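(* For every integer $N\ge 2$, the Lebesgue measure of $W_N\subset\mathbb R^{N-1}$ is $$\mathrm{vol}(W_N)=\frac{2^{N-1}\pi^{(N-1)/2}}{\Gamma\!\left(\frac{N+1}{2}\right)},$$ i.e. it equals the volume of the $(N-1)$-dimensional ball of radius $2$.
   Context: Let $N\ge 2$ be an integer and $\mathbb T=\{z\in\mathbb C:|z|=1\}$. For $\mathbf a=(a_1,\dots,a_{N-1})\in\mathbb R^{N-1}$ define $\mathbf c=(c_1,\dots,c_{N-1})\in\mathbb C^{N-1}$ by $c_j=\frac{\sqrt2}{2}(a_j+i\,a_{N-j})$ for $1\le j<N/2$, $c_{N/2}=a_{N/2}$ (only when $N$ is even), and $c_j=\frac{\sqrt2}{2}(a_{N-j}-i\,a_j)$ for $N/2<j\le N-1$ (so $c_{N-j}=\overline{c_j}$ and $\|\mathbf c\|=\|\mathbf a\|$). Associate to $\mathbf a$ the monic polynomial $\mathbf a(x)=x^N+\sum_{n=1}^{N-1}c_nx^{N-n}+1$. Define $W_N=\{\mathbf a\in\mathbb R^{N-1}:\text{all roots of }\mathbf a(x)\text{ lie in }\mathbb T\}$. *)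

theory Defs
  imports "HOL-Analysis.Analysis" "HOL-Computational_Algebra.Polynomial"
begin

text \<open>Points of R^(N-1) are represented as functions a :: nat => real, indexed by {1..N-1}
  (extensional, i.e. elements of PiE {1..N-1} (%_. UNIV)).\<close>

definition coeff_c :: "nat \<Rightarrow> (nat \<Rightarrow> real) \<Rightarrow> nat \<Rightarrow> complex" where
  "coeff_c N a j =
     (if 2 * j < N then complex_of_real (sqrt 2 / 2) * (complex_of_real (a j) + \<i> * complex_of_real (a (N - j)))
      else if 2 * j = N then complex_of_real (a j)
      else complex_of_real (sqrt 2 / 2) * (complex_of_real (a (N - j)) - \<i> * complex_of_real (a j)))"

definition assoc_poly :: "nat \<Rightarrow> (nat \<Rightarrow> real) \<Rightarrow> complex poly" where
  "assoc_poly N a = monom 1 N + (\<Sum>n = 1..N - 1. monom (coeff_c N a n) (N - n)) + 1"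

definition W :: "nat \<Rightarrow> (nat \<Rightarrow> real) set" where
  "W N = {a \<in> PiE {1..N - 1} (\<lambda>_. UNIV).
            \<forall>z. poly (assoc_poly N a) z = 0 \<longrightarrow> z \<in> sphere 0 1}"

end

theory Submission
  imports Defs "HOL-Computational_Algebra.Fundamental_Theorem_Algebra"
begin

text \<open>
  Write \<open>N = n + 1\<close>. Every monic polynomial \<open>\<phi>\<close> of degree \<open>n\<close> yields a conjugate reciprocal
  polynomial \<open>p x = x * \<phi> x + \<phi>\<^sup>* x\<close> of degree \<open>N\<close>, where \<open>\<phi>\<^sup>*\<close> is the reversed polynomial.
  If \<open>p\<close> has simple zeros \<open>z j\<close> on the unit circle, the \<open>\<phi>\<close> above \<open>p\<close> are given by their masses
  \<open>\<mu> j = \<phi> (z j) / p' (z j)\<close>, which are real with sum \<open>1\<close>; all zeros of \<open>\<phi>\<close> lie in the open disk iff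
  all masses are positive; and the resultant \<open>R \<phi>\<close> of \<open>\<phi>\<close> and \<open>\<phi>\<^sup>*\<close> is \<open>\<Prod>j. \<mu> j * \<bar>p' (z j)\<bar>\<close>
  in absolute value. As the Jacobian of the masses is proportional to \<open>\<Prod>j. \<bar>p' (z j)\<bar> powr (-1/2)\<close>, the
  integral of \<open>R powr (-1/2)\<close> over the fibre above \<open>p\<close> is a Dirichlet integral that does not depend
  on \<open>p\<close>. So the volume in question is, up to a constant, the integral of \<open>R powr (-1/2)\<close> over
  all \<open>\<phi>\<close> with zeros in the open disk. The Schur recursion
  \<open>\<phi> x \<mapsto> x * \<phi> x + b * \<phi>\<^sup>* x\<close> with \<open>\<bar>b\<bar> < 1\<close> turns that integral into a product of elementary integrals
  over the disk. Since the dimension varies, all Jacobians are obtained from shears and Fubini.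
\<close>

text \<open>The exponent -1/2 is forced. Let P be the product of all |p'(z_j)|. R is P times the
  product of the masses, and the real Jacobian of the masses is a constant times P^(-1/2), so the
  integral of R^s over the fibre is P^(s + 1/2) times a quantity independent of p. Two obstacles
  shape the rest. First, the fibre is a real affine space, while the evaluation nodes are complex;
  the real Jacobian is therefore read off as the square root of the factor of the complexified map.
  Second, masses exist only when the zeros are simple. Nothing with zeros in the open disk lies
  above any other p, so the weighted integral sees only \<open>W_simple\<close>. Its complement in
  \<open>W\<close> is controlled by diagonal maps that send \<open>W\<close> into
  \<open>W_simple\<close> and have determinants tending to 1; these maps also yield the
  measurability of \<open>W\<close>. The constant comes from 2^n * C * vol * 4^(-n) = (2 pi)^n / n!,
  where C = Gamma(1/2)^(n+1) / Gamma((n+1)/2) is the Dirichlet integral; Legendre duplication brings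
  it to the stated form.\<close>

section \<open>Maps that scale Lebesgue measure on a finite product\<close>

text \<open>For an invertible affine \<open>T\<close>, the factor \<open>c\<close> is the absolute value of the determinant.\<close>

definition scales :: "'a measure \<Rightarrow> ('a \<Rightarrow> 'a) \<Rightarrow> ennreal \<Rightarrow> bool" where
  "scales M T c \<longleftrightarrow> T \<in> M \<rightarrow>\<^sub>M M \<and>
     (\<forall>f \<in> borel_measurable M. (\<integral>\<^sup>+x. f (T x) \<partial>M) * c = (\<integral>\<^sup>+x. f x \<partial>M))"

lemma scales_measurable: "scales M T c \<Longrightarrow> T \<in> M \<rightarrow>\<^sub>M M"
  by (simp add: scales_def)

lemma scalesD: "scales M T c \<Longrightarrow> f \<in> borel_measurable M \<Longrightarrow>
    (\<integral>\<^sup>+x. f (T x) \<partial>M) * c = (\<integral>\<^sup>+x. f x \<partial>M)"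
  by (simp add: scales_def)

lemma scales_compose:
  assumes S: "scales M S c" and T: "scales M T d"
  shows "scales M (\<lambda>x. S (T x)) (c * d)"
  unfolding scales_def
proof (intro conjI ballI)
  show "(\<lambda>x. S (T x)) \<in> M \<rightarrow>\<^sub>M M"
    using measurable_compose[OF scales_measurable[OF T] scales_measurable[OF S]] .
  fix f :: "'a \<Rightarrow> ennreal" assume f: "f \<in> borel_measurable M"
  have "(\<lambda>x. f (S x)) \<in> borel_measurable M"
    using measurable_compose[OF scales_measurable[OF S] f] .
  from scalesD[OF T this] have "(\<integral>\<^sup>+x. f (S (T x)) \<partial>M) * d = (\<integral>\<^sup>+x. f (S x) \<partial>M)" .
  then show "(\<integral>\<^sup>+x. f (S (T x)) \<partial>M) * (c * d) = (\<integral>\<^sup>+x. f x \<partial>M)"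
    using scalesD[OF S f] by (simp add: mult.commute mult.left_commute mult.assoc)
qed

lemma scales_cong:
  assumes "scales M T c" and eq: "\<And>x. x \<in> space M \<Longrightarrow> T x = S x" and "c = d"
  shows "scales M S d"
  unfolding scales_def
proof (intro conjI ballI)
  show "S \<in> M \<rightarrow>\<^sub>M M"
    using assms(1) measurable_cong[of M T S M] eq by (simp add: scales_def)
  fix f :: "'a \<Rightarrow> ennreal" assume f: "f \<in> borel_measurable M"
  have "(\<integral>\<^sup>+x. f (S x) \<partial>M) = (\<integral>\<^sup>+x. f (T x) \<partial>M)"
    by (rule nn_integral_cong) (simp add: eq)
  then show "(\<integral>\<^sup>+x. f (S x) \<partial>M) * d = (\<integral>\<^sup>+x. f x \<partial>M)"
    using scalesD[OF assms(1) f] assms(3) by simp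
qed

lemma scales_inverse:
  assumes T: "scales M T c" and S: "S \<in> M \<rightarrow>\<^sub>M M"
    and inv: "\<And>x. x \<in> space M \<Longrightarrow> S (T x) = x" and cd: "c * d = 1"
  shows "scales M S d"
  unfolding scales_def
proof (intro conjI ballI S)
  fix f :: "'a \<Rightarrow> ennreal" assume f: "f \<in> borel_measurable M"
  have "(\<lambda>x. f (S x)) \<in> borel_measurable M"
    using measurable_compose[OF S f] .
  from scalesD[OF T this] have "(\<integral>\<^sup>+x. f (S x) \<partial>M) = (\<integral>\<^sup>+x. f (S (T x)) \<partial>M) * c" ..
  also have "(\<integral>\<^sup>+x. f (S (T x)) \<partial>M) = (\<integral>\<^sup>+x. f x \<partial>M)"
    by (rule nn_integral_cong) (simp add: inv)
  finally show "(\<integral>\<^sup>+x. f (S x) \<partial>M) * d = (\<integral>\<^sup>+x. f x \<partial>M)"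
    using cd by (simp add: mult.assoc)
qed

abbreviation lborels :: "nat set \<Rightarrow> (nat \<Rightarrow> 'a :: euclidean_space) measure" where
  "lborels I \<equiv> Pi\<^sub>M I (\<lambda>_. lborel)"

interpretation lborels: product_sigma_finite "\<lambda>_::nat. (lborel :: 'a::euclidean_space measure)"
  by standard

text \<open>Induction on the index set: Fubini separates one coordinate, whose inner integral
  absorbs \<open>c i\<close>, and the induction hypothesis handles the resulting function of the
  others.\<close>

lemma scales_lborels_coordinatewise:
  fixes g :: "nat \<Rightarrow> 'a::euclidean_space \<Rightarrow> 'a"
  assumes "finite I" and "\<And>k. k \<in> I \<Longrightarrow> scales lborel (g k) (c k)"
  shows "scales (lborels I) (\<lambda>x. \<lambda>k\<in>I. g k (x k)) (\<Prod>k\<in>I. c k)"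
  using assms
proof (induction I rule: finite_induct)
  case empty
  have "space (lborels {} :: (nat \<Rightarrow> 'a) measure) = {\<lambda>k. undefined}"
    by (simp add: space_PiM)
  then show ?case
    unfolding scales_def
    by (intro conjI ballI measurable_restrict) (simp_all add: lborels.nn_integral_empty restrict_def)
next
  case (insert i I)
  have gm [measurable]: "g k \<in> borel_measurable borel" if "k \<in> insert i I" for k
    using scales_measurable[OF insert.prems[OF that]] by simp
  have IH: "scales (lborels I) (\<lambda>x. \<lambda>k\<in>I. g k (x k)) (\<Prod>k\<in>I. c k)"
    using insert by blast
  have IHm [measurable]: "(\<lambda>x. \<lambda>k\<in>I. g k (x k)) \<in> lborels I \<rightarrow>\<^sub>M lborels I"
    using scales_measurable[OF IH] .
  show ?case
    unfolding scales_def
  proof (intro conjI ballI)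
    show m [measurable]: "(\<lambda>x. \<lambda>k\<in>insert i I. g k (x k)) \<in> lborels (insert i I) \<rightarrow>\<^sub>M lborels (insert i I)"
      by (rule measurable_restrict) (use gm in \<open>auto intro!: measurable_compose[OF measurable_component_singleton]\<close>)
    fix f :: "(nat \<Rightarrow> 'a) \<Rightarrow> ennreal" assume f [measurable]: "f \<in> borel_measurable (lborels (insert i I))"
    have [measurable]: "(\<lambda>x. f (x(i := y))) \<in> borel_measurable (lborels I)" for y
      by measurable
    have [measurable]: "(\<lambda>y. f (x(i := y))) \<in> borel_measurable borel" if [measurable]: "x \<in> space (lborels I)" for x
    proof -
      have "(\<lambda>y. x(i := y)) \<in> borel \<rightarrow>\<^sub>M lborels (insert i I)"
        using measurable_fun_upd[where I="insert i I" and J=I and i=i and f="\<lambda>_. x" and h="\<lambda>y. y" and M="\<lambda>_. lborel" and N=borel]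
        that by (auto simp: measurable_const)
      then show ?thesis by (rule measurable_compose) (rule f)
    qed
    have upd: "(\<lambda>k\<in>insert i I. g k ((x(i := y)) k)) = (\<lambda>k\<in>I. g k (x k))(i := g i y)" for x y
      using insert.hyps by (auto simp: fun_eq_iff)
    have "(\<integral>\<^sup>+x. f (\<lambda>k\<in>insert i I. g k (x k)) \<partial>lborels (insert i I))
        = (\<integral>\<^sup>+x. (\<integral>\<^sup>+y. f ((\<lambda>k\<in>I. g k (x k))(i := g i y)) \<partial>lborel) \<partial>lborels I)"
      by (subst lborels.product_nn_integral_insert[OF insert.hyps measurable_compose[OF m f]]) (simp only: upd)
    also have "\<dots> * c i = (\<integral>\<^sup>+x. (\<integral>\<^sup>+y. f ((\<lambda>k\<in>I. g k (x k))(i := g i y)) \<partial>lborel) * c i \<partial>lborels I)"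
    proof (rule nn_integral_multc[symmetric])
      show "(\<lambda>x. \<integral>\<^sup>+ y. f ((\<lambda>k\<in>I. g k (x k))(i := g i y)) \<partial>lborel) \<in> borel_measurable (lborels I)"
        by (rule lborel.borel_measurable_nn_integral) (simp, measurable)
    qed
    also have "\<dots> = (\<integral>\<^sup>+x. (\<integral>\<^sup>+y. f ((\<lambda>k\<in>I. g k (x k))(i := y)) \<partial>lborel) \<partial>lborels I)"
    proof (rule nn_integral_cong)
      fix x :: "nat \<Rightarrow> 'a" assume "x \<in> space (lborels I)"
      then have "(\<lambda>k\<in>I. g k (x k)) \<in> space (lborels I)" by (auto simp: space_PiM)
      then show "(\<integral>\<^sup>+y. f ((\<lambda>k\<in>I. g k (x k))(i := g i y)) \<partial>lborel) * c i
           = (\<integral>\<^sup>+y. f ((\<lambda>k\<in>I. g k (x k))(i := y)) \<partial>lborel)"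
        using scalesD[OF insert.prems[of i], of "\<lambda>y. f ((\<lambda>k\<in>I. g k (x k))(i := y))"] by simp
    qed
    also have "\<dots> * (\<Prod>k\<in>I. c k) = (\<integral>\<^sup>+x. (\<integral>\<^sup>+y. f (x(i := y)) \<partial>lborel) \<partial>lborels I)"
      by (rule scalesD[OF IH, of "\<lambda>x. (\<integral>\<^sup>+y. f (x(i := y)) \<partial>lborel)"]) measurable
    also have "\<dots> = (\<integral>\<^sup>+x. f x \<partial>lborels (insert i I))"
      by (subst lborels.product_nn_integral_insert) (use insert.hyps f in auto)
    finally show "(\<integral>\<^sup>+x. f (\<lambda>k\<in>insert i I. g k (x k)) \<partial>lborels (insert i I)) * (\<Prod>k\<in>insert i I. c k)
       = (\<integral>\<^sup>+x. f x \<partial>lborels (insert i I))"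
      using insert.hyps by (simp add: mult.assoc)
  qed
qed


text \<open>With the \<open>B\<close> coordinates frozen the map is coordinatewise on
  \<open>A\<close>, so Fubini applies. The reflection, the fibre coordinates and the evaluation maps
  below are factored into such triangular pieces, which works uniformly in the dimension.\<close>

lemma scales_lborels_shear:
  fixes g :: "nat \<Rightarrow> (nat \<Rightarrow> 'a::euclidean_space) \<Rightarrow> 'a \<Rightarrow> 'a"
  assumes fin: "finite A" "finite B" and disj: "A \<inter> B = {}"
    and g: "\<And>k y. k \<in> A \<Longrightarrow> y \<in> space (lborels B) \<Longrightarrow> scales lborel (g k y) (c k)"
    and m [measurable]: "\<And>k. k \<in> A \<Longrightarrow> (\<lambda>(y, t). g k y t) \<in> borel_measurable (lborels B \<Otimes>\<^sub>M lborel)"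
  shows "scales (lborels (B \<union> A))
     (\<lambda>x. \<lambda>k\<in>B \<union> A. if k \<in> A then g k (restrict x B) (x k) else x k) (\<Prod>k\<in>A. c k)"
  unfolding scales_def
proof (intro conjI ballI)
  let ?T = "\<lambda>x. \<lambda>k\<in>B \<union> A. if k \<in> A then g k (restrict x B) (x k) else x k"
  have "(\<lambda>x. if k \<in> A then g k (restrict x B) (x k) else x k) \<in> borel_measurable (lborels (B \<union> A))"
    if k: "k \<in> B \<union> A" for k
  proof (cases "k \<in> A")
    case True
    have "(\<lambda>x. (restrict x B, x k)) \<in> lborels (B \<union> A) \<rightarrow>\<^sub>M lborels B \<Otimes>\<^sub>M lborel"
      using k by (intro measurable_Pair measurable_restrict_subset measurable_component_singleton) auto
    from measurable_compose[OF this m[OF True]] True show ?thesis by simp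
  qed (use k in \<open>auto intro!: measurable_compose[OF measurable_component_singleton]\<close>)
  then show mT [measurable]: "?T \<in> lborels (B \<union> A) \<rightarrow>\<^sub>M lborels (B \<union> A)"
    by (intro measurable_restrict) simp
  fix f :: "(nat \<Rightarrow> 'a) \<Rightarrow> ennreal" assume f [measurable]: "f \<in> borel_measurable (lborels (B \<union> A))"
  have fm [measurable]: "(\<lambda>z. f (merge B A z)) \<in> borel_measurable (lborels B \<Otimes>\<^sub>M lborels A)"
    by measurable
  interpret SA: sigma_finite_measure "lborels A :: (nat \<Rightarrow> 'a) measure"
    by (rule lborels.sigma_finite) fact
  have mm: "(\<lambda>z. f (?T (merge B A z))) \<in> borel_measurable (lborels B \<Otimes>\<^sub>M lborels A)"
    by (rule measurable_compose[OF measurable_merge]) measurable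
  have merge_T: "?T (merge B A (y, x)) = merge B A (y, \<lambda>k\<in>A. g k y (x k))"
    if "y \<in> space (lborels B)" for x y
  proof -
    have r: "restrict (merge B A (y, x)) B = y" using that disj
      by (auto simp: space_PiM restrict_def merge_def fun_eq_iff PiE_def extensional_def)
    show ?thesis unfolding r
    proof
      fix k
      show "(\<lambda>k\<in>B \<union> A. if k \<in> A then g k y (merge B A (y, x) k) else merge B A (y, x) k) k
          = merge B A (y, \<lambda>k\<in>A. g k y (x k)) k"
        using disj by (cases "k \<in> A"; cases "k \<in> B") (auto simp: merge_def)
    qed
  qed
  have inner: "(\<integral>\<^sup>+x. f (?T (merge B A (y, x))) \<partial>lborels A) * (\<Prod>k\<in>A. c k)
     = (\<integral>\<^sup>+x. f (merge B A (y, x)) \<partial>lborels A)" if y: "y \<in> space (lborels B)" for y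
  proof -
    have "(\<lambda>x. f (merge B A (y, x))) \<in> borel_measurable (lborels A)"
      using measurable_compose[OF measurable_Pair1'[OF y] fm] .
    from scalesD[OF scales_lborels_coordinatewise[OF fin(1), of "\<lambda>k. g k y" c] this] g[OF _ y] y
    show ?thesis by (simp add: merge_T)
  qed
  have "(\<integral>\<^sup>+x. f (?T x) \<partial>lborels (B \<union> A)) * (\<Prod>k\<in>A. c k)
      = (\<integral>\<^sup>+y. (\<integral>\<^sup>+x. f (?T (merge B A (y, x))) \<partial>lborels A) * (\<Prod>k\<in>A. c k) \<partial>lborels B)"
    using fin disj by (subst lborels.product_nn_integral_fold)
      (auto simp: Int_commute intro!: nn_integral_multc[symmetric] SA.borel_measurable_nn_integral mm[simplified])
  also have "\<dots> = (\<integral>\<^sup>+y. (\<integral>\<^sup>+x. f (merge B A (y, x)) \<partial>lborels A) \<partial>lborels B)"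
    by (rule nn_integral_cong) (rule inner)
  also have "\<dots> = (\<integral>\<^sup>+x. f x \<partial>lborels (B \<union> A))"
    using fin disj by (subst lborels.product_nn_integral_fold) (auto simp: Int_commute)
  finally show "(\<integral>\<^sup>+x. f (?T x) \<partial>lborels (B \<union> A)) * (\<Prod>k\<in>A. c k) = (\<integral>\<^sup>+x. f x \<partial>lborels (B \<union> A))" .
qed

section \<open>Affine maps of a Euclidean space and of the complex plane\<close>

lemma scales_lborel_affine:
  fixes t :: "'a::euclidean_space"
  assumes "r \<noteq> 0"
  shows "scales lborel (\<lambda>x. t + r *\<^sub>R x) (\<bar>r\<bar> ^ DIM('a))"
  unfolding scales_def
proof (intro conjI ballI)
  fix f :: "'a \<Rightarrow> ennreal" assume [measurable]: "f \<in> borel_measurable lborel"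
  show "(\<integral>\<^sup>+x. f (t + r *\<^sub>R x) \<partial>lborel) * (\<bar>r\<bar> ^ DIM('a)) = (\<integral>\<^sup>+x. f x \<partial>lborel)"
    by (subst (2) lborel_affine[OF assms, of t])
       (simp add: nn_integral_density nn_integral_distr nn_integral_cmult mult.commute)
qed simp

lemma nn_integral_lborel_complex:
  assumes [measurable]: "f \<in> borel_measurable borel"
  shows "(\<integral>\<^sup>+z. f z \<partial>lborel) = (\<integral>\<^sup>+x. \<integral>\<^sup>+y. f (Complex x y) \<partial>lborel \<partial>lborel)"
proof -
  have m [measurable]: "(\<lambda>(x, y). Complex x y) \<in> borel_measurable (borel \<Otimes>\<^sub>M borel)"
    by (subst borel_prod) (auto intro!: borel_measurable_continuous_onI continuous_intros simp: case_prod_beta Complex_eq)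
  have "lborel = distr (lborel \<Otimes>\<^sub>M lborel) borel (\<lambda>(x, y). Complex x y)"
  proof (rule lborel_eqI)
    fix l u :: complex assume lu: "\<And>b. b \<in> Basis \<Longrightarrow> l \<bullet> b \<le> u \<bullet> b"
    have le: "Re l \<le> Re u" "Im l \<le> Im u" using lu[of 1] lu[of \<i>] by (auto simp: Basis_complex_def)
    have "(\<lambda>(x, y). Complex x y) -` box l u \<inter> space (lborel \<Otimes>\<^sub>M lborel) = {Re l <..< Re u} \<times> {Im l <..< Im u}"
      by (auto simp: box_def Basis_complex_def space_pair_measure)
    then show "emeasure (distr (lborel \<Otimes>\<^sub>M lborel) borel (\<lambda>(x, y). Complex x y)) (box l u) = (\<Prod>b\<in>Basis. (u - l) \<bullet> b)"
      using le by (subst emeasure_distr)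
       (auto simp: lborel.emeasure_pair_measure_Times Basis_complex_def ennreal_mult complex_eq_iff)
  qed simp
  then have "(\<integral>\<^sup>+z. f z \<partial>lborel) = (\<integral>\<^sup>+z. f z \<partial>distr (lborel \<Otimes>\<^sub>M lborel) borel (\<lambda>(x, y). Complex x y))"
    by simp
  also have "\<dots> = (\<integral>\<^sup>+z. f (case z of (x, y) \<Rightarrow> Complex x y) \<partial>(lborel \<Otimes>\<^sub>M lborel))"
    by (subst nn_integral_distr) auto
  also have "\<dots> = (\<integral>\<^sup>+x. \<integral>\<^sup>+y. f (Complex x y) \<partial>lborel \<partial>lborel)"
    by (subst lborel.nn_integral_fst[symmetric]) auto
  finally show ?thesis .
qed

lemma nn_integral_lborel_scale:
  fixes f :: "real \<Rightarrow> ennreal"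
  assumes "f \<in> borel_measurable borel" "r \<noteq> 0"
  shows "(\<integral>\<^sup>+x. f (r * x + t) \<partial>lborel) * ennreal \<bar>r\<bar> = (\<integral>\<^sup>+x. f x \<partial>lborel)"
  using scalesD[OF scales_lborel_affine[OF assms(2), of t], of f] assms by (simp add: add.commute)

text \<open>Gaussian elimination carried out as two substitutions on the line; a vanishing pivot
  \<open>p\<close> is met by exchanging the variables.\<close>

lemma scales_complex_real_linear:
  assumes D: "p * s - q * r \<noteq> 0"
  shows "scales lborel (\<lambda>z. Complex (p * Re z + q * Im z) (r * Re z + s * Im z)) \<bar>p * s - q * r\<bar>"
  unfolding scales_def
proof (intro conjI ballI)
  have cm [measurable]: "(\<lambda>x. Complex (g x) (h x)) \<in> borel_measurable M"
    if [measurable]: "g \<in> borel_measurable M" "h \<in> borel_measurable M" for g h and M :: "'z measure"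
    unfolding Complex_eq by measurable
  show "(\<lambda>z. Complex (p * Re z + q * Im z) (r * Re z + s * Im z)) \<in> lborel \<rightarrow>\<^sub>M lborel"
    by measurable
  fix f :: "complex \<Rightarrow> ennreal" assume [measurable]: "f \<in> borel_measurable lborel"
  let ?F = "\<lambda>u v. f (Complex (p * u + q * v) (r * u + s * v))"
  have "(\<integral>\<^sup>+u. \<integral>\<^sup>+v. ?F u v \<partial>lborel \<partial>lborel) * \<bar>p * s - q * r\<bar>
      = (\<integral>\<^sup>+x. \<integral>\<^sup>+y. f (Complex x y) \<partial>lborel \<partial>lborel)"
  proof (cases "p = 0")
    case False
    \<comment> \<open>The pivot left after elimination: the second component is \<open>r / p\<close>
      times the first plus \<open>e * v\<close>, and the determinant splits as
      \<open>p * e\<close>.\<close>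
    define e where "e = (p * s - q * r) / p"
    have ep: "p * s - q * r = p * e" and e0: "e \<noteq> 0" using False D by (simp_all add: e_def)
    have D': "ennreal \<bar>p * s - q * r\<bar> = ennreal \<bar>p\<bar> * ennreal \<bar>e\<bar>"
      by (subst ennreal_mult[symmetric]) (simp_all add: ep abs_mult)
    have 1: "(\<integral>\<^sup>+u. ?F u v \<partial>lborel) * \<bar>p\<bar>
       = (\<integral>\<^sup>+u. f (Complex u (e * v + r / p * u)) \<partial>lborel)" for v
    proof -
      have e_eq: "r * u + s * v = e * v + r / p * (p * u + q * v)" for u
        using False by (simp add: e_def field_simps)
      show ?thesis unfolding e_eq
        by (rule nn_integral_lborel_scale[of "\<lambda>x. f (Complex x (e * v + r / p * x))"])
          (use False in auto)
    qed
    have "(\<integral>\<^sup>+u. \<integral>\<^sup>+v. ?F u v \<partial>lborel \<partial>lborel) * \<bar>p\<bar> = (\<integral>\<^sup>+v. (\<integral>\<^sup>+u. ?F u v \<partial>lborel) * \<bar>p\<bar> \<partial>lborel)"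
      by (subst lborel_pair.Fubini') (auto simp: nn_integral_multc)
    also have "\<dots> = (\<integral>\<^sup>+v. \<integral>\<^sup>+u. f (Complex u (e * v + r / p * u)) \<partial>lborel \<partial>lborel)"
      by (simp add: 1)
    also have "\<dots> = (\<integral>\<^sup>+u. \<integral>\<^sup>+v. f (Complex u (e * v + r / p * u)) \<partial>lborel \<partial>lborel)"
      by (subst lborel_pair.Fubini') auto
    also have "\<dots> * ennreal \<bar>e\<bar>
       = (\<integral>\<^sup>+u. (\<integral>\<^sup>+v. f (Complex u (e * v + r / p * u)) \<partial>lborel) * ennreal \<bar>e\<bar> \<partial>lborel)"
      by (auto simp: nn_integral_multc)
    also have "\<dots> = (\<integral>\<^sup>+x. \<integral>\<^sup>+y. f (Complex x y) \<partial>lborel \<partial>lborel)"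
    proof (rule nn_integral_cong)
      fix u
      show "(\<integral>\<^sup>+v. f (Complex u (e * v + r / p * u)) \<partial>lborel) * ennreal \<bar>e\<bar>
          = (\<integral>\<^sup>+y. f (Complex u y) \<partial>lborel)"
        using nn_integral_lborel_scale[of "\<lambda>v. f (Complex u v)" "e" "r / p * u"] e0
        by simp
    qed
    finally show ?thesis unfolding D' by (simp add: mult.assoc)
  next
    case True
    have qr: "q \<noteq> 0" "r \<noteq> 0" using D True by auto
    have D': "ennreal \<bar>p * s - q * r\<bar> = ennreal \<bar>q\<bar> * ennreal \<bar>r\<bar>"
      using True by (simp add: ennreal_mult[symmetric] abs_mult)
    have 1: "(\<integral>\<^sup>+v. ?F u v \<partial>lborel) * \<bar>q\<bar> = (\<integral>\<^sup>+v. f (Complex v (r * u + s / q * v)) \<partial>lborel)" for u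
    proof -
      have e: "r * u + s * v = r * u + s / q * (q * v + 0)" for v using qr by simp
      show ?thesis unfolding e using nn_integral_lborel_scale[of "\<lambda>v. f (Complex v (r * u + s / q * v))" q 0] qr True
        by simp
    qed
    have "(\<integral>\<^sup>+u. \<integral>\<^sup>+v. ?F u v \<partial>lborel \<partial>lborel) * \<bar>q\<bar> = (\<integral>\<^sup>+u. (\<integral>\<^sup>+v. ?F u v \<partial>lborel) * \<bar>q\<bar> \<partial>lborel)"
      by (auto simp: nn_integral_multc)
    also have "\<dots> = (\<integral>\<^sup>+u. \<integral>\<^sup>+v. f (Complex v (r * u + s / q * v)) \<partial>lborel \<partial>lborel)"
      by (simp add: 1)
    also have "\<dots> = (\<integral>\<^sup>+v. \<integral>\<^sup>+u. f (Complex v (r * u + s / q * v)) \<partial>lborel \<partial>lborel)"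
      by (subst lborel_pair.Fubini') auto
    also have "\<dots> * \<bar>r\<bar> = (\<integral>\<^sup>+v. (\<integral>\<^sup>+u. f (Complex v (r * u + s / q * v)) \<partial>lborel) * \<bar>r\<bar> \<partial>lborel)"
      by (auto simp: nn_integral_multc)
    also have "\<dots> = (\<integral>\<^sup>+x. \<integral>\<^sup>+y. f (Complex x y) \<partial>lborel \<partial>lborel)"
    proof (rule nn_integral_cong)
      fix v
      show "(\<integral>\<^sup>+u. f (Complex v (r * u + s / q * v)) \<partial>lborel) * \<bar>r\<bar> = (\<integral>\<^sup>+y. f (Complex v y) \<partial>lborel)"
        using nn_integral_lborel_scale[of "\<lambda>u. f (Complex v u)" r "s / q * v"] qr by simp
    qed
    finally show ?thesis unfolding D' by (simp add: mult.assoc)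
  qed
  then show "(\<integral>\<^sup>+z. f (Complex (p * Re z + q * Im z) (r * Re z + s * Im z)) \<partial>lborel) * \<bar>p * s - q * r\<bar>
      = (\<integral>\<^sup>+z. f z \<partial>lborel)"
    by (subst (1 2) nn_integral_lborel_complex) auto
qed

text \<open>Multiplication by \<open>w\<close> has the real matrix with rows (Re w, -Im w) and (Im
  w, Re w), whose determinant is |w|^2.\<close>

lemma scales_complex_affine:
  fixes w t :: complex
  assumes "w \<noteq> 0"
  shows "scales lborel (\<lambda>z. w * z + t) ((norm w)\<^sup>2)"
proof -
  have n: "Re w * Re w - (- Im w) * Im w = (norm w)\<^sup>2"
    by (simp add: cmod_def power2_eq_square[symmetric])
  have "Re w * Re w - (- Im w) * Im w \<noteq> 0" unfolding n using assms by simp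
  from scales_complex_real_linear[OF this]
  have 1: "scales lborel (\<lambda>z. w * z) ((norm w)\<^sup>2)"
    by (rule scales_cong) (simp_all only: n, simp_all add: complex_eq_iff)
  have 2: "scales lborel (\<lambda>z. z + t) 1"
    by (rule scales_cong[OF scales_lborel_affine[of 1 t]]) auto
  show ?thesis using scales_compose[OF 2 1] by simp
qed

text \<open>The conjugate makes the map only real-linear. It is the action of a Schur step on the
  self-paired middle coefficient, where k = n + 1 - k.\<close>

lemma scales_complex_add_cnj:
  assumes "norm b < 1"
  shows "scales lborel (\<lambda>z. z + b * cnj z) (1 - (norm b)\<^sup>2)"
proof -
  have n: "(1 + Re b) * (1 - Re b) - Im b * Im b = 1 - (norm b)\<^sup>2"
    by (simp add: cmod_def power2_eq_square[symmetric] algebra_simps)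
  have "(norm b)\<^sup>2 < 1" using assms by (simp add: power_less_one_iff abs_square_less_1)
  then show ?thesis
    by (intro scales_cong[OF scales_complex_real_linear[of "1 + Re b" "1 - Re b" "Im b" "Im b"]])
       (simp_all only: n, simp_all add: complex_eq_iff algebra_simps)
qed

section \<open>Polynomials with zeros in the open disk\<close>

text \<open>A polynomial is represented by its coefficient function on {1..n}, that is, by a point
  of \<open>lborels {1..n}\<close>. The leading 1 is implicit, and indices count down from the top
  as in \<open>assoc_poly\<close>.\<close>

definition monic_eval :: "nat \<Rightarrow> (nat \<Rightarrow> complex) \<Rightarrow> complex \<Rightarrow> complex" where
  "monic_eval n \<phi> x = x ^ n + (\<Sum>k = 1..n. \<phi> k * x ^ (n - k))"

definition reversed_eval :: "nat \<Rightarrow> (nat \<Rightarrow> complex) \<Rightarrow> complex \<Rightarrow> complex" where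
  "reversed_eval n \<phi> x = 1 + (\<Sum>k = 1..n. cnj (\<phi> k) * x ^ k)"

definition monic_poly :: "nat \<Rightarrow> (nat \<Rightarrow> complex) \<Rightarrow> complex poly" where
  "monic_poly n \<phi> = monom 1 n + (\<Sum>k = 1..n. monom (\<phi> k) (n - k))"

lemma poly_monic_poly: "poly (monic_poly n \<phi>) = monic_eval n \<phi>"
  by (simp add: fun_eq_iff monic_poly_def monic_eval_def poly_monom poly_sum)

lemma coeff_monic_poly_ge: "m \<ge> n \<Longrightarrow> coeff (monic_poly n \<phi>) m = (if m = n then 1 else 0)"
  by (auto simp: monic_poly_def coeff_sum intro!: sum.neutral)

lemma degree_monic_poly: "degree (monic_poly n \<phi>) = n"
  using coeff_monic_poly_ge[of n _ \<phi>] by (intro antisym degree_le le_degree) auto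

lemma lead_coeff_monic_poly: "lead_coeff (monic_poly n \<phi>) = 1"
  by (simp add: degree_monic_poly coeff_monic_poly_ge)

definition is_roots :: "nat \<Rightarrow> (nat \<Rightarrow> complex) \<Rightarrow> (nat \<Rightarrow> complex) \<Rightarrow> bool" where
  "is_roots n \<phi> w \<longleftrightarrow> (\<forall>x. monic_eval n \<phi> x = (\<Prod>i<n. x - w i))"

lemma exists_roots: "\<exists>w. is_roots n \<phi> w"
proof -
  obtain w where w: "smult (lead_coeff (monic_poly n \<phi>)) (\<Prod>i<degree (monic_poly n \<phi>). [:-w i, 1:]) = monic_poly n \<phi>"
    by (rule complex_poly_decompose')
  then have "monic_poly n \<phi> = (\<Prod>i<n. [:-w i, 1:])" by (simp add: degree_monic_poly lead_coeff_monic_poly coeff_monic_poly_ge)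
  then have "monic_eval n \<phi> x = (\<Prod>i<n. x - w i)" for x
    unfolding poly_monic_poly[symmetric] by (simp add: poly_prod)
  then show ?thesis unfolding is_roots_def by blast
qed

lemma reversed_eval_eq: "x \<noteq> 0 \<Longrightarrow> reversed_eval n \<phi> x = x ^ n * cnj (monic_eval n \<phi> (1 / cnj x))"
  by (auto simp: monic_eval_def reversed_eval_def power_one_over algebra_simps sum_distrib_left power_diff
      intro!: sum.cong)

lemma reversed_eval_factor:
  assumes "is_roots n \<phi> w"
  shows "reversed_eval n \<phi> x = (\<Prod>i<n. 1 - cnj (w i) * x)"
proof (cases "x = 0")
  case False
  have "reversed_eval n \<phi> x = (\<Prod>i<n. x) * (\<Prod>i<n. 1 / x - cnj (w i))"
    using assms False by (simp add: reversed_eval_eq is_roots_def)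
  also have "\<dots> = (\<Prod>i<n. x * (1 / x - cnj (w i)))" by (simp only: prod.distrib)
  finally show ?thesis using False by (simp add: algebra_simps)
qed (simp add: reversed_eval_def)

lemma reversed_eval_unit: "norm x = 1 \<Longrightarrow> reversed_eval n \<phi> x = x ^ n * cnj (monic_eval n \<phi> x)"
proof -
  assume "norm x = 1"
  then have "x \<noteq> 0" "1 / cnj x = x"
    by (auto simp: divide_eq_eq complex_norm_square[symmetric])
  then show ?thesis by (simp add: reversed_eval_eq)
qed

section \<open>Schur-stable polynomials and the Schur recursion\<close>

definition Schur :: "nat \<Rightarrow> (nat \<Rightarrow> complex) \<Rightarrow> bool" where
  "Schur n \<phi> \<longleftrightarrow> (\<forall>x. monic_eval n \<phi> x = 0 \<longrightarrow> norm x < 1)"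

lemma is_roots_zero: "is_roots n \<phi> w \<Longrightarrow> i < n \<Longrightarrow> monic_eval n \<phi> (w i) = 0"
  by (auto simp: is_roots_def)

lemma Schur_roots: "is_roots n \<phi> w \<Longrightarrow> Schur n \<phi> \<Longrightarrow> i < n \<Longrightarrow> norm (w i) < 1"
  using is_roots_zero by (auto simp: Schur_def)

text \<open>Numerator and denominator of a Blaschke factor: for |a| < 1 the sign of the difference
  shows on which side of the unit circle x lies.\<close>

lemma blaschke_norm:
  fixes a x :: complex
  shows "(norm (x - a))\<^sup>2 - (norm (1 - cnj a * x))\<^sup>2 = ((norm x)\<^sup>2 - 1) * (1 - (norm a)\<^sup>2)"
  by (simp add: cmod_power2) algebra

lemma blaschke_le:
  fixes a x :: complex
  assumes "norm a < 1" "1 \<le> norm x"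
  shows "norm (1 - cnj a * x) \<le> norm (x - a)"
proof -
  have "(norm a)\<^sup>2 \<le> 1" "1 \<le> (norm x)\<^sup>2"
    using assms by (auto simp: power_le_one)
  then have "(norm (1 - cnj a * x))\<^sup>2 \<le> (norm (x - a))\<^sup>2"
    using blaschke_norm[of x a] by (smt (verit) mult_nonneg_nonneg)
  then show ?thesis by (rule power2_le_imp_le) simp
qed

lemma blaschke_ge:
  fixes a x :: complex
  assumes "norm a < 1" "norm x \<le> 1"
  shows "norm (x - a) \<le> norm (1 - cnj a * x)"
proof -
  have "(norm a)\<^sup>2 \<le> 1" "(norm x)\<^sup>2 \<le> 1"
    using assms by (auto simp: power_le_one)
  then have "(norm (x - a))\<^sup>2 \<le> (norm (1 - cnj a * x))\<^sup>2"
    using blaschke_norm[of x a] by (smt (verit) mult_nonneg_nonneg mult_minus_left)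
  then show ?thesis by (rule power2_le_imp_le) simp
qed

lemma Schur_nonzero: "Schur n \<phi> \<Longrightarrow> 1 \<le> norm x \<Longrightarrow> monic_eval n \<phi> x \<noteq> 0"
  by (auto simp: Schur_def)

text \<open>One Blaschke factor per zero. This comparison and its counterpart inside the disk drive
  the Schur recursion and locate the zeros of x * \<phi> + \<phi>*.\<close>

lemma Schur_norm_le:
  assumes "Schur n \<phi>" "1 \<le> norm x"
  shows "norm (reversed_eval n \<phi> x) \<le> norm (monic_eval n \<phi> x)"
proof -
  obtain w where w: "is_roots n \<phi> w" using exists_roots by blast
  show ?thesis
    unfolding reversed_eval_factor[OF w] w[unfolded is_roots_def, rule_format] prod_norm[symmetric]
    by (intro prod_mono) (use Schur_roots[OF w assms(1)] blaschke_le assms in auto)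
qed

lemma Schur_norm_ge:
  assumes "Schur n \<phi>" "norm x \<le> 1"
  shows "norm (monic_eval n \<phi> x) \<le> norm (reversed_eval n \<phi> x)"
proof -
  obtain w where w: "is_roots n \<phi> w" using exists_roots by blast
  show ?thesis
    unfolding reversed_eval_factor[OF w] w[unfolded is_roots_def, rule_format] prod_norm[symmetric]
    by (intro prod_mono) (use Schur_roots[OF w assms(1)] blaschke_ge assms in auto)
qed

lemma Schur_reversed_eval_nonzero:
  assumes "Schur n \<phi>" "norm x \<le> 1"
  shows "reversed_eval n \<phi> x \<noteq> 0"
proof -
  obtain w where w: "is_roots n \<phi> w" using exists_roots by blast
  have "1 - cnj (w i) * x \<noteq> 0" if "i < n" for i
  proof -
    have "norm (cnj (w i) * x) < 1"
      using Schur_roots[OF w assms(1) that] assms(2) unfolding norm_mult complex_mod_cnj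
      by (smt (verit) mult_left_le norm_ge_zero)
    then show ?thesis by (metis norm_one eq_iff_diff_eq_0 less_irrefl)
  qed
  then show ?thesis unfolding reversed_eval_factor[OF w] by simp
qed

text \<open>Used with |b| < 1 for the Schur recursion, and with b = 1 to write the polynomials of
  the theorem as x * \<phi> + \<phi>*.\<close>

lemma monic_eval_step:
  assumes "\<phi> (Suc n) = b" "\<And>k. k \<in> {1..n} \<Longrightarrow> \<phi> k = \<psi> k + b * cnj (\<psi> (Suc n - k))"
  shows "monic_eval (Suc n) \<phi> x = x * monic_eval n \<psi> x + b * reversed_eval n \<psi> x"
    and "reversed_eval (Suc n) \<phi> x = reversed_eval n \<psi> x + cnj b * x * monic_eval n \<psi> x"
proof -
  have "(\<Sum>k = 1..n. \<phi> k * x ^ (Suc n - k))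
      = (\<Sum>k = 1..n. x * (\<psi> k * x ^ (n - k))) + (\<Sum>k = 1..n. b * (cnj (\<psi> (Suc n - k)) * x ^ (Suc n - k)))"
    unfolding sum.distrib[symmetric]
    by (rule sum.cong) (auto simp: assms(2) Suc_diff_le algebra_simps)
  also have "(\<Sum>k = 1..n. b * (cnj (\<psi> (Suc n - k)) * x ^ (Suc n - k))) = (\<Sum>k = 1..n. b * (cnj (\<psi> k) * x ^ k))"
    using sum.atLeastAtMost_rev[of "\<lambda>k. b * (cnj (\<psi> k) * x ^ k)" 1 n] by simp
  finally show "monic_eval (Suc n) \<phi> x = x * monic_eval n \<psi> x + b * reversed_eval n \<psi> x"
    by (simp add: monic_eval_def reversed_eval_def assms(1) sum_distrib_left algebra_simps)
  have "(\<Sum>k = 1..n. cnj (\<phi> k) * x ^ k)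
      = (\<Sum>k = 1..n. cnj (\<psi> k) * x ^ k) + (\<Sum>k = 1..n. cnj b * x * (\<psi> (Suc n - k) * x ^ (n - (Suc n - k))))"
    unfolding sum.distrib[symmetric]
  proof (rule sum.cong)
    fix k assume k: "k \<in> {1..n}"
    then have "x ^ k = x * x ^ (n - (Suc n - k))"
      by (cases k) auto
    then show "cnj (\<phi> k) * x ^ k = cnj (\<psi> k) * x ^ k + cnj b * x * (\<psi> (Suc n - k) * x ^ (n - (Suc n - k)))"
      using assms(2)[OF k] by (simp add: algebra_simps)
  qed simp
  also have "(\<Sum>k = 1..n. cnj b * x * (\<psi> (Suc n - k) * x ^ (n - (Suc n - k))))
      = (\<Sum>k = 1..n. cnj b * x * (\<psi> k * x ^ (n - k)))"
    using sum.atLeastAtMost_rev[of "\<lambda>k. cnj b * x * (\<psi> k * x ^ (n - k))" 1 n] by simp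
  finally show "reversed_eval (Suc n) \<phi> x = reversed_eval n \<psi> x + cnj b * x * monic_eval n \<psi> x"
    by (simp add: monic_eval_def reversed_eval_def assms(1) sum_distrib_left algebra_simps)
qed

text \<open>Inverts the Schur step \<open>\<psi> \<mapsto> x * \<psi> x + b * \<psi>\<^sup>* x\<close>; the parameter \<open>b\<close> is the constant coefficient.\<close>

definition pred_poly :: "nat \<Rightarrow> complex \<Rightarrow> (nat \<Rightarrow> complex) \<Rightarrow> nat \<Rightarrow> complex" where
  "pred_poly n b \<phi> = (\<lambda>k\<in>{1..n}. (\<phi> k - b * cnj (\<phi> (Suc n - k))) / of_real (1 - (norm b)\<^sup>2))"

text \<open>The step couples \<open>\<psi> k\<close> only with the conjugate of
  \<open>\<psi> (Suc n - k)\<close>; this 2 x 2 system has determinant 1 - |b|^2.\<close>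

lemma pred_poly_inverse:
  assumes "norm b < 1" "k \<in> {1..n}"
  shows "\<phi> k = pred_poly n b \<phi> k + b * cnj (pred_poly n b \<phi> (Suc n - k))"
proof -
  define d :: complex where "d = of_real (1 - (norm b)\<^sup>2)"
  have bd: "b * cnj b = 1 - d" by (simp add: d_def complex_norm_square[symmetric])
  have "(norm b)\<^sup>2 < 1" using assms by (simp add: power_less_one_iff abs_square_less_1)
  then have "d \<noteq> 0" unfolding d_def by (metis of_real_eq_0_iff diff_gt_0_iff_gt less_irrefl)
  moreover have "cnj d = d" by (simp add: d_def)
  moreover have "Suc n - (Suc n - k) = k" "Suc n - k \<in> {1..n}" using assms by auto
  ultimately have "pred_poly n b \<phi> k + b * cnj (pred_poly n b \<phi> (Suc n - k))
     = (\<phi> k - b * cnj (\<phi> (Suc n - k)) + b * cnj (\<phi> (Suc n - k)) - (b * cnj b) * \<phi> k) / d"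
    using assms(2) unfolding pred_poly_def d_def[symmetric]
    by (simp add: add_divide_distrib[symmetric] algebra_simps)
  also have "\<dots> = \<phi> k" using \<open>d \<noteq> 0\<close> unfolding bd by (simp add: field_simps)
  finally show ?thesis ..
qed

lemma monic_eval_pred_poly:
  assumes "norm (\<phi> (Suc n)) < 1"
  shows "monic_eval (Suc n) \<phi> x = x * monic_eval n (pred_poly n (\<phi> (Suc n)) \<phi>) x + \<phi> (Suc n) * reversed_eval n (pred_poly n (\<phi> (Suc n)) \<phi>) x"
    "reversed_eval (Suc n) \<phi> x = reversed_eval n (pred_poly n (\<phi> (Suc n)) \<phi>) x + cnj (\<phi> (Suc n)) * x * monic_eval n (pred_poly n (\<phi> (Suc n)) \<phi>) x"
  using monic_eval_step[of \<phi> n "\<phi> (Suc n)" "pred_poly n (\<phi> (Suc n)) \<phi>"] pred_poly_inverse[OF assms] by blast+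

text \<open>Up to sign the constant coefficient is the product of the zeros, and there is at least
  one.\<close>

lemma Schur_last_coeff:
  assumes "Schur (Suc n) \<phi>"
  shows "norm (\<phi> (Suc n)) < 1"
proof -
  obtain w where w: "is_roots (Suc n) \<phi> w" using exists_roots by blast
  have "monic_eval (Suc n) \<phi> 0 = \<phi> (Suc n)"
    by (simp add: monic_eval_def power_0_left Suc_diff_le)
  then have "\<phi> (Suc n) = (\<Prod>i<Suc n. 0 - w i)"
    using w[unfolded is_roots_def, rule_format, of 0] by (simp only:)
  also have "norm \<dots> = (\<Prod>i<Suc n. norm (w i))"
    by (simp only: prod_norm[symmetric] norm_minus_cancel diff_0)
  finally have "norm (\<phi> (Suc n)) = (\<Prod>i<Suc n. norm (w i))" .
  also have "\<dots> = (\<Prod>i<n. norm (w i)) * norm (w n)" by simp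
  also have "\<dots> \<le> 1 * norm (w n)"
    by (intro mult_right_mono prod_le_1) (use Schur_roots[OF w assms] in \<open>auto simp: less_imp_le\<close>)
  also have "\<dots> < 1" using Schur_roots[OF w assms] by simp
  finally show ?thesis .
qed

text \<open>Both directions compare moduli outside the open disk. If \<psi> vanished at x there,
  then |\<phi>(x)| = |b| |\<phi>*(x)| <= |b| |\<phi>(x)| would force \<phi>(x) = 0; if \<phi>
  vanished, then |x| |\<psi>(x)| = |b| |\<psi>*(x)| would contradict |b| < 1 <= |x|.\<close>

lemma Schur_step:
  "Schur (Suc n) \<phi> \<longleftrightarrow> norm (\<phi> (Suc n)) < 1 \<and> Schur n (pred_poly n (\<phi> (Suc n)) \<phi>)"
proof
  assume S: "Schur (Suc n) \<phi>"
  let ?b = "\<phi> (Suc n)" and ?\<psi> = "pred_poly n (\<phi> (Suc n)) \<phi>"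
  have b: "norm ?b < 1" by (rule Schur_last_coeff[OF S])
  moreover have "Schur n ?\<psi>"
    unfolding Schur_def
  proof (intro allI impI, rule ccontr)
    fix x assume 0: "monic_eval n ?\<psi> x = 0" and "\<not> norm x < 1"
    then have x: "1 \<le> norm x" by simp
    have "norm (monic_eval (Suc n) \<phi> x) = norm ?b * norm (reversed_eval (Suc n) \<phi> x)"
      unfolding monic_eval_pred_poly[where \<phi> = \<phi>, OF b] 0 by (simp add: norm_mult)
    also have "\<dots> \<le> norm ?b * norm (monic_eval (Suc n) \<phi> x)"
      by (intro mult_left_mono Schur_norm_le[OF S x]) simp
    finally have "norm (monic_eval (Suc n) \<phi> x) * (1 - norm ?b) \<le> 0" by (simp add: algebra_simps)
    with b have "monic_eval (Suc n) \<phi> x = 0" by (simp add: mult_le_0_iff)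
    with Schur_nonzero[OF S x] show False by simp
  qed
  ultimately show "norm ?b < 1 \<and> Schur n ?\<psi>" ..
next
  let ?b = "\<phi> (Suc n)" and ?\<psi> = "pred_poly n (\<phi> (Suc n)) \<phi>"
  assume "norm ?b < 1 \<and> Schur n ?\<psi>"
  then have b: "norm ?b < 1" and S: "Schur n ?\<psi>" by auto
  show "Schur (Suc n) \<phi>"
    unfolding Schur_def
  proof (intro allI impI, rule ccontr)
    fix x assume 0: "monic_eval (Suc n) \<phi> x = 0" and "\<not> norm x < 1"
    then have x: "1 \<le> norm x" by simp
    have "x * monic_eval n ?\<psi> x = - (?b * reversed_eval n ?\<psi> x)"
      using 0 unfolding monic_eval_pred_poly[where \<phi> = \<phi>, OF b] by (simp add: add_eq_0_iff)
    then have "norm x * norm (monic_eval n ?\<psi> x) = norm ?b * norm (reversed_eval n ?\<psi> x)"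
      by (metis norm_minus_cancel norm_mult)
    also have "\<dots> \<le> norm ?b * norm (monic_eval n ?\<psi> x)"
      by (intro mult_left_mono Schur_norm_le[OF S x]) simp
    also have "\<dots> < 1 * norm (monic_eval n ?\<psi> x)"
      using b Schur_nonzero[OF S x] by simp
    also have "\<dots> \<le> norm x * norm (monic_eval n ?\<psi> x)"
      by (intro mult_right_mono x) simp
    finally show False by simp
  qed
qed

text \<open>At a zero w of \<phi> the recursion gives w \<psi>(w) = -b \<psi>*(w), hence \<phi>*(w)
  = (1 - |b|^2) \<psi>*(w): one factor 1 - |b|^2 for each of the n + 1 zeros.\<close>

lemma resultant_step:
  assumes b: "norm (\<phi> (Suc n)) < 1" and w: "is_roots (Suc n) \<phi> w"
    and v: "is_roots n (pred_poly n (\<phi> (Suc n)) \<phi>) v"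
  shows "(\<Prod>i<Suc n. norm (reversed_eval (Suc n) \<phi> (w i)))
    = (1 - (norm (\<phi> (Suc n)))\<^sup>2) ^ Suc n * (\<Prod>j<n. norm (reversed_eval n (pred_poly n (\<phi> (Suc n)) \<phi>) (v j)))"
proof -
  let ?b = "\<phi> (Suc n)" and ?\<psi> = "pred_poly n (\<phi> (Suc n)) \<phi>"
  have d: "0 \<le> 1 - (norm ?b)\<^sup>2" using b by (simp add: power_le_one)
  have 1: "norm (reversed_eval (Suc n) \<phi> (w i)) = (1 - (norm ?b)\<^sup>2) * norm (reversed_eval n ?\<psi> (w i))" if "i < Suc n" for i
  proof -
    have "w i * monic_eval n ?\<psi> (w i) = - ?b * reversed_eval n ?\<psi> (w i)"
      using is_roots_zero[OF w that] unfolding monic_eval_pred_poly[where \<phi> = \<phi>, OF b] by (simp add: add_eq_0_iff)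
    then have "reversed_eval (Suc n) \<phi> (w i) = reversed_eval n ?\<psi> (w i) + cnj ?b * (- ?b * reversed_eval n ?\<psi> (w i))"
      unfolding monic_eval_pred_poly[where \<phi> = \<phi>, OF b] by (simp add: mult.assoc)
    also have "\<dots> = of_real (1 - (norm ?b)\<^sup>2) * reversed_eval n ?\<psi> (w i)"
      by (simp only: of_real_diff complex_norm_square of_real_1) (simp add: algebra_simps)
    finally show ?thesis using d by (simp only: norm_mult norm_of_real abs_of_nonneg)
  qed
  \<comment> \<open>Symmetry of the resultant: |1 - cnj v * w| = |1 - cnj w * v| trades evaluation
    of \<psi>* at the zeros of \<phi> for evaluation of \<phi>* at the zeros of \<psi>, where
    \<phi>* and \<psi>* agree.\<close>
  have "(\<Prod>i<Suc n. norm (reversed_eval n ?\<psi> (w i))) = (\<Prod>i<Suc n. \<Prod>j<n. norm (1 - cnj (v j) * w i))"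
    unfolding reversed_eval_factor[OF v] by (simp only: prod_norm)
  also have "\<dots> = (\<Prod>j<n. \<Prod>i<Suc n. norm (1 - cnj (v j) * w i))"
    by (rule prod.swap)
  also have "\<dots> = (\<Prod>j<n. \<Prod>i<Suc n. norm (1 - cnj (w i) * v j))"
  proof (intro prod.cong refl)
    fix i j
    have "1 - cnj (v j) * w i = cnj (1 - cnj (w i) * v j)" by simp
    then show "norm (1 - cnj (v j) * w i) = norm (1 - cnj (w i) * v j)" by (metis complex_mod_cnj)
  qed
  also have "\<dots> = (\<Prod>j<n. norm (reversed_eval (Suc n) \<phi> (v j)))"
    unfolding reversed_eval_factor[OF w] by (simp only: prod_norm)
  also have "\<dots> = (\<Prod>j<n. norm (reversed_eval n ?\<psi> (v j)))"
    unfolding monic_eval_pred_poly[where \<phi> = \<phi>, OF b] by (intro prod.cong refl) (simp add: is_roots_zero[OF v])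
  finally have 2: "(\<Prod>i<Suc n. norm (reversed_eval n ?\<psi> (w i))) = (\<Prod>j<n. norm (reversed_eval n ?\<psi> (v j)))" .
  have "(\<Prod>i<Suc n. norm (reversed_eval (Suc n) \<phi> (w i))) = (\<Prod>i<Suc n. (1 - (norm ?b)\<^sup>2) * norm (reversed_eval n ?\<psi> (w i)))"
    by (intro prod.cong refl 1) simp
  also have "\<dots> = (1 - (norm ?b)\<^sup>2) ^ Suc n * (\<Prod>i<Suc n. norm (reversed_eval n ?\<psi> (w i)))"
    by (simp only: prod.distrib prod_constant card_lessThan)
  finally show ?thesis unfolding 2 .
qed

text \<open>This is \<open>R \<phi> powr (-1/2)\<close> on polynomials with zeros in the open disk and \<open>0\<close> elsewhere; the
  recursion avoids mentioning zeros, which makes measurability evident.\<close>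

primrec schur_weight :: "nat \<Rightarrow> (nat \<Rightarrow> complex) \<Rightarrow> ennreal" where
  "schur_weight 0 \<phi> = 1"
| "schur_weight (Suc n) \<phi> = (if norm (\<phi> (Suc n)) < 1
     then ennreal ((1 - (norm (\<phi> (Suc n)))\<^sup>2) powr (- real (Suc n) / 2)) * schur_weight n (pred_poly n (\<phi> (Suc n)) \<phi>)
     else 0)"

text \<open>Taking the power -1/2 of \<open>resultant_step\<close> produces the exponent -(n + 1) /
  2 in the recursion, and \<open>Schur_step\<close> matches the two case distinctions.\<close>

lemma schur_weight_eq:
  assumes "is_roots n \<phi> w"
  shows "schur_weight n \<phi> = (if Schur n \<phi> then ennreal ((\<Prod>i<n. norm (reversed_eval n \<phi> (w i))) powr (- 1 / 2)) else 0)"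
  using assms
proof (induction n arbitrary: \<phi> w)
  case 0
  then show ?case by (simp add: Schur_def monic_eval_def)
next
  case (Suc n)
  let ?b = "\<phi> (Suc n)" and ?\<psi> = "pred_poly n (\<phi> (Suc n)) \<phi>"
  obtain v where v: "is_roots n ?\<psi> v" using exists_roots by blast
  show ?case
  proof (cases "norm ?b < 1 \<and> Schur n ?\<psi>")
    case True
    then have b: "norm ?b < 1" and S: "Schur n ?\<psi>" by auto
    have d: "0 < 1 - (norm ?b)\<^sup>2" using b by (simp add: power_less_one_iff abs_square_less_1)
    have "schur_weight (Suc n) \<phi> = ennreal ((1 - (norm ?b)\<^sup>2) powr (- real (Suc n) / 2) * (\<Prod>i<n. norm (reversed_eval n ?\<psi> (v i))) powr (- 1 / 2))"
      using Suc.IH[OF v] b S by (simp add: ennreal_mult)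
    also have "(1 - (norm ?b)\<^sup>2) powr (- real (Suc n) / 2) = ((1 - (norm ?b)\<^sup>2) ^ Suc n) powr (- 1 / 2)"
      using d by (simp add: powr_realpow[symmetric] powr_powr del: power_Suc of_nat_Suc)
    also have "\<dots> * (\<Prod>i<n. norm (reversed_eval n ?\<psi> (v i))) powr (- 1 / 2) = (\<Prod>i<Suc n. norm (reversed_eval (Suc n) \<phi> (w i))) powr (- 1 / 2)"
      unfolding resultant_step[OF b Suc.prems v] using d
      by (intro powr_mult[symmetric]) 
    finally show ?thesis using True Schur_step[of n \<phi>] by simp
  next
    case False
    then show ?thesis using Suc.IH[OF v] Schur_step[of n \<phi>] by auto
  qed
qed

section \<open>The weighted volume of the polynomials with zeros in the open disk\<close>

lemma measurable_lborels_component: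
  "k \<in> I \<Longrightarrow> (\<lambda>x. x k) \<in> borel_measurable (lborels I)"
  by (subst measurable_lborel1[symmetric]) (rule measurable_component_singleton)

text \<open>The map couples k antilinearly with n + 1 - k. With d = 1 - |b|^2 one has x + b * cnj y
  = d * x + b * cnj (y + b * cnj x), so on each pair two shears suffice: first the upper index, then
  the lower one.\<close>

lemma scales_lborels_reflection:
  assumes b: "norm b < 1"
  shows "scales (lborels {1..n}) (\<lambda>x. \<lambda>k\<in>{1..n}. x k + b * cnj (x (Suc n - k))) (ennreal ((1 - (norm b)\<^sup>2) ^ n))"
proof -
  define L H where "L = {k\<in>{1..n}. 2 * k \<le> Suc n}" and "H = {k\<in>{1..n}. Suc n < 2 * k}"
  define d where "d = 1 - (norm b)\<^sup>2"
  have d: "0 < d" using b by (simp add: d_def power_less_one_iff abs_square_less_1)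
  have bd: "b * cnj b = 1 - of_real d" by (simp add: d_def complex_norm_square[symmetric])
  have LH: "L \<union> H = {1..n}" "H \<union> L = {1..n}" "L \<inter> H = {}" "H \<inter> L = {}" "finite L" "finite H"
    by (auto simp: L_def H_def)
  have memH: "Suc n - k \<in> L" if "k \<in> H" for k using that by (auto simp: L_def H_def)
  have memL: "Suc n - k \<in> H" if "k \<in> L" "2 * k \<noteq> Suc n" for k using that by (auto simp: L_def H_def)
  have cm [measurable]: "cnj \<in> borel_measurable borel"
    by (intro borel_measurable_continuous_onI continuous_intros)
  have m1: "(\<lambda>x :: (nat \<Rightarrow> complex) \<times> complex. fst x j) \<in> borel_measurable (lborels I \<Otimes>\<^sub>M lborel)" if "j \<in> I"
    for I j
    by (rule measurable_compose[OF measurable_fst measurable_lborels_component[OF that]])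
  \<comment> \<open>Scaling the complex plane by d has real factor d^2, which accounts for both
    members of a pair; the self-paired middle index contributes d alone. The total is d^n.\<close>
  let ?c = "\<lambda>k. ennreal (if 2 * k = Suc n then d else d ^ 2)"
  have 1: "scales (lborels (L \<union> H))
      (\<lambda>x. \<lambda>k\<in>L \<union> H. if k \<in> H then x k + b * cnj (restrict x L (Suc n - k)) else x k) (\<Prod>k\<in>H. 1)"
  proof (rule scales_lborels_shear[where g = "\<lambda>k y t. t + b * cnj (y (Suc n - k))"])
    show "scales lborel (\<lambda>t. t + b * cnj (y (Suc n - k))) 1" for k y
      using scales_complex_affine[of 1 "b * cnj (y (Suc n - k))"] by simp
    show "(\<lambda>(y, t). t + b * cnj (y (Suc n - k))) \<in> borel_measurable (lborels L \<Otimes>\<^sub>M lborel)" if "k \<in> H" for k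
      using m1[OF memH[OF that]] unfolding case_prod_beta by measurable
  qed (use LH in auto)
  have 2: "scales (lborels (H \<union> L))
      (\<lambda>x. \<lambda>k\<in>H \<union> L. if k \<in> L then
          (if 2 * k = Suc n then x k + b * cnj (x k) else of_real d * x k + b * cnj (restrict x H (Suc n - k)))
        else x k) (\<Prod>k\<in>L. ?c k)"
  proof (rule scales_lborels_shear[where g = "\<lambda>k y t. if 2 * k = Suc n then t + b * cnj t else of_real d * t + b * cnj (y (Suc n - k))"])
    show "scales lborel (\<lambda>t. if 2 * k = Suc n then t + b * cnj t else of_real d * t + b * cnj (y (Suc n - k))) (?c k)" for k y
    proof (cases "2 * k = Suc n")
      case True
      then show ?thesis using scales_complex_add_cnj[OF b] by (simp add: d_def)
    next
      case False
      then show ?thesis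
        using scales_complex_affine[of "of_real d" "b * cnj (y (Suc n - k))"] d by simp
    qed
    show "(\<lambda>(y, t). if 2 * k = Suc n then t + b * cnj t else of_real d * t + b * cnj (y (Suc n - k)))
        \<in> borel_measurable (lborels H \<Otimes>\<^sub>M lborel)" if "k \<in> L" for k
    proof (cases "2 * k = Suc n")
      case True
      then show ?thesis unfolding case_prod_beta if_P[OF True] by measurable
    next
      case False
      have "(\<lambda>x :: (nat \<Rightarrow> complex) \<times> complex. cnj (fst x (Suc n - k))) \<in> borel_measurable (lborels H \<Otimes>\<^sub>M lborel)"
        by (rule measurable_compose[OF m1[OF memL[OF that False]] cm])
      moreover have "(\<lambda>x :: (nat \<Rightarrow> complex) \<times> complex. snd x) \<in> borel_measurable (lborels H \<Otimes>\<^sub>M lborel)"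
        by measurable
      ultimately show ?thesis unfolding case_prod_beta if_not_P[OF False]
        by (intro borel_measurable_add borel_measurable_times borel_measurable_const)
    qed
  qed (use LH in auto)
  have prod: "(\<Prod>k\<in>L. ?c k) = ennreal (d ^ n)"
  proof -
    have "(\<Prod>k\<in>L. ?c k) = ennreal (\<Prod>k\<in>L. if 2 * k = Suc n then d else d ^ 2)"
      using d by (subst prod_ennreal) auto
    also have "(\<Prod>k\<in>L. if 2 * k = Suc n then d else d ^ 2) = (\<Prod>k\<in>L. d) * (\<Prod>k\<in>L. if 2 * k = Suc n then 1 else d)"
      unfolding prod.distrib[symmetric] by (intro prod.cong) (auto simp: power2_eq_square)
    also have "(\<Prod>k\<in>L. if 2 * k = Suc n then 1 else d) = (\<Prod>k\<in>{k\<in>L. 2 * k \<noteq> Suc n}. d)"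
      by (subst prod.inter_filter[OF LH(5)]) (auto intro!: prod.cong)
    also have "\<dots> = (\<Prod>k\<in>H. d)"
      by (rule prod.reindex_bij_witness[of _ "\<lambda>k. Suc n - k" "\<lambda>k. Suc n - k"]) (auto simp: L_def H_def)
    also have "(\<Prod>k\<in>L. d) * (\<Prod>k\<in>H. d) = (\<Prod>k\<in>{1..n}. d)"
      using LH by (metis prod.union_disjoint)
    finally show ?thesis by simp
  qed
  show ?thesis
  proof (rule scales_cong[OF scales_compose[OF 2[unfolded LH(2)] 1[unfolded LH(1)]]])
    show "(\<Prod>k\<in>L. ?c k) * (\<Prod>k\<in>H. 1) = ennreal ((1 - (norm b)\<^sup>2) ^ n)"
      unfolding prod by (simp add: d_def)
  next
    fix x :: "nat \<Rightarrow> complex"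
    let ?y = "\<lambda>k\<in>{1..n}. if k \<in> H then x k + b * cnj (restrict x L (Suc n - k)) else x k"
    show "(\<lambda>k\<in>{1..n}. if k \<in> L then
          (if 2 * k = Suc n then ?y k + b * cnj (?y k) else of_real d * ?y k + b * cnj (restrict ?y H (Suc n - k)))
        else ?y k) = (\<lambda>k\<in>{1..n}. x k + b * cnj (x (Suc n - k)))"
    proof (rule restrict_ext)
      fix k assume k: "k \<in> {1..n}"
      consider "k \<in> H" "k \<notin> L" | "k \<in> L" "k \<notin> H" "2 * k = Suc n" | "k \<in> L" "k \<notin> H" "2 * k \<noteq> Suc n"
        using k LH by blast
      then show "(if k \<in> L then
          (if 2 * k = Suc n then ?y k + b * cnj (?y k) else of_real d * ?y k + b * cnj (restrict ?y H (Suc n - k)))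
        else ?y k) = x k + b * cnj (x (Suc n - k))"
      proof cases
        case 1
        then show ?thesis using k memH by simp
      next
        case 2
        then have "Suc n - k = k" by simp
        then show ?thesis using 2 k by simp
      next
        case 3
        have S: "Suc n - (Suc n - k) = k" "Suc n - k \<in> {1..n}" using k by auto
        have "of_real d * x k + b * cnj (x (Suc n - k) + b * cnj (x k)) = (of_real d + b * cnj b) * x k + b * cnj (x (Suc n - k))"
          by (simp add: algebra_simps)
        then show ?thesis using 3 k S memL[OF 3(1,3)] unfolding bd by simp
      qed
    qed
  qed
qed

lemma pred_poly_measurable [measurable]:
  "pred_poly n b \<in> lborels {1..n} \<rightarrow>\<^sub>M lborels {1..n}"
proof -
  have [measurable]: "cnj \<in> borel_measurable borel"
    by (intro borel_measurable_continuous_onI continuous_intros)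
  show ?thesis unfolding pred_poly_def
  proof (intro measurable_restrict)
    fix k assume k: "k \<in> {1..n}"
    have [measurable]: "(\<lambda>x :: nat \<Rightarrow> complex. x k) \<in> borel_measurable (lborels {1..n})"
      "(\<lambda>x :: nat \<Rightarrow> complex. x (Suc n - k)) \<in> borel_measurable (lborels {1..n})"
      by (rule measurable_lborels_component; use k in auto)+
    show "(\<lambda>\<phi>. (\<phi> k - b * cnj (\<phi> (Suc n - k))) / complex_of_real (1 - (norm b)\<^sup>2)) \<in> lborels {1..n} \<rightarrow>\<^sub>M lborel"
      unfolding measurable_lborel1 by (intro borel_measurable_divide borel_measurable_diff borel_measurable_times
        measurable_const measurable_compose[OF _ \<open>cnj \<in> _\<close>]) (fact | simp)+
  qed
qed

lemma scales_pred_poly: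
  assumes b: "norm b < 1"
  shows "scales (lborels {1..n}) (pred_poly n b) (ennreal (1 / (1 - (norm b)\<^sup>2) ^ n))"
proof (rule scales_inverse[OF scales_lborels_reflection[OF b, of n]])
  define d :: complex where "d = of_real (1 - (norm b)\<^sup>2)"
  have bd: "b * cnj b = 1 - d" by (simp add: d_def complex_norm_square[symmetric])
  have pos: "0 < 1 - (norm b)\<^sup>2" using b by (simp add: power_less_one_iff abs_square_less_1)
  then have d0: "d \<noteq> 0" unfolding d_def by (metis of_real_eq_0_iff less_irrefl)
  show "ennreal ((1 - (norm b)\<^sup>2) ^ n) * ennreal (1 / (1 - (norm b)\<^sup>2) ^ n) = 1"
    using pos by (subst ennreal_mult[symmetric]) auto
  fix x :: "nat \<Rightarrow> complex" assume "x \<in> space (lborels {1..n})"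
  then have x: "x k = undefined" if "k \<notin> {1..n}" for k using that by (auto simp: space_PiM)
  let ?y = "\<lambda>k\<in>{1..n}. x k + b * cnj (x (Suc n - k))"
  show "pred_poly n b ?y = x"
  proof
    fix k
    show "pred_poly n b ?y k = x k"
    proof (cases "k \<in> {1..n}")
      case True
      have S: "Suc n - (Suc n - k) = k" "Suc n - k \<in> {1..n}" using True by auto
      have "x k + b * cnj (x (Suc n - k)) - b * cnj (x (Suc n - k) + b * cnj (x k)) = (1 - b * cnj b) * x k"
        by (simp add: algebra_simps)
      also have "\<dots> = d * x k" unfolding bd by simp
      finally show ?thesis using True S d0 unfolding pred_poly_def d_def[symmetric] by simp
    qed (use x in \<open>auto simp: pred_poly_def\<close>)
  qed
qed measurable

lemma schur_weight_measurable [measurable]: "schur_weight n \<in> borel_measurable (lborels {1..n})"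
proof (induction n)
  case (Suc n)
  have [measurable]: "cnj \<in> borel_measurable borel"
    by (intro borel_measurable_continuous_onI continuous_intros)
  have l [measurable]: "(\<lambda>x :: nat \<Rightarrow> complex. x (Suc n)) \<in> borel_measurable (lborels {1..Suc n})"
    by (rule measurable_lborels_component) auto
  have "(\<lambda>\<phi>. pred_poly n (\<phi> (Suc n)) \<phi>) \<in> lborels {1..Suc n} \<rightarrow>\<^sub>M lborels {1..n}"
    unfolding pred_poly_def
  proof (intro measurable_restrict)
    fix k assume k: "k \<in> {1..n}"
    have m: "(\<lambda>x :: nat \<Rightarrow> complex. x k) \<in> borel_measurable (lborels {1..Suc n})"
      "(\<lambda>x :: nat \<Rightarrow> complex. x (Suc n - k)) \<in> borel_measurable (lborels {1..Suc n})"
      by (rule measurable_lborels_component; use k in auto)+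
    have [measurable]: "(\<lambda>x :: nat \<Rightarrow> complex. complex_of_real (1 - (norm (x (Suc n)))\<^sup>2)) \<in> borel_measurable (lborels {1..Suc n})"
      by measurable
    show "(\<lambda>\<phi>. (\<phi> k - \<phi> (Suc n) * cnj (\<phi> (Suc n - k))) / complex_of_real (1 - (norm (\<phi> (Suc n)))\<^sup>2)) \<in> lborels {1..Suc n} \<rightarrow>\<^sub>M lborel"
      unfolding measurable_lborel1 by (intro borel_measurable_divide borel_measurable_diff borel_measurable_times
        measurable_const measurable_compose[OF _ \<open>cnj \<in> _\<close>]) (fact | simp)+
  qed
  from measurable_compose[OF this Suc.IH] l show ?case
    unfolding schur_weight.simps by measurable
qed simp

section \<open>Beta integrals over the disk\<close>

lemma nn_integral_beta:
  fixes a b :: real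
  assumes "a > 0" "b > 0"
  shows "(\<integral>\<^sup>+t. ennreal (t powr (a - 1) * (1 - t) powr (b - 1)) * indicator {0<..<1} t \<partial>lborel) = ennreal (Beta a b)"
  using has_integral_Beta_real[OF assms]
  by (intro nn_integral_has_integral_lebesgue') (auto simp: has_integral_Icc_iff_Ioo)

lemma Beta_one_left: "b > 0 \<Longrightarrow> Beta 1 (b::real) = 1 / b"
proof -
  assume b: "b > 0"
  then have "b \<notin> \<int>\<^sub>\<le>\<^sub>0" by (auto elim!: nonpos_Ints_cases)
  from Gamma_plus1[OF this] Gamma_real_pos[OF b] show ?thesis
    by (simp add: Beta_def add.commute)
qed

lemma borel_measurable_indicator_ball [measurable, simp]:
  "(indicator (ball (0::complex) 1) :: complex \<Rightarrow> ennreal) \<in> borel_measurable borel"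
  by (intro borel_measurable_indicator) simp

text \<open>The annulus x < |z|^2 < 1 has area pi * (1 - x), so the squared modulus is uniformly
  distributed. This takes the place of polar coordinates.\<close>

lemma distr_norm_square_disk:
  "distr (density lborel (indicator (ball (0::complex) 1))) borel (\<lambda>z. (norm z)\<^sup>2)
     = density lborel (\<lambda>t. ennreal pi * indicator {0<..<1} t)" (is "?M = ?N")
proof (rule measure_eqI_lessThan)
  have N: "emeasure ?N {x<..} = ennreal pi * emeasure lborel ({0<..<1} \<inter> {x<..})" for x :: real
    by (subst emeasure_density)
       (auto simp: nn_integral_cmult mult.assoc indicator_inter_arith[symmetric])
  have M: "emeasure ?M {x<..} = emeasure lborel (ball (0::complex) 1 \<inter> {z. x < (norm z)\<^sup>2})" for x
  proof -
    have "(\<lambda>z. (norm z)\<^sup>2) -` {x<..} = {z::complex. x < (norm z)\<^sup>2}" by auto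
    moreover have "{z::complex. x < (norm z)\<^sup>2} \<in> sets borel" by measurable
    ultimately show ?thesis
      by (subst emeasure_distr) (auto simp: emeasure_density indicator_inter_arith[symmetric])
  qed
  show eq: "emeasure ?M {x<..} = emeasure ?N {x<..}" for x
  proof -
    consider "x < 0" | "0 \<le> x" "x < 1" | "x \<ge> 1" by linarith
    then show ?thesis
    proof cases
      case 1
      then have "ball (0::complex) 1 \<inter> {z. x < (norm z)\<^sup>2} = ball 0 1" "{0<..<1} \<inter> {x<..} = {0<..<1}"
        by (auto intro: less_le_trans)
      then show ?thesis unfolding M N by (simp add: emeasure_ball unit_ball_vol_2)
    next
      case 2
      have "ball (0::complex) 1 \<inter> {z. x < (norm z)\<^sup>2} = ball 0 1 - cball 0 (sqrt x)"
      proof -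
        have "x < (norm z)\<^sup>2 \<longleftrightarrow> sqrt x < norm z" for z :: complex
          using 2 real_sqrt_less_iff[of x "(norm z)\<^sup>2"] by simp
        then have "ball (0::complex) 1 \<inter> {z. x < (norm z)\<^sup>2} = ball 0 1 \<inter> {z. sqrt x < norm z}" by presburger
        also have "\<dots> = ball 0 1 - cball 0 (sqrt x)" by (auto simp: not_le)
        finally show ?thesis .
      qed
      moreover have "cball (0::complex) (sqrt x) \<subseteq> ball 0 1"
      proof -
        have "sqrt x < 1" using 2 by (simp add: real_less_lsqrt)
        then show ?thesis using le_less_trans by (fastforce simp del: real_sqrt_lt_1_iff)
      qed
      ultimately have "emeasure ?M {x<..} = emeasure lborel (ball (0::complex) 1) - emeasure lborel (cball (0::complex) (sqrt x))"
        unfolding M by (subst emeasure_Diff[symmetric]) (use 2 in \<open>auto simp: emeasure_cball\<close>)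
      also have "\<dots> = ennreal (pi * (1 - x))"
        using 2 by (simp add: emeasure_ball emeasure_cball unit_ball_vol_2 ennreal_minus algebra_simps)
      moreover have "{0<..<1} \<inter> {x<..} = {x<..<1}" using 2 by auto
      ultimately show ?thesis unfolding N using 2 by (simp add: ennreal_mult)
    next
      case 3
      then have "ball (0::complex) 1 \<inter> {z. x < (norm z)\<^sup>2} = {}" "{0<..<1} \<inter> {x<..} = {}"
      proof -
        have "(norm z)\<^sup>2 < 1" if "norm z < 1" for z :: complex
          using that by (simp add: power_less_one_iff abs_square_less_1)
        then show "ball (0::complex) 1 \<inter> {z. x < (norm z)\<^sup>2} = {}" using 3 by force
      qed (use 3 in auto)
      then show ?thesis unfolding M N by simp
    qed
  qed
  show "emeasure ?M {x<..} < \<infinity>" for x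
  proof -
    have "emeasure lborel ({0<..<1} \<inter> {x<..}) \<le> emeasure lborel {0<..<1::real}"
      by (rule emeasure_mono) auto
    then have "ennreal pi * emeasure lborel ({0<..<1} \<inter> {x<..}) \<le> ennreal pi * 1"
      by (intro mult_left_mono) auto
    also have "\<dots> < \<infinity>" by simp
    finally show ?thesis unfolding eq N .
  qed
qed simp_all

lemma nn_integral_disk:
  assumes [measurable]: "h \<in> borel_measurable borel"
  shows "(\<integral>\<^sup>+z. h ((norm (z::complex))\<^sup>2) * indicator (ball 0 1) z \<partial>lborel)
     = ennreal pi * (\<integral>\<^sup>+t. h t * indicator {0<..<1} t \<partial>lborel)"
proof -
  have "(\<integral>\<^sup>+z. h ((norm (z::complex))\<^sup>2) * indicator (ball 0 1) z \<partial>lborel)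
      = (\<integral>\<^sup>+t. h t \<partial>distr (density lborel (indicator (ball (0::complex) 1))) borel (\<lambda>z. (norm z)\<^sup>2))"
    by (simp add: nn_integral_distr nn_integral_density mult.commute)
  also have "\<dots> = ennreal pi * (\<integral>\<^sup>+t. h t * indicator {0<..<1} t \<partial>lborel)"
    unfolding distr_norm_square_disk
    by (simp add: nn_integral_density mult_ac nn_integral_cmult)
  finally show ?thesis .
qed

text \<open>The exponent is n - (n + 1) / 2: the n comes from the Jacobian of the Schur step on n
  coefficients, the rest from the weight. The values for successive n multiply to (2 pi)^n /
  n!.\<close>

lemma nn_integral_disk_powr:
  "(\<integral>\<^sup>+z. ennreal ((1 - (norm (z::complex))\<^sup>2) powr ((real n - 1) / 2)) * indicator (ball 0 1) z \<partial>lborel)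
     = ennreal (2 * pi / real (Suc n))"
proof -
  have "(\<integral>\<^sup>+t. ennreal ((1 - t) powr ((real n - 1) / 2)) * indicator {0<..<1} t \<partial>lborel)
     = (\<integral>\<^sup>+t. ennreal (t powr (1 - 1) * (1 - t) powr (real (Suc n) / 2 - 1)) * indicator {0<..<1} t \<partial>lborel)"
  proof (rule nn_integral_cong)
    fix t :: real
    have e: "(real n - 1) / 2 = real (Suc n) / 2 - 1" by (simp add: field_simps)
    show "ennreal ((1 - t) powr ((real n - 1) / 2)) * indicator {0<..<1} t
        = ennreal (t powr (1 - 1) * (1 - t) powr (real (Suc n) / 2 - 1)) * indicator {0<..<1} t"
      unfolding e by (auto simp: indicator_def)
  qed
  also have "\<dots> = ennreal (Beta 1 (real (Suc n) / 2))"
    by (rule nn_integral_beta) auto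
  also have "\<dots> = ennreal (2 / real (Suc n))" by (subst Beta_one_left) auto
  finally show ?thesis
    by (subst nn_integral_disk[of "\<lambda>t. ennreal ((1 - t) powr ((real n - 1) / 2))"])
       (auto simp: ennreal_mult[symmetric] simp del: of_nat_Suc)
qed

lemma pred_poly_upd: "pred_poly n b (x(Suc n := y)) = pred_poly n b x"
  unfolding pred_poly_def by (rule restrict_ext) auto

text \<open>With the last coefficient b integrated outermost, \<open>pred_poly n b\<close>
  transports the inner integral to the one of degree n, so b decouples and contributes a single disk
  integral.\<close>

lemma nn_integral_schur_weight: "(\<integral>\<^sup>+\<phi>. schur_weight n \<phi> \<partial>lborels {1..n}) = ennreal ((2 * pi) ^ n / fact n)"
proof (induction n)
  case 0
  have "integral\<^sup>N (lborels {}) (schur_weight 0) = 1" using lborels.nn_integral_empty[of "schur_weight 0"] by simp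
  moreover have "{1..0::nat} = {}" by simp
  ultimately have "integral\<^sup>N (lborels {1..0}) (schur_weight 0) = 1" by (simp only:)
  then show ?case unfolding power_0 fact_0 by (simp only: div_by_1 ennreal_1)
next
  case (Suc n)
  let ?I = "\<integral>\<^sup>+\<phi>. schur_weight n \<phi> \<partial>lborels {1..n}"
  let ?p = "\<lambda>b::complex. (1 - (norm b)\<^sup>2) powr (- real (Suc n) / 2)"
  have in1: "(\<integral>\<^sup>+x. schur_weight (Suc n) (x(Suc n := b)) \<partial>lborels {1..n})
      = ennreal ((1 - (norm b)\<^sup>2) powr ((real n - 1) / 2)) * indicator (ball 0 1) b * ?I" for b
  proof (cases "norm b < 1")
    case True
    define d where "d = 1 - (norm b)\<^sup>2"
    have d: "0 < d" using True by (simp add: d_def power_less_one_iff abs_square_less_1)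
    have "(\<integral>\<^sup>+x. schur_weight (Suc n) (x(Suc n := b)) \<partial>lborels {1..n}) = (\<integral>\<^sup>+x. ennreal (?p b) * schur_weight n (pred_poly n b x) \<partial>lborels {1..n})"
      using True by (simp add: pred_poly_upd)
    also have "\<dots> = ennreal (?p b) * (\<integral>\<^sup>+x. schur_weight n (pred_poly n b x) \<partial>lborels {1..n})"
      by (rule nn_integral_cmult) measurable
    also have "(\<integral>\<^sup>+x. schur_weight n (pred_poly n b x) \<partial>lborels {1..n}) = ennreal (d ^ n) * ?I"
    proof -
      have "ennreal (d ^ n) * ((\<integral>\<^sup>+x. schur_weight n (pred_poly n b x) \<partial>lborels {1..n}) * ennreal (1 / d ^ n)) = ennreal (d ^ n) * ?I"
        unfolding d_def scalesD[OF scales_pred_poly[OF True] schur_weight_measurable] ..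
      moreover have "ennreal (d ^ n) * ennreal (1 / d ^ n) = 1"
        using d by (subst ennreal_mult[symmetric]) auto
      ultimately show ?thesis by (metis mult.commute mult.left_commute mult_1)
    qed
    also have "ennreal (?p b) * (ennreal (d ^ n) * ?I) = ennreal (d powr (- real (Suc n) / 2) * d ^ n) * ?I"
      using d by (simp add: d_def ennreal_mult mult.assoc)
    finally have "(\<integral>\<^sup>+x. schur_weight (Suc n) (x(Suc n := b)) \<partial>lborels {1..n}) = ennreal (d powr (- real (Suc n) / 2) * d ^ n) * ?I" .
    moreover have "d powr (- real (Suc n) / 2) * d ^ n = d powr ((real n - 1) / 2)"
    proof -
      have "- real (Suc n) / 2 + real n = (real n - 1) / 2" by (simp add: field_simps)
      then show ?thesis using d by (simp only: powr_realpow[symmetric] powr_add[symmetric])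
    qed
    moreover have "indicator (ball 0 1) b = (1 :: ennreal)" using True by simp
    ultimately show ?thesis unfolding d_def by (simp only: mult_1_right)
  qed simp
  have ins: "{1..Suc n} = insert (Suc n) {1..n}" by auto
  have "(\<integral>\<^sup>+\<phi>. schur_weight (Suc n) \<phi> \<partial>lborels {1..Suc n})
     = (\<integral>\<^sup>+b. \<integral>\<^sup>+x. schur_weight (Suc n) (x(Suc n := b)) \<partial>lborels {1..n} \<partial>lborel)"
    unfolding ins
    by (rule lborels.product_nn_integral_insert_rev[OF _ _ schur_weight_measurable[of "Suc n", unfolded ins]]) simp_all
  also have "\<dots> = (\<integral>\<^sup>+b. ennreal ((1 - (norm b)\<^sup>2) powr ((real n - 1) / 2)) * indicator (ball 0 1) (b::complex) \<partial>lborel) * ?I"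
    unfolding in1 by (rule nn_integral_multc) measurable
  also have "\<dots> = ennreal (2 * pi / real (Suc n) * ((2 * pi) ^ n / fact n))"
    unfolding nn_integral_disk_powr Suc.IH by (rule ennreal_mult[symmetric]) auto
  also have "2 * pi / real (Suc n) * ((2 * pi) ^ n / fact n) = (2 * pi) ^ Suc n / fact (Suc n)"
    by simp
  finally show ?case .
qed

section \<open>Coordinates adapted to the fibres\<close>

definition cplx :: "nat set \<Rightarrow> (nat \<Rightarrow> real) \<Rightarrow> (nat \<Rightarrow> real) \<Rightarrow> nat \<Rightarrow> complex" where
  "cplx I a b = (\<lambda>k\<in>I. Complex (a k) (b k))"

lemma emeasure_lborels_empty [simp]:
  "emeasure (lborels {} :: (nat \<Rightarrow> 'a::euclidean_space) measure) (space (lborels {})) = 1"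
  using lborels.nn_integral_empty[where 'a = 'a, of "\<lambda>_. 1"] by simp

lemma borel_measurable_Complex [measurable]:
  assumes [measurable]: "g \<in> borel_measurable M" "h \<in> borel_measurable M"
  shows "(\<lambda>x. Complex (g x) (h x)) \<in> borel_measurable M"
  unfolding Complex_eq by measurable

lemma measurable_cplx:
  assumes "A \<in> M \<rightarrow>\<^sub>M lborels I" "B \<in> M \<rightarrow>\<^sub>M lborels I"
  shows "(\<lambda>x. cplx I (A x) (B x)) \<in> M \<rightarrow>\<^sub>M lborels I"
  unfolding cplx_def
  by (intro measurable_restrict)
     (auto intro!: borel_measurable_Complex measurable_compose[OF assms(1)] measurable_compose[OF assms(2)]
        measurable_lborels_component)

lemma measurable_lborels_upd:
  assumes "A \<in> M \<rightarrow>\<^sub>M lborels I" "h \<in> borel_measurable M"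
  shows "(\<lambda>x. (A x)(i := h x)) \<in> M \<rightarrow>\<^sub>M lborels (insert i I)"
  by (rule measurable_fun_upd[where J = I]) (use assms in auto)

text \<open>Reduces to one complex coordinate at a time; it is what separates the base coordinate
  \<open>a\<close> from the fibre coordinate \<open>b\<close>.\<close>

lemma nn_integral_lborels_cplx:
  assumes "finite I" "F \<in> borel_measurable (lborels I)"
  shows "(\<integral>\<^sup>+w. F w \<partial>lborels I) = (\<integral>\<^sup>+a. \<integral>\<^sup>+b. F (cplx I a b) \<partial>lborels I \<partial>lborels I)"
  using assms
proof (induction I arbitrary: F rule: finite_induct)
  case empty
  then show ?case by (simp add: lborels.nn_integral_empty cplx_def restrict_def)
next
  case (insert i I)
  note F = insert.prems
  interpret SI: sigma_finite_measure "lborels I :: (nat \<Rightarrow> real) measure"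
    by (rule lborels.sigma_finite) fact
  interpret P: pair_sigma_finite "lborels I :: (nat \<Rightarrow> real) measure" "lborel :: real measure" ..
  have upd: "cplx (insert i I) (a(i := s)) (b(i := t)) = (cplx I a b)(i := Complex s t)" for a b s t
    using insert.hyps by (auto simp: cplx_def fun_eq_iff)
  have Fm: "(\<lambda>x. F ((cplx I (A x) (B x))(i := Complex (g x) (h x)))) \<in> borel_measurable M"
    if "A \<in> M \<rightarrow>\<^sub>M lborels I" "B \<in> M \<rightarrow>\<^sub>M lborels I" "g \<in> borel_measurable M" "h \<in> borel_measurable M"
    for A B g h and M :: "'z measure"
    by (rule measurable_compose[OF measurable_lborels_upd F]) (use that in \<open>auto intro: measurable_cplx borel_measurable_Complex\<close>)
  have Hm: "(\<lambda>x. \<integral>\<^sup>+y. F (x(i := y)) \<partial>lborel) \<in> borel_measurable (lborels I)"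
  proof (rule lborel.borel_measurable_nn_integral)
    show "(\<lambda>(x, y). F (x(i := y))) \<in> borel_measurable (lborels I \<Otimes>\<^sub>M lborel)"
      unfolding case_prod_beta
      by (rule measurable_compose[OF measurable_lborels_upd F]) auto
  qed
  have "(\<integral>\<^sup>+w. F w \<partial>lborels (insert i I)) = (\<integral>\<^sup>+x. \<integral>\<^sup>+y. F (x(i := y)) \<partial>lborel \<partial>lborels I)"
    by (rule lborels.product_nn_integral_insert[OF insert.hyps F])
  also have "\<dots> = (\<integral>\<^sup>+a. \<integral>\<^sup>+b. \<integral>\<^sup>+y. F ((cplx I a b)(i := y)) \<partial>lborel \<partial>lborels I \<partial>lborels I)"
    by (rule insert.IH[OF Hm])
  also have "\<dots> = (\<integral>\<^sup>+a. \<integral>\<^sup>+b. \<integral>\<^sup>+s. \<integral>\<^sup>+t. F ((cplx I a b)(i := Complex s t)) \<partial>lborel \<partial>lborel \<partial>lborels I \<partial>lborels I)"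
  proof (intro nn_integral_cong nn_integral_lborel_complex)
    fix a b :: "nat \<Rightarrow> real"
    show "(\<lambda>y. F ((cplx I a b)(i := y))) \<in> borel_measurable borel"
      by (rule measurable_compose[OF measurable_lborels_upd F]) (auto simp: space_PiM cplx_def)
  qed
  \<comment> \<open>The real part of the new coordinate sits inside the integral over
    \<open>b\<close>; it must move outside before (a, s) and (b, t) can be joined.\<close>
  also have "\<dots> = (\<integral>\<^sup>+a. \<integral>\<^sup>+s. \<integral>\<^sup>+b. \<integral>\<^sup>+t. F ((cplx I a b)(i := Complex s t)) \<partial>lborel \<partial>lborels I \<partial>lborel \<partial>lborels I)"
  proof (rule nn_integral_cong, rule P.Fubini'[symmetric])
    fix a :: "nat \<Rightarrow> real" assume a: "a \<in> space (lborels I)"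
    show "(\<lambda>(b, s). \<integral>\<^sup>+ t. F ((cplx I a b)(i := Complex s t)) \<partial>lborel) \<in> borel_measurable (lborels I \<Otimes>\<^sub>M lborel)"
      unfolding case_prod_beta
    proof (rule lborel.borel_measurable_nn_integral)
      show "(\<lambda>(x, t). F ((cplx I a (fst x))(i := Complex (snd x) t))) \<in> borel_measurable ((lborels I \<Otimes>\<^sub>M lborel) \<Otimes>\<^sub>M lborel)"
        unfolding case_prod_beta by (rule Fm) (use a in auto)
    qed
  qed
  also have "\<dots> = (\<integral>\<^sup>+a. \<integral>\<^sup>+s. \<integral>\<^sup>+b. F (cplx (insert i I) (a(i := s)) b) \<partial>lborels (insert i I) \<partial>lborel \<partial>lborels I)"
  proof (intro nn_integral_cong)
    fix a :: "nat \<Rightarrow> real" and s :: real assume a: "a \<in> space (lborels I)"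
    have "(\<lambda>b. F (cplx (insert i I) (a(i := s)) b)) \<in> borel_measurable (lborels (insert i I))"
      by (rule measurable_compose[OF measurable_cplx F]) (use a in \<open>auto simp: space_PiM\<close>)
    from lborels.product_nn_integral_insert[OF insert.hyps this]
    show "(\<integral>\<^sup>+b. \<integral>\<^sup>+t. F ((cplx I a b)(i := Complex s t)) \<partial>lborel \<partial>lborels I)
        = (\<integral>\<^sup>+b. F (cplx (insert i I) (a(i := s)) b) \<partial>lborels (insert i I))"
      unfolding upd ..
  qed
  also have "\<dots> = (\<integral>\<^sup>+a. \<integral>\<^sup>+b. F (cplx (insert i I) a b) \<partial>lborels (insert i I) \<partial>lborels (insert i I))"
  proof (rule lborels.product_nn_integral_insert[OF insert.hyps, symmetric])
    interpret SI': sigma_finite_measure "lborels (insert i I) :: (nat \<Rightarrow> real) measure"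
      by (rule lborels.sigma_finite) (use insert.hyps in simp)
    show "(\<lambda>a. \<integral>\<^sup>+b. F (cplx (insert i I) a b) \<partial>lborels (insert i I)) \<in> borel_measurable (lborels (insert i I))"
    proof (rule SI'.borel_measurable_nn_integral)
      show "(\<lambda>(a, b). F (cplx (insert i I) a b)) \<in> borel_measurable (lborels (insert i I) \<Otimes>\<^sub>M lborels (insert i I))"
        unfolding case_prod_beta
        by (rule measurable_compose[OF measurable_cplx F]) auto
    qed
  qed
  finally show ?case .
qed

text \<open>Half the unitary map underlying \<open>coeff_c\<close>, extended to complex arguments: at \<open>a + \<i> b\<close> with real
  \<open>a\<close>, \<open>b\<close>, the point \<open>a\<close> determines \<open>x * \<phi> x + \<phi>\<^sup>* x\<close>, and \<open>b\<close> is a coordinate on the fibre.\<close>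

definition fibre_coords :: "nat \<Rightarrow> (nat \<Rightarrow> complex) \<Rightarrow> nat \<Rightarrow> complex" where
  "fibre_coords n w = (\<lambda>k\<in>{1..n}. if 2 * k < Suc n then of_real (sqrt 2 / 4) * (w k + \<i> * w (Suc n - k))
     else if 2 * k = Suc n then w k / 2 else of_real (sqrt 2 / 4) * (w (Suc n - k) - \<i> * w k))"

text \<open>Half a unitary map contributes |1/2|^2 per complex coordinate. On a pair k, n + 1 - k it
  is a composition of two shears with factors 1/8 and 1/2.\<close>

lemma scales_fibre_coords: "scales (lborels {1..n}) (fibre_coords n) (ennreal ((1 / 4) ^ n))"
proof -
  define L H where "L = {k\<in>{1..n}. 2 * k \<le> Suc n}" and "H = {k\<in>{1..n}. Suc n < 2 * k}"
  define s :: complex where "s = of_real (sqrt 2 / 4)"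
  have s0: "s \<noteq> 0" and ns: "(norm s)\<^sup>2 = 1 / 8" by (simp_all add: s_def norm_divide power_divide)
  have ns2: "(norm (- 2 * s * \<i>))\<^sup>2 = 1 / 2" by (simp add: norm_mult power_mult_distrib ns)
  have LH: "L \<union> H = {1..n}" "H \<union> L = {1..n}" "L \<inter> H = {}" "H \<inter> L = {}" "finite L" "finite H"
    by (auto simp: L_def H_def)
  have memH: "Suc n - k \<in> L" if "k \<in> H" for k using that by (auto simp: L_def H_def)
  have memL: "Suc n - k \<in> H" if "k \<in> L" "2 * k \<noteq> Suc n" for k using that by (auto simp: L_def H_def)
  have m1: "(\<lambda>x :: (nat \<Rightarrow> complex) \<times> complex. fst x j) \<in> borel_measurable (lborels I \<Otimes>\<^sub>M lborel)" if "j \<in> I"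
    for I j
    by (rule measurable_compose[OF measurable_fst measurable_lborels_component[OF that]])
  have m2: "(\<lambda>x :: (nat \<Rightarrow> complex) \<times> complex. snd x) \<in> borel_measurable (lborels I \<Otimes>\<^sub>M lborel)" for I
    by measurable
  let ?c = "\<lambda>k. ennreal (if 2 * k = Suc n then 1 / 4 else 1 / 8)"
  have 1: "scales (lborels (H \<union> L))
      (\<lambda>x. \<lambda>k\<in>H \<union> L. if k \<in> L then
          (if 2 * k = Suc n then 1 / 2 * x k else s * x k + s * \<i> * restrict x H (Suc n - k))
        else x k) (\<Prod>k\<in>L. ?c k)"
  proof (rule scales_lborels_shear[where g = "\<lambda>k y t. if 2 * k = Suc n then 1 / 2 * t else s * t + s * \<i> * y (Suc n - k)"])
    show "scales lborel (\<lambda>t. if 2 * k = Suc n then 1 / 2 * t else s * t + s * \<i> * y (Suc n - k)) (?c k)" for k y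
      using scales_complex_affine[OF s0, of "s * \<i> * y (Suc n - k)"] scales_complex_affine[of "1 / 2" 0]
      by (simp add: ns norm_divide power_divide)
    show "(\<lambda>(y, t). if 2 * k = Suc n then 1 / 2 * t else s * t + s * \<i> * y (Suc n - k))
        \<in> borel_measurable (lborels H \<Otimes>\<^sub>M lborel)" if "k \<in> L" for k
    proof (cases "2 * k = Suc n")
      case True
      then show ?thesis unfolding case_prod_beta if_P[OF True]
        by (intro borel_measurable_times borel_measurable_const m2)
    next
      case False
      then show ?thesis unfolding case_prod_beta if_not_P[OF False]
        by (intro borel_measurable_add borel_measurable_times borel_measurable_const m1 m2 memL that)
    qed
  qed (use LH in auto)
  have 2: "scales (lborels (L \<union> H))
      (\<lambda>x. \<lambda>k\<in>L \<union> H. if k \<in> H then (- 2 * s * \<i>) * x k + restrict x L (Suc n - k) else x k) (\<Prod>k\<in>H. ennreal (1 / 2))"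
  proof (rule scales_lborels_shear[where g = "\<lambda>k y t. (- 2 * s * \<i>) * t + y (Suc n - k)"])
    show "scales lborel (\<lambda>t. (- 2 * s * \<i>) * t + y (Suc n - k)) (ennreal (1 / 2))" for k y
      unfolding ns2[symmetric] by (rule scales_complex_affine) (use s0 in auto)
    show "(\<lambda>(y, t). (- 2 * s * \<i>) * t + y (Suc n - k)) \<in> borel_measurable (lborels L \<Otimes>\<^sub>M lborel)" if "k \<in> H" for k
      unfolding case_prod_beta
      by (intro borel_measurable_add borel_measurable_times borel_measurable_const m1 m2 memH that)
  qed (use LH in auto)
  have prod: "(\<Prod>k\<in>H. ennreal (1 / 2)) * (\<Prod>k\<in>L. ?c k) = ennreal ((1 / 4) ^ n)"
  proof -
    have re: "(\<Prod>k\<in>H. r) = (\<Prod>k\<in>L. if 2 * k = Suc n then 1 else r)" for r :: real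
    proof -
      have "(\<Prod>k\<in>H. r) = (\<Prod>k\<in>{k\<in>L. 2 * k \<noteq> Suc n}. r)"
        by (rule prod.reindex_bij_witness[of _ "\<lambda>k. Suc n - k" "\<lambda>k. Suc n - k"]) (auto simp: L_def H_def)
      also have "\<dots> = (\<Prod>k\<in>L. if 2 * k = Suc n then 1 else r)"
        by (subst prod.inter_filter[OF LH(5)]) (auto intro!: prod.cong)
      finally show ?thesis .
    qed
    have "(\<Prod>k\<in>H. ennreal (1 / 2)) * (\<Prod>k\<in>L. ?c k)
        = ennreal ((\<Prod>k\<in>H. 1 / 2) * (\<Prod>k\<in>L. if 2 * k = Suc n then 1 / 4 else 1 / 8))"
      by (subst (1 2) prod_ennreal) (auto intro!: ennreal_mult[symmetric] prod_nonneg)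
    also have "(\<Prod>k\<in>H. 1 / 2) * (\<Prod>k\<in>L. if 2 * k = Suc n then 1 / 4 else 1 / 8)
        = (\<Prod>k\<in>L. 1 / 4) * (\<Prod>k\<in>H. 1 / 4 :: real)"
      unfolding re prod.distrib[symmetric] by (intro prod.cong) auto
    also have "\<dots> = (\<Prod>k\<in>{1..n}. 1 / 4)"
      using LH by (metis prod.union_disjoint)
    finally show ?thesis by simp
  qed
  show ?thesis
  proof (rule scales_cong[OF scales_compose[OF 2[unfolded LH(1)] 1[unfolded LH(2)]]])
    show "(\<Prod>k\<in>H. ennreal (1 / 2)) * (\<Prod>k\<in>L. ?c k) = ennreal ((1 / 4) ^ n)" by (rule prod)
  next
    fix x :: "nat \<Rightarrow> complex"
    let ?y = "\<lambda>k\<in>{1..n}. if k \<in> L then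
          (if 2 * k = Suc n then 1 / 2 * x k else s * x k + s * \<i> * restrict x H (Suc n - k))
        else x k"
    show "(\<lambda>k\<in>{1..n}. if k \<in> H then (- 2 * s * \<i>) * ?y k + restrict ?y L (Suc n - k) else ?y k) = fibre_coords n x"
      unfolding fibre_coords_def s_def[symmetric]
    proof (rule restrict_ext)
      fix k assume k: "k \<in> {1..n}"
      consider "k \<in> H" "k \<notin> L" | "k \<in> L" "k \<notin> H" "2 * k = Suc n" | "k \<in> L" "k \<notin> H" "2 * k \<noteq> Suc n"
        using k LH by blast
      then show "(if k \<in> H then (- 2 * s * \<i>) * ?y k + restrict ?y L (Suc n - k) else ?y k)
         = (if 2 * k < Suc n then s * (x k + \<i> * x (Suc n - k))
     else if 2 * k = Suc n then x k / 2 else s * (x (Suc n - k) - \<i> * x k))"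
      proof cases
        case 1
        have S: "Suc n - (Suc n - k) = k" "Suc n - k \<in> {1..n}" "2 * (Suc n - k) \<noteq> Suc n" "Suc n < 2 * k"
          using k 1 by (auto simp: H_def)
        have "(- 2 * s * \<i>) * x k + (s * x (Suc n - k) + s * \<i> * x k) = s * (x (Suc n - k) - \<i> * x k)"
          by (simp add: algebra_simps)
        then show ?thesis using 1 k S memH[OF 1(1)] by simp
      next
        case 2
        then show ?thesis using k by simp
      next
        case 3
        then have "2 * k < Suc n" by (simp add: L_def)
        then show ?thesis using 3 k memL[OF 3(1,3)] by (simp add: algebra_simps)
      qed
    qed
  qed
qed

text \<open>The contributions of \<open>b\<close> to the two summands cancel, while those of
  \<open>a\<close>, halved in \<open>fibre_coords\<close>, coincide. Hence every \<open>b\<close>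
  gives a \<phi> above the same polynomial.\<close>

lemma fibre_coords_cplx:
  assumes k: "k \<in> {1..n}"
  shows "coeff_c (Suc n) a k = fibre_coords n (cplx {1..n} a b) k + cnj (fibre_coords n (cplx {1..n} a b) (Suc n - k))"
proof -
  have S: "Suc n - (Suc n - k) = k" "Suc n - k \<in> {1..n}" using k by auto
  consider "2 * k < Suc n" | "2 * k = Suc n" | "2 * k > Suc n" by linarith
  then show ?thesis
  proof cases
    case 1
    then have "\<not> 2 * (Suc n - k) < Suc n" "2 * (Suc n - k) \<noteq> Suc n" by auto
    then show ?thesis using 1 S k
      by (simp add: fibre_coords_def coeff_c_def cplx_def complex_eq_iff algebra_simps)
  next
    case 2
    then have "Suc n - k = k" by simp
    then show ?thesis using 2 k by (simp add: fibre_coords_def coeff_c_def cplx_def complex_eq_iff)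
  next
    case 3
    then have "2 * (Suc n - k) < Suc n" "2 * (Suc n - k) \<noteq> Suc n" by auto
    then show ?thesis using 3 S k
      by (simp add: fibre_coords_def coeff_c_def cplx_def complex_eq_iff algebra_simps)
  qed
qed

lemma poly_assoc_poly:
  "poly (assoc_poly (Suc n) a) x = monic_eval (Suc n) ((coeff_c (Suc n) a)(Suc n := 1)) x"
proof -
  have "(\<Sum>k = 1..Suc n. ((coeff_c (Suc n) a)(Suc n := 1)) k * x ^ (Suc n - k))
      = (\<Sum>k = 1..n. coeff_c (Suc n) a k * x ^ (Suc n - k)) + 1"
    by (simp add: sum.nat_ivl_Suc')
  then show ?thesis
    by (simp only: monic_eval_def) (simp add: assoc_poly_def poly_monom poly_sum)
qed

lemma poly_assoc_poly_monic_eval: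
  "poly (assoc_poly (Suc n) a) x = x * monic_eval n (fibre_coords n (cplx {1..n} a b)) x + reversed_eval n (fibre_coords n (cplx {1..n} a b)) x"
  unfolding poly_assoc_poly
  using monic_eval_step(1)[of "(coeff_c (Suc n) a)(Suc n := 1)" n 1 "fibre_coords n (cplx {1..n} a b)" x]
  by (simp add: fibre_coords_cplx[of _ n a b])

section \<open>Scaling factors of evaluation maps and of real parts\<close>

text \<open>Lets an induction on the dimension apply the map for \<open>I\<close> while the new
  coordinate is left untouched.\<close>

lemma scales_lborels_extend:
  fixes T :: "(nat \<Rightarrow> 'a::euclidean_space) \<Rightarrow> nat \<Rightarrow> 'a"
  assumes "finite I" "i \<notin> I" and T: "scales (lborels I) T c"
  shows "scales (lborels (insert i I)) (\<lambda>x. (T (restrict x I))(i := x i)) c"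
  unfolding scales_def
proof (intro conjI ballI)
  let ?T = "\<lambda>x. (T (restrict x I))(i := x i)"
  have "(\<lambda>x. T (restrict x I)) \<in> lborels (insert i I) \<rightarrow>\<^sub>M lborels I"
    by (rule measurable_compose[OF measurable_restrict_subset scales_measurable[OF T]]) auto
  then show mT: "?T \<in> lborels (insert i I) \<rightarrow>\<^sub>M lborels (insert i I)"
    by (rule measurable_lborels_upd) (auto intro: measurable_lborels_component)
  fix f :: "(nat \<Rightarrow> 'a) \<Rightarrow> ennreal" assume f: "f \<in> borel_measurable (lborels (insert i I))"
  have fy: "(\<lambda>x. f (x(i := y))) \<in> borel_measurable (lborels I)" for y
    by (rule measurable_compose[OF measurable_lborels_upd f]) auto
  interpret SI: sigma_finite_measure "lborels I :: (nat \<Rightarrow> 'a) measure"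
    by (rule lborels.sigma_finite) fact
  have eq: "(\<integral>\<^sup>+x. f (?T (x(i := y))) \<partial>lborels I) = (\<integral>\<^sup>+x. f ((T x)(i := y)) \<partial>lborels I)" for y
  proof (rule nn_integral_cong)
    fix x :: "nat \<Rightarrow> 'a" assume "x \<in> space (lborels I)"
    then have "restrict (x(i := y)) I = x"
      using assms(2) by (auto simp: space_PiM fun_eq_iff PiE_def extensional_def)
    then show "f (?T (x(i := y))) = f ((T x)(i := y))" by simp
  qed
  have "(\<lambda>y. \<integral>\<^sup>+x. f ((T x)(i := y)) \<partial>lborels I) \<in> borel_measurable lborel"
  proof (rule SI.borel_measurable_nn_integral)
    have "(\<lambda>x. T (snd x)) \<in> lborel \<Otimes>\<^sub>M lborels I \<rightarrow>\<^sub>M lborels I"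
      by (rule measurable_compose[OF measurable_snd scales_measurable[OF T]])
    then have "(\<lambda>x. (T (snd x))(i := fst x)) \<in> lborel \<Otimes>\<^sub>M lborels I \<rightarrow>\<^sub>M lborels (insert i I)"
      by (rule measurable_lborels_upd) auto
    from measurable_compose[OF this f]
    show "(\<lambda>(y, x). f ((T x)(i := y))) \<in> borel_measurable (lborel \<Otimes>\<^sub>M lborels I)"
      by (simp add: case_prod_beta)
  qed
  then have "(\<integral>\<^sup>+x. f (?T x) \<partial>lborels (insert i I)) * c
      = (\<integral>\<^sup>+y. (\<integral>\<^sup>+x. f ((T x)(i := y)) \<partial>lborels I) * c \<partial>lborel)"
    by (subst lborels.product_nn_integral_insert_rev[OF assms(1,2) measurable_compose[OF mT f]])
      (simp only: eq nn_integral_multc)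
  also have "\<dots> = (\<integral>\<^sup>+y. (\<integral>\<^sup>+x. f (x(i := y)) \<partial>lborels I) \<partial>lborel)"
    by (simp only: scalesD[OF T fy])
  also have "\<dots> = (\<integral>\<^sup>+x. f x \<partial>lborels (insert i I))"
    by (rule lborels.product_nn_integral_insert_rev[OF assms(1,2) f, symmetric])
  finally show "(\<integral>\<^sup>+x. f (?T x) \<partial>lborels (insert i I)) * c = (\<integral>\<^sup>+x. f x \<partial>lborels (insert i I))" .
qed

section \<open>Horner's scheme and the Vandermonde factor\<close>

lemma monic_eval_Suc: "monic_eval (Suc n) \<phi> x = x * monic_eval n \<phi> x + \<phi> (Suc n)"
proof -
  have "(\<Sum>k = 1..n. \<phi> k * x ^ (Suc n - k)) = (\<Sum>k = 1..n. x * (\<phi> k * x ^ (n - k)))"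
    by (rule sum.cong) (auto simp: Suc_diff_le)
  then show ?thesis by (simp add: monic_eval_def sum_distrib_left algebra_simps)
qed

lemma monic_eval_cong: "(\<And>k. k \<in> {1..n} \<Longrightarrow> \<phi> k = \<psi> k) \<Longrightarrow> monic_eval n \<phi> x = monic_eval n \<psi> x"
  by (simp add: monic_eval_def)

text \<open>The partial values of Horner's scheme at z are the coefficients of the quotient by x -
  z.\<close>

lemma monic_eval_synthetic_division:
  "monic_eval (Suc n) \<phi> x = (x - z) * monic_eval n (\<lambda>k. monic_eval k \<phi> z) x + monic_eval (Suc n) \<phi> z"
proof (induction n)
  case 0
  show ?case by (simp add: monic_eval_def)
next
  case (Suc n)
  have "monic_eval (Suc (Suc n)) \<phi> x = x * ((x - z) * monic_eval n (\<lambda>k. monic_eval k \<phi> z) x + monic_eval (Suc n) \<phi> z) + \<phi> (Suc (Suc n))"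
    by (subst monic_eval_Suc) (simp only: Suc)
  also have "\<dots> = (x - z) * (x * monic_eval n (\<lambda>k. monic_eval k \<phi> z) x + monic_eval (Suc n) \<phi> z) + (z * monic_eval (Suc n) \<phi> z + \<phi> (Suc (Suc n)))"
    by (simp add: algebra_simps)
  finally show ?case by (simp only: monic_eval_Suc[of "Suc n" \<phi> z] monic_eval_Suc[of n "\<lambda>k. monic_eval k \<phi> z" x])
qed

lemma measurable_monic_eval:
  assumes "{1..n} \<subseteq> I"
  shows "(\<lambda>\<phi>. monic_eval n \<phi> x) \<in> borel_measurable (lborels I)"
  unfolding monic_eval_def
  by (intro borel_measurable_add borel_measurable_sum borel_measurable_times borel_measurable_const
      measurable_lborels_component) (use assms in auto)

text \<open>Horner's scheme is unitriangular: each value is \<open>\<phi> k\<close> plus z times the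
  preceding value.\<close>

lemma scales_horner: "scales (lborels {1..m}) (\<lambda>\<phi>. \<lambda>k\<in>{1..m}. monic_eval k \<phi> z) 1"
proof (induction m)
  case 0
  show ?case
    by (rule scales_cong[of _ "\<lambda>x. x" 1]) (auto simp: scales_def space_PiM)
next
  case (Suc m)
  have ins: "{1..m} \<union> {Suc m} = {1..Suc m}" "insert (Suc m) {1..m} = {1..Suc m}" by auto
  have 1: "scales (lborels ({1..m} \<union> {Suc m})) (\<lambda>x. \<lambda>k\<in>{1..m} \<union> {Suc m}. if k \<in> {Suc m}
      then 1 * x k + z * monic_eval m (restrict x {1..m}) z else x k) (\<Prod>k\<in>{Suc m}. 1)"
  proof (rule scales_lborels_shear[where g = "\<lambda>k y t. 1 * t + z * monic_eval m y z"])
    show "scales lborel (\<lambda>t. 1 * t + z * monic_eval m y z) 1" for y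
      using scales_complex_affine[of 1 "z * monic_eval m y z"] by simp
    show "(\<lambda>(y, t). 1 * t + z * monic_eval m y z) \<in> borel_measurable (lborels {1..m} \<Otimes>\<^sub>M lborel)"
      unfolding case_prod_beta
      by (intro borel_measurable_add borel_measurable_times borel_measurable_const
          measurable_compose[OF measurable_fst measurable_monic_eval]) auto
  qed auto
  have 2: "scales (lborels (insert (Suc m) {1..m}))
      (\<lambda>x. (\<lambda>k\<in>{1..m}. monic_eval k (restrict x {1..m}) z)(Suc m := x (Suc m))) 1"
    by (rule scales_lborels_extend[OF _ _ Suc]) auto
  show ?case
  proof (rule scales_cong[OF scales_compose[OF 2[unfolded ins] 1[unfolded ins]]])
    fix x :: "nat \<Rightarrow> complex"
    let ?y = "\<lambda>k\<in>{1..Suc m}. if k \<in> {Suc m} then 1 * x k + z * monic_eval m (restrict x {1..m}) z else x k"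
    have e1: "monic_eval k (restrict ?y {1..m}) z = monic_eval k x z" if "k \<in> {1..m}" for k
      by (rule monic_eval_cong) (use that in auto)
    have e2: "monic_eval m (restrict x {1..m}) z = monic_eval m x z" by (rule monic_eval_cong) auto
    show "(\<lambda>k\<in>{1..m}. monic_eval k (restrict ?y {1..m}) z)(Suc m := ?y (Suc m)) = (\<lambda>k\<in>{1..Suc m}. monic_eval k x z)"
      using e1 e2 monic_eval_Suc[of m x z] by (auto simp: fun_eq_iff)
  qed simp
qed

text \<open>Eliminates the last node: \<open>scales_horner\<close> passes to the quotient by x -
  z_(n+1) together with the value there, the induction hypothesis evaluates the quotient at the
  other nodes, and a shear multiplies by z_j - z_(n+1) and adds the value back. The factors build
  the squared modulus of the Vandermonde determinant.\<close>

lemma scales_evaluation: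
  assumes "inj_on z {1..n}"
  shows "scales (lborels {1..n}) (\<lambda>\<phi>. \<lambda>j\<in>{1..n}. monic_eval n \<phi> (z j))
    (ennreal (\<Prod>k\<in>{1..n}. \<Prod>j\<in>{1..<k}. (norm (z j - z k))\<^sup>2))"
  using assms
proof (induction n)
  case 0
  show ?case
    by (rule scales_cong[of _ "\<lambda>x. x" 1]) (auto simp: scales_def space_PiM)
next
  case (Suc n)
  have ins: "{Suc n} \<union> {1..n} = {1..Suc n}" "insert (Suc n) {1..n} = {1..Suc n}" by auto
  have "inj_on z {1..n}" using Suc.prems by (rule inj_on_subset) auto
  note IH = Suc.IH[OF this]
  have ne: "z j - z (Suc n) \<noteq> 0" if "j \<in> {1..n}" for j
    using inj_onD[OF Suc.prems, of j "Suc n"] that by auto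
  have 2: "scales (lborels (insert (Suc n) {1..n}))
      (\<lambda>x. (\<lambda>j\<in>{1..n}. monic_eval n (restrict x {1..n}) (z j))(Suc n := x (Suc n)))
      (ennreal (\<Prod>k\<in>{1..n}. \<Prod>j\<in>{1..<k}. (norm (z j - z k))\<^sup>2))"
    by (rule scales_lborels_extend[OF _ _ IH]) auto
  have 3: "scales (lborels ({Suc n} \<union> {1..n})) (\<lambda>x. \<lambda>j\<in>{Suc n} \<union> {1..n}. if j \<in> {1..n}
      then (z j - z (Suc n)) * x j + restrict x {Suc n} (Suc n) else x j)
      (\<Prod>j\<in>{1..n}. ennreal ((norm (z j - z (Suc n)))\<^sup>2))"
  proof (rule scales_lborels_shear[where g = "\<lambda>j y t. (z j - z (Suc n)) * t + y (Suc n)"])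
    show "scales lborel (\<lambda>t. (z j - z (Suc n)) * t + y (Suc n)) (ennreal ((norm (z j - z (Suc n)))\<^sup>2))"
      if "j \<in> {1..n}" for j y
      by (rule scales_complex_affine[OF ne[OF that]])
    show "(\<lambda>(y, t). (z j - z (Suc n)) * t + y (Suc n)) \<in> borel_measurable (lborels {Suc n} \<Otimes>\<^sub>M lborel)" for j
      unfolding case_prod_beta
      by (intro borel_measurable_add borel_measurable_times borel_measurable_const
          measurable_compose[OF measurable_fst measurable_lborels_component]) auto
  qed auto
  show ?case
  proof (rule scales_cong[OF scales_compose[OF 3[unfolded ins] scales_compose[OF 2[unfolded ins] scales_horner[of "Suc n" "z (Suc n)"]]]])
    fix x :: "nat \<Rightarrow> complex"
    let ?h = "\<lambda>k\<in>{1..Suc n}. monic_eval k x (z (Suc n))"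
    let ?v = "(\<lambda>j\<in>{1..n}. monic_eval n (restrict ?h {1..n}) (z j))(Suc n := ?h (Suc n))"
    have e: "monic_eval n (restrict ?h {1..n}) y = monic_eval n (\<lambda>k. monic_eval k x (z (Suc n))) y" for y
      by (rule monic_eval_cong) auto
    show "(\<lambda>j\<in>{1..Suc n}. if j \<in> {1..n}
        then (z j - z (Suc n)) * ?v j + restrict ?v {Suc n} (Suc n) else ?v j) = (\<lambda>j\<in>{1..Suc n}. monic_eval (Suc n) x (z j))"
    proof (rule restrict_ext)
      fix j assume j: "j \<in> {1..Suc n}"
      show "(if j \<in> {1..n} then (z j - z (Suc n)) * ?v j + restrict ?v {Suc n} (Suc n) else ?v j) = monic_eval (Suc n) x (z j)"
      proof (cases "j = Suc n")
        case False
        then have "j \<in> {1..n}" "j \<noteq> Suc n" using j by auto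
        then show ?thesis using e[of "z j"] monic_eval_synthetic_division[of n x "z j" "z (Suc n)"] by simp
      qed simp
    qed
    show "(\<Prod>j\<in>{1..n}. ennreal ((norm (z j - z (Suc n)))\<^sup>2)) *
        (ennreal (\<Prod>k\<in>{1..n}. \<Prod>j\<in>{1..<k}. (norm (z j - z k))\<^sup>2) * 1) =
        ennreal (\<Prod>k\<in>{1..Suc n}. \<Prod>j\<in>{1..<k}. (norm (z j - z k))\<^sup>2)"
    proof -
      have e: "{1..<Suc n} = {1..n}" by auto
      have "(\<Prod>j\<in>{1..n}. ennreal ((norm (z j - z (Suc n)))\<^sup>2)) = ennreal (\<Prod>j\<in>{1..<Suc n}. (norm (z j - z (Suc n)))\<^sup>2)"
        unfolding e by (rule prod_ennreal) simp
      moreover have "(\<Prod>k\<in>{1..Suc n}. \<Prod>j\<in>{1..<k}. (norm (z j - z k))\<^sup>2)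
         = (\<Prod>j\<in>{1..<Suc n}. (norm (z j - z (Suc n)))\<^sup>2) * (\<Prod>k\<in>{1..n}. \<Prod>j\<in>{1..<k}. (norm (z j - z k))\<^sup>2)"
        unfolding ins(2)[symmetric] by (subst prod.insert) auto
      ultimately show ?thesis
        by (simp only: mult_1_right) (rule ennreal_mult[symmetric]; intro prod_nonneg ballI; simp)
    qed
  qed
qed

lemma ennreal_square_inject:
  fixes x y :: ennreal
  assumes "x * x = y * y"
  shows "x = y"
proof (cases x y rule: ennreal2_cases)
  case (real_real r s)
  then have "ennreal (r * r) = ennreal (s * s)" using assms by (simp only: ennreal_mult)
  then have "r\<^sup>2 = s\<^sup>2" using real_real by (simp add: power2_eq_square)
  then show ?thesis using real_real by simp
qed (use assms in \<open>auto simp: ennreal_mult_top ennreal_mult[symmetric]\<close>)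

text \<open>A real affine map inherits its scaling factor from its complexification, since the
  latter acts on real and imaginary parts separately by the same linear part.\<close>

lemma scales_real_part:
  fixes T :: "(nat \<Rightarrow> complex) \<Rightarrow> nat \<Rightarrow> complex" and A :: "(nat \<Rightarrow> real) \<Rightarrow> nat \<Rightarrow> real"
  assumes I: "finite I" and T: "scales (lborels I) T (ennreal \<kappa>)" and \<kappa>: "\<kappa> \<ge> 0"
    and A: "A \<in> lborels I \<rightarrow>\<^sub>M lborels I"
    and TA: "\<And>s t. s \<in> space (lborels I) \<Longrightarrow> t \<in> space (lborels I) \<Longrightarrow>
       T (cplx I (\<lambda>k\<in>I. a k + s k) t) = cplx I (A t) (\<lambda>k\<in>I. c k - A s k)"
  shows "scales (lborels I) A (ennreal (sqrt \<kappa>))"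
proof -
  have shift: "scales (lborels I) (\<lambda>x. \<lambda>k\<in>I. a k + x k) 1"
  proof (rule scales_cong[OF scales_lborels_coordinatewise[OF I]])
    show "scales lborel (\<lambda>x. a k + x) 1" for k using scales_lborel_affine[of 1 "a k"] by simp
  qed auto
  have refl: "scales (lborels I) (\<lambda>x. \<lambda>k\<in>I. c k - x k) 1"
  proof (rule scales_cong[OF scales_lborels_coordinatewise[OF I]])
    show "scales lborel (\<lambda>x. c k - x) 1" for k using scales_lborel_affine[of "-1" "c k"] by simp
  qed auto
  let ?re = "\<lambda>w :: nat \<Rightarrow> complex. \<lambda>k\<in>I. Re (w k)" and ?im = "\<lambda>w :: nat \<Rightarrow> complex. \<lambda>k\<in>I. c k - Im (w k)"
  have m: "?re \<in> lborels I \<rightarrow>\<^sub>M lborels I" "?im \<in> lborels I \<rightarrow>\<^sub>M lborels I"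
  proof -
    have [measurable]: "(\<lambda>w :: nat \<Rightarrow> complex. w k) \<in> borel_measurable (lborels I)" if "k \<in> I" for k
      using that by (rule measurable_lborels_component)
    show "?re \<in> lborels I \<rightarrow>\<^sub>M lborels I" "?im \<in> lborels I \<rightarrow>\<^sub>M lborels I"
      by (intro measurable_restrict; simp)+
  qed
  have scale: "emeasure (distr (lborels I) (lborels I) A) X * ennreal (sqrt \<kappa>) = emeasure (lborels I) X"
    if X: "X \<in> sets (lborels I)" for X
  proof -
    \<comment> \<open>Product test sets: by \<open>TA\<close> the real part of the image depends
      only on t and its imaginary part only on s. Reflecting the latter in \<open>c\<close> restores
      \<open>A s\<close>, so the integral over the complexification becomes a square.\<close>
    let ?f = "\<lambda>w. indicator X (?re w) * indicator X (?im w) :: ennreal"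
    have iX: "(\<lambda>x. indicator X x :: ennreal) \<in> borel_measurable (lborels I)" using X by simp
    have f: "?f \<in> borel_measurable (lborels I)"
      by (intro borel_measurable_times_ennreal measurable_compose[OF m(1) iX] measurable_compose[OF m(2) iX])
    have fT: "(\<lambda>w. ?f (T w)) \<in> borel_measurable (lborels I)"
      by (rule measurable_compose[OF scales_measurable[OF T] f])
    have iA: "(\<lambda>x. indicator X (A x) :: ennreal) \<in> borel_measurable (lborels I)"
      by (rule measurable_compose[OF A iX])
    let ?V = "\<integral>\<^sup>+x. indicator X (A x) \<partial>lborels I" and ?U = "\<integral>\<^sup>+x. indicator X x \<partial>lborels I"
    interpret SI: sigma_finite_measure "lborels I :: (nat \<Rightarrow> real) measure"
      by (rule lborels.sigma_finite) fact
    have inner: "(\<lambda>a. \<integral>\<^sup>+b. ?f (T (cplx I a b)) \<partial>lborels I) \<in> borel_measurable (lborels I)"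
    proof (rule SI.borel_measurable_nn_integral)
      have "(\<lambda>x. cplx I (fst x) (snd x)) \<in> lborels I \<Otimes>\<^sub>M lborels I \<rightarrow>\<^sub>M lborels I"
        by (rule measurable_cplx) auto
      from measurable_compose[OF this fT]
      show "(\<lambda>(a, b). ?f (T (cplx I a b))) \<in> borel_measurable (lborels I \<Otimes>\<^sub>M lborels I)"
        by (simp add: case_prod_beta)
    qed
    have "(\<integral>\<^sup>+w. ?f (T w) \<partial>lborels I) = (\<integral>\<^sup>+a. \<integral>\<^sup>+b. ?f (T (cplx I a b)) \<partial>lborels I \<partial>lborels I)"
      by (rule nn_integral_lborels_cplx[OF I fT])
    also have "\<dots> = (\<integral>\<^sup>+s. \<integral>\<^sup>+t. ?f (T (cplx I (\<lambda>k\<in>I. a k + s k) t)) \<partial>lborels I \<partial>lborels I)"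
      using scalesD[OF shift inner] by (simp only: mult_1_right)
    also have "\<dots> = (\<integral>\<^sup>+s. \<integral>\<^sup>+t. indicator X (A t) * indicator X (A s) \<partial>lborels I \<partial>lborels I)"
    proof (intro nn_integral_cong)
      fix s t :: "nat \<Rightarrow> real" assume st: "s \<in> space (lborels I)" "t \<in> space (lborels I)"
      have "A s \<in> space (lborels I)" "A t \<in> space (lborels I)"
        using measurable_space[OF A] st by auto
      then have "?re (cplx I (A t) (\<lambda>k\<in>I. c k - A s k)) = A t" "?im (cplx I (A t) (\<lambda>k\<in>I. c k - A s k)) = A s"
        by (auto simp: cplx_def space_PiM fun_eq_iff PiE_def extensional_def)
      then show "?f (T (cplx I (\<lambda>k\<in>I. a k + s k) t)) = indicator X (A t) * indicator X (A s)"
        unfolding TA[OF st] by (simp only:)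
    qed
    also have "\<dots> = ?V * ?V"
      by (simp only: nn_integral_multc[OF iA] nn_integral_cmult[OF iA])
    finally have L: "(\<integral>\<^sup>+w. ?f (T w) \<partial>lborels I) = ?V * ?V" .
    have "(\<integral>\<^sup>+w. ?f w \<partial>lborels I) = (\<integral>\<^sup>+a. \<integral>\<^sup>+b. ?f (cplx I a b) \<partial>lborels I \<partial>lborels I)"
      by (rule nn_integral_lborels_cplx[OF I f])
    also have "\<dots> = (\<integral>\<^sup>+a. \<integral>\<^sup>+b. indicator X a * indicator X (\<lambda>k\<in>I. c k - b k) \<partial>lborels I \<partial>lborels I)"
    proof (intro nn_integral_cong)
      fix s t :: "nat \<Rightarrow> real" assume st: "s \<in> space (lborels I)" "t \<in> space (lborels I)"
      have "?re (cplx I s t) = s" "?im (cplx I s t) = (\<lambda>k\<in>I. c k - t k)"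
        using st by (auto simp: cplx_def space_PiM fun_eq_iff PiE_def extensional_def)
      then show "?f (cplx I s t) = indicator X s * indicator X (\<lambda>k\<in>I. c k - t k)"
        by (simp only:)
    qed
    also have "\<dots> = ?U * (\<integral>\<^sup>+b. indicator X (\<lambda>k\<in>I. c k - b k) \<partial>lborels I)"
    proof -
      have "(\<lambda>b. indicator X (\<lambda>k\<in>I. c k - b k) :: ennreal) \<in> borel_measurable (lborels I)"
        by (rule measurable_compose[OF scales_measurable[OF refl] iX])
      then show ?thesis by (simp only: nn_integral_multc[OF iX] nn_integral_cmult)
    qed
    also have "(\<integral>\<^sup>+b. indicator X (\<lambda>k\<in>I. c k - b k) \<partial>lborels I) = ?U"
      using scalesD[OF refl iX] by (simp only: mult_1_right)
    finally have R: "(\<integral>\<^sup>+w. ?f w \<partial>lborels I) = ?U * ?U" .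
    have "?V * ?V * ennreal \<kappa> = ?U * ?U"
      using scalesD[OF T f] unfolding L R .
    moreover have "ennreal \<kappa> = ennreal (sqrt \<kappa>) * ennreal (sqrt \<kappa>)"
      using \<kappa> by (simp add: ennreal_mult[symmetric])
    ultimately have "(?V * ennreal (sqrt \<kappa>)) * (?V * ennreal (sqrt \<kappa>)) = ?U * ?U"
      by (simp only: mult_ac)
    then have "?V * ennreal (sqrt \<kappa>) = ?U" by (rule ennreal_square_inject)
    moreover have "emeasure (distr (lborels I) (lborels I) A) X = ?V"
      using nn_integral_distr[OF A, of "indicator X"] X by simp
    ultimately show ?thesis using X by simp
  qed
  \<comment> \<open>The identity on sets amounts to an equality of measures, which then covers all
    nonnegative measurable functions.\<close>
  have eq: "scale_measure (ennreal (sqrt \<kappa>)) (distr (lborels I) (lborels I) A) = lborels I"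
    by (rule measure_eqI) (use scale in \<open>auto simp: mult.commute\<close>)
  show ?thesis
    unfolding scales_def
  proof (intro conjI ballI A)
    fix f :: "(nat \<Rightarrow> real) \<Rightarrow> ennreal" assume f: "f \<in> borel_measurable (lborels I)"
    have "(\<integral>\<^sup>+x. f x \<partial>lborels I) = (\<integral>\<^sup>+x. f x \<partial>scale_measure (ennreal (sqrt \<kappa>)) (distr (lborels I) (lborels I) A))"
      unfolding eq ..
    also have "\<dots> = ennreal (sqrt \<kappa>) * (\<integral>\<^sup>+x. f (A x) \<partial>lborels I)"
      using f A by (simp add: nn_integral_scale_measure nn_integral_distr)
    finally show "(\<integral>\<^sup>+x. f (A x) \<partial>lborels I) * ennreal (sqrt \<kappa>) = (\<integral>\<^sup>+x. f x \<partial>lborels I)"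
      by (simp add: mult.commute)
  qed
qed

section \<open>The Dirichlet integral\<close>

text \<open>Dirichlet density with all parameters 1/2, in simplex coordinates from which the last
  mass \<open>s - sum x I\<close> has been eliminated. The total mass \<open>s\<close> is kept
  variable so that coordinates can be split off one by one.\<close>

definition dirichlet_density :: "nat set \<Rightarrow> real \<Rightarrow> (nat \<Rightarrow> real) \<Rightarrow> ennreal" where
  "dirichlet_density I s x = (if (\<forall>j\<in>I. 0 < x j) \<and> sum x I < s
     then ennreal (((\<Prod>j\<in>I. x j) * (s - sum x I)) powr (- 1 / 2)) else 0)"

text \<open>This is Gamma(1/2)^(m+1) / Gamma((m+1)/2), the multivariate Beta function at m + 1
  parameters 1/2; the additional parameter belongs to the eliminated mass.\<close>

definition dirichlet_const :: "nat \<Rightarrow> real" where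
  "dirichlet_const m = pi powr ((real m + 1) / 2) / Gamma ((real m + 1) / 2)"

lemma dirichlet_const_Suc:
  "dirichlet_const m * Beta (1 / 2) ((real m + 1) / 2) = dirichlet_const (Suc m)"
proof -
  have "(real m + 1) / 2 > 0" by simp
  then have g: "Gamma ((real m + 1) / 2) \<noteq> 0" using Gamma_real_pos less_irrefl by metis
  have e: "(real (Suc m) + 1) / 2 = 1 / 2 + (real m + 1) / 2" by (simp add: field_simps)
  have "pi powr (1 / 2 + (real m + 1) / 2) = sqrt pi * pi powr ((real m + 1) / 2)"
    by (subst powr_add) (simp add: powr_half_sqrt)
  then show ?thesis using g
    unfolding dirichlet_const_def Beta_def e Gamma_one_half_real by simp
qed

lemma dirichlet_const_nonneg: "0 \<le> dirichlet_const m"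
  unfolding dirichlet_const_def by (intro divide_nonneg_nonneg less_imp_le[OF Gamma_real_pos]) auto

lemma nn_integral_beta_scaled:
  assumes s: "s > 0" and "a > 0" "b > 0"
  shows "(\<integral>\<^sup>+y. ennreal (y powr (a - 1) * (s - y) powr (b - 1)) * indicator {0<..<s} y \<partial>lborel)
     = ennreal (s powr (a + b - 1) * Beta a b)"
proof -
  let ?f = "\<lambda>y. ennreal (y powr (a - 1) * (s - y) powr (b - 1)) * indicator {0<..<s} y"
  have "(\<integral>\<^sup>+y. ?f y \<partial>lborel) = (\<integral>\<^sup>+t. ?f (s * t + 0) \<partial>lborel) * ennreal \<bar>s\<bar>"
    by (rule nn_integral_lborel_scale[symmetric]) (use s in auto)
  also have "(\<integral>\<^sup>+t. ?f (s * t + 0) \<partial>lborel)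
     = (\<integral>\<^sup>+t. ennreal (s powr (a + b - 2)) * (ennreal (t powr (a - 1) * (1 - t) powr (b - 1)) * indicator {0<..<1} t) \<partial>lborel)"
  proof (rule nn_integral_cong)
    fix t :: real
    show "?f (s * t + 0) = ennreal (s powr (a + b - 2)) * (ennreal (t powr (a - 1) * (1 - t) powr (b - 1)) * indicator {0<..<1} t)"
    proof (cases "0 < t \<and> t < 1")
      case True
      have "s - s * t = s * (1 - t)" by (simp add: algebra_simps)
      then have "(s * t) powr (a - 1) * (s - s * t) powr (b - 1)
         = (s powr (a - 1) * s powr (b - 1)) * (t powr (a - 1) * (1 - t) powr (b - 1))"
        using True s by (simp add: powr_mult)
      also have "s powr (a - 1) * s powr (b - 1) = s powr (a + b - 2)"
        by (simp add: powr_add[symmetric])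
      finally show ?thesis using True s by (simp add: ennreal_mult)
    next
      case False
      then have "s * t \<notin> {0<..<s}" "t \<notin> {0<..<1}" using s by (auto simp: zero_less_mult_iff)
      then show ?thesis by simp
    qed
  qed
  also have "\<dots> = ennreal (s powr (a + b - 2)) * ennreal (Beta a b)"
    by (subst nn_integral_cmult) (auto simp only: nn_integral_beta[OF assms(2,3)], measurable)
  also have "\<dots> * ennreal \<bar>s\<bar> = ennreal (s powr (a + b - 1) * Beta a b)"
  proof -
    have "s powr (a + b - 1) = s powr (a + b - 2) * s"
      using s powr_add[of s "a + b - 2" 1] by simp
    then show ?thesis using s
      by (simp add: ennreal_mult' ennreal_mult'' mult_ac)
  qed
  finally show ?thesis .
qed

lemma dirichlet_density_measurable [measurable]:
  assumes "finite I"
  shows "dirichlet_density I s \<in> borel_measurable (lborels I)"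
proof -
  have [measurable]: "(\<lambda>x :: nat \<Rightarrow> real. x j) \<in> borel_measurable (lborels I)" if "j \<in> I" for j
    using that by (rule measurable_lborels_component)
  have [measurable]: "(\<lambda>x :: nat \<Rightarrow> real. sum x I) \<in> borel_measurable (lborels I)"
    by (rule borel_measurable_sum) measurable
  have [measurable]: "(\<lambda>x :: nat \<Rightarrow> real. \<Prod>j\<in>I. x j) \<in> borel_measurable (lborels I)"
    by (rule borel_measurable_prod) measurable
  have [measurable]: "Measurable.pred (lborels I) (\<lambda>x :: nat \<Rightarrow> real. \<forall>j\<in>I. 0 < x j)"
    by (rule pred_intros_finite(3)[OF assms]) measurable
  show ?thesis unfolding dirichlet_density_def by measurable
qed

lemma dirichlet_density_insert:
  assumes "finite I" "i \<notin> I"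
  shows "dirichlet_density (insert i I) s (x(i := y))
     = ennreal (y powr (- 1 / 2)) * indicator {0<..<s} y * dirichlet_density I (s - y) x"
proof -
  have S: "sum (x(i := y)) (insert i I) = y + sum x I" and P: "(\<Prod>j\<in>insert i I. (x(i := y)) j) = y * (\<Prod>j\<in>I. x j)"
    using assms by (auto intro!: sum.cong prod.cong)
  have A: "(\<forall>j\<in>insert i I. 0 < (x(i := y)) j) \<longleftrightarrow> 0 < y \<and> (\<forall>j\<in>I. 0 < x j)" using assms by auto
  have D: "dirichlet_density (insert i I) s (x(i := y)) = (if (0 < y \<and> (\<forall>j\<in>I. 0 < x j)) \<and> y + sum x I < s
     then ennreal (((y * (\<Prod>j\<in>I. x j)) * (s - (y + sum x I))) powr (- 1 / 2)) else 0)"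
    unfolding dirichlet_density_def S P A ..
  show ?thesis
  proof (cases "(0 < y \<and> (\<forall>j\<in>I. 0 < x j)) \<and> y + sum x I < s")
    case True
    then have "0 \<le> sum x I" by (intro sum_nonneg) (auto intro: less_imp_le)
    then have y: "y < s" using True by linarith
    have "0 < (\<Prod>j\<in>I. x j)" using True by (intro prod_pos) auto
    then have "((y * (\<Prod>j\<in>I. x j)) * (s - (y + sum x I))) powr (- 1 / 2)
       = y powr (- 1 / 2) * ((\<Prod>j\<in>I. x j) * (s - y - sum x I)) powr (- 1 / 2)"
      using True by (subst powr_mult[symmetric]) (auto simp: algebra_simps)
    then show ?thesis unfolding D using True y
      by (simp add: dirichlet_density_def ennreal_mult algebra_simps)
  next
    case False
    then show ?thesis unfolding D by (auto simp: dirichlet_density_def indicator_def)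
  qed
qed

text \<open>Splitting off a mass y leaves the total s - y, and the remaining powers of y and s - y
  form a Beta integral over (0, s).\<close>

lemma nn_integral_dirichlet:
  assumes "finite I" "0 < s"
  shows "(\<integral>\<^sup>+x. dirichlet_density I s x \<partial>lborels I)
     = ennreal (s powr ((real (card I) - 1) / 2) * dirichlet_const (card I))"
  using assms
proof (induction I arbitrary: s rule: finite_induct)
  case empty
  then show ?case
    by (simp add: lborels.nn_integral_empty dirichlet_density_def dirichlet_const_def
        Gamma_one_half_real powr_half_sqrt)
next
  case (insert i I)
  let ?m = "card I"
  have "(\<integral>\<^sup>+x. dirichlet_density (insert i I) s x \<partial>lborels (insert i I))
     = (\<integral>\<^sup>+y. \<integral>\<^sup>+x. ennreal (y powr (- 1 / 2)) * indicator {0<..<s} y * dirichlet_density I (s - y) x \<partial>lborels I \<partial>lborel)"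
    using insert.hyps
    by (subst lborels.product_nn_integral_insert_rev) (auto simp: dirichlet_density_insert intro!: dirichlet_density_measurable)
  also have "\<dots> = (\<integral>\<^sup>+y. ennreal (dirichlet_const ?m) *
       (ennreal (y powr (1 / 2 - 1) * (s - y) powr ((real ?m + 1) / 2 - 1)) * indicator {0<..<s} y) \<partial>lborel)"
  proof (rule nn_integral_cong)
    fix y :: real
    have "(\<integral>\<^sup>+x. ennreal (y powr (- 1 / 2)) * indicator {0<..<s} y * dirichlet_density I (s - y) x \<partial>lborels I)
      = ennreal (y powr (- 1 / 2)) * indicator {0<..<s} y * (\<integral>\<^sup>+x. dirichlet_density I (s - y) x \<partial>lborels I)"
      by (rule nn_integral_cmult) (rule dirichlet_density_measurable[OF insert.hyps(1)])
    also have "\<dots> = ennreal (dirichlet_const ?m) *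
       (ennreal (y powr (1 / 2 - 1) * (s - y) powr ((real ?m + 1) / 2 - 1)) * indicator {0<..<s} y)"
    proof (cases "y \<in> {0<..<s}")
      case True
      have e: "(real ?m + 1) / 2 - 1 = (real ?m - 1) / 2" "1 / 2 - 1 = (- 1 / 2 :: real)"
        by (simp_all add: field_simps)
      show ?thesis using True insert.IH[of "s - y"] dirichlet_const_nonneg[of ?m] unfolding e
        by (simp add: ennreal_mult' ennreal_mult'' mult_ac)
    qed simp
    finally show "(\<integral>\<^sup>+x. ennreal (y powr (- 1 / 2)) * indicator {0<..<s} y * dirichlet_density I (s - y) x \<partial>lborels I) =
      ennreal (dirichlet_const ?m) *
       (ennreal (y powr (1 / 2 - 1) * (s - y) powr ((real ?m + 1) / 2 - 1)) * indicator {0<..<s} y)" .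
  qed
  also have "\<dots> = ennreal (dirichlet_const ?m) * ennreal (s powr (1 / 2 + (real ?m + 1) / 2 - 1) * Beta (1 / 2) ((real ?m + 1) / 2))"
    by (subst nn_integral_cmult) (measurable, subst nn_integral_beta_scaled[OF insert.prems], auto)
  also have "\<dots> = ennreal (s powr (1 / 2 + (real ?m + 1) / 2 - 1) * (dirichlet_const ?m * Beta (1 / 2) ((real ?m + 1) / 2)))"
    using dirichlet_const_nonneg[of ?m] by (subst ennreal_mult'[symmetric]) (auto simp: mult_ac)
  also have "1 / 2 + (real ?m + 1) / 2 - 1 = (real (card (insert i I)) - 1) / 2"
    using insert.hyps by (simp add: field_simps)
  finally show ?case
    unfolding dirichlet_const_Suc using insert.hyps by simp
qed

section \<open>Paraorthogonal polynomials\<close>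

text \<open>Logarithmic derivative for factors b + c * x, so that both x - w and the factors 1 - cnj
  w * x of the reversed polynomial are covered.\<close>

lemma poly_pderiv_prod_linear:
  fixes b c :: "nat \<Rightarrow> complex"
  assumes "\<And>i. i < n \<Longrightarrow> b i + c i * z \<noteq> 0"
  shows "poly (pderiv (\<Prod>i<n. [:b i, c i:])) z = (\<Prod>i<n. b i + c i * z) * (\<Sum>i<n. c i / (b i + c i * z))"
  using assms
proof (induction n)
  case (Suc n)
  let ?P = "\<Prod>i<n. [:b i, c i:]" and ?S = "\<Sum>i<n. c i / (b i + c i * z)"
  have ne: "b n + c n * z \<noteq> 0" using Suc.prems by simp
  have P: "poly ?P z = (\<Prod>i<n. b i + c i * z)" by (simp add: poly_prod mult.commute)
  have IH: "poly (pderiv ?P) z = poly ?P z * ?S" unfolding P by (rule Suc.IH) (use Suc.prems in simp)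
  have "poly (pderiv (?P * [:b n, c n:])) z = poly ?P z * c n + (b n + c n * z) * poly (pderiv ?P) z"
    unfolding pderiv_mult poly_add poly_mult by (simp add: pderiv_pCons mult.commute)
  also have "\<dots> = poly ?P z * (b n + c n * z) * (?S + c n / (b n + c n * z))"
    unfolding IH using ne by (simp add: distrib_left mult_ac)
  finally show ?case unfolding P by simp
qed simp

text \<open>With u = w / z in the closed disk, the quotient is 1 / (1 - u), and this function maps
  the closed disk without 1 into the half plane Re >= 1/2.\<close>

lemma Re_half_plane:
  fixes z w :: complex
  assumes "z \<noteq> w" "norm w \<le> norm z"
  shows "1 / 2 \<le> Re (z / (z - w))"
proof -
  have p: "0 < (norm (z - w))\<^sup>2" using assms by simp
  have sq: "(norm w)\<^sup>2 \<le> (norm z)\<^sup>2" using assms by simp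
  have e: "Re (z / (z - w)) = Re (z * cnj (z - w)) / (norm (z - w))\<^sup>2"
    by (subst complex_div_cnj) (simp flip: of_real_power)
  have le: "(norm (z - w))\<^sup>2 \<le> 2 * Re (z * cnj (z - w))"
    using sq unfolding cmod_power2 by (simp add: power2_eq_square algebra_simps)
  show ?thesis unfolding e by (subst pos_le_divide_eq[OF p]) (use le in linarith)
qed

lemma monic_poly_eq_prod: "is_roots n \<phi> w \<Longrightarrow> monic_poly n \<phi> = (\<Prod>i<n. [:- w i, 1:])"
  by (subst poly_eq_poly_eq_iff[symmetric]) (auto simp: fun_eq_iff poly_monic_poly is_roots_def poly_prod)

text \<open>Every zero contributes at least 1/2. Applied to \<phi> this gives positive masses;
  applied to p it is the Gauss--Lucas step.\<close>

lemma Re_log_derivative: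
  assumes w: "is_roots n \<phi> w" and "\<And>i. i < n \<Longrightarrow> z \<noteq> w i" "\<And>i. i < n \<Longrightarrow> norm (w i) \<le> norm z"
  obtains s where "z * poly (pderiv (monic_poly n \<phi>)) z = monic_eval n \<phi> z * s" "real n / 2 \<le> Re s"
    "s = (\<Sum>i<n. z / (z - w i))"
proof
  let ?s = "\<Sum>i<n. z / (z - w i)"
  have "poly (pderiv (monic_poly n \<phi>)) z = (\<Prod>i<n. - w i + 1 * z) * (\<Sum>i<n. 1 / (- w i + 1 * z))"
    unfolding monic_poly_eq_prod[OF w] by (rule poly_pderiv_prod_linear) (use assms in auto)
  moreover have "monic_eval n \<phi> z = (\<Prod>i<n. z - w i)" using w by (simp add: is_roots_def)
  ultimately show "z * poly (pderiv (monic_poly n \<phi>)) z = monic_eval n \<phi> z * ?s"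
    by (simp add: sum_distrib_left mult_ac)
  have "(\<Sum>i<n. 1 / 2) \<le> (\<Sum>i<n. Re (z / (z - w i)))"
    by (intro sum_mono Re_half_plane) (use assms in auto)
  then show "real n / 2 \<le> Re ?s" by simp
qed simp

definition reversed_poly :: "nat \<Rightarrow> (nat \<Rightarrow> complex) \<Rightarrow> complex poly" where
  "reversed_poly n \<phi> = 1 + (\<Sum>k = 1..n. monom (cnj (\<phi> k)) k)"

lemma poly_reversed_poly: "poly (reversed_poly n \<phi>) = reversed_eval n \<phi>"
  by (simp add: fun_eq_iff reversed_poly_def reversed_eval_def poly_monom poly_sum)

text \<open>Off the circle, |x| |\<phi>(x)| = |\<phi>*(x)| contradicts the Blaschke
  comparison.\<close>

lemma Schur_paraorthogonal_root_norm:
  assumes S: "Schur n \<phi>" and 0: "x * monic_eval n \<phi> x + reversed_eval n \<phi> x = 0"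
  shows "norm x = 1"
proof (rule ccontr)
  have eq: "norm x * norm (monic_eval n \<phi> x) = norm (reversed_eval n \<phi> x)"
    using 0 by (metis add_eq_0_iff norm_minus_cancel norm_mult)
  assume "norm x \<noteq> 1"
  then consider "norm x < 1" | "norm x > 1" by linarith
  then show False
  proof cases
    case 1
    have "norm x * norm (monic_eval n \<phi> x) \<le> norm x * norm (reversed_eval n \<phi> x)"
      by (intro mult_left_mono Schur_norm_ge[OF S]) (use 1 in auto)
    also have "\<dots> < 1 * norm (reversed_eval n \<phi> x)"
      using 1 Schur_reversed_eval_nonzero[OF S, of x] by (intro mult_strict_right_mono) auto
    finally show False using eq by simp
  next
    case 2
    have "1 * norm (monic_eval n \<phi> x) < norm x * norm (monic_eval n \<phi> x)"
      using 2 Schur_nonzero[OF S, of x] by (intro mult_strict_right_mono) auto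
    also have "\<dots> \<le> norm (monic_eval n \<phi> x)" unfolding eq by (rule Schur_norm_le[OF S]) (use 2 in auto)
    finally show False by simp
  qed
qed

text \<open>The factor r is 1 plus the sum of the Poisson kernels Re ((z + w) / (z - w)) over the
  zeros w of \<phi>, hence positive. The zero z of p is therefore simple and its mass 1 / r is
  positive.\<close>

lemma Schur_paraorthogonal_derivative:
  assumes S: "Schur n \<phi>" and p: "\<And>x. poly p x = x * monic_eval n \<phi> x + reversed_eval n \<phi> x" and 0: "poly p z = 0"
  obtains r where "r > 0" "poly (pderiv p) z = of_real r * monic_eval n \<phi> z" "monic_eval n \<phi> z \<noteq> 0"
proof -
  have z1: "norm z = 1" using Schur_paraorthogonal_root_norm[OF S] 0 p by simp
  then have z0: "z \<noteq> 0" by auto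
  have zz: "z * cnj z = 1" using z1 by (simp add: complex_norm_square[symmetric])
  obtain w where w: "is_roots n \<phi> w" using exists_roots by blast
  have wz: "norm (w i) < 1" "z \<noteq> w i" "norm (w i) \<le> norm z" if "i < n" for i
    using Schur_roots[OF w S that] z1 by auto
  obtain s where s: "z * poly (pderiv (monic_poly n \<phi>)) z = monic_eval n \<phi> z * s" "real n / 2 \<le> Re s" "s = (\<Sum>i<n. z / (z - w i))"
    by (rule Re_log_derivative[OF w wz(2,3)])
  have ne: "1 + (- cnj (w i)) * z \<noteq> 0" if "i < n" for i
  proof
    assume "1 + (- cnj (w i)) * z = 0"
    then have "norm (cnj (w i) * z) = 1" by (metis add_eq_0_iff minus_mult_left norm_one norm_minus_cancel)
    then show False using wz(1)[OF that] z1 by (simp add: norm_mult)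
  qed
  have "reversed_poly n \<phi> = (\<Prod>i<n. [:1, - cnj (w i):])"
    by (subst poly_eq_poly_eq_iff[symmetric])
      (auto simp: fun_eq_iff poly_reversed_poly reversed_eval_factor[OF w] poly_prod mult.commute)
  then have "poly (pderiv (reversed_poly n \<phi>)) z = (\<Prod>i<n. 1 + (- cnj (w i)) * z) * (\<Sum>i<n. (- cnj (w i)) / (1 + (- cnj (w i)) * z))"
    by (simp only:) (rule poly_pderiv_prod_linear[OF ne])
  also have "(\<Prod>i<n. 1 + (- cnj (w i)) * z) = reversed_eval n \<phi> z"
    unfolding reversed_eval_factor[OF w] by (intro prod.cong) auto
  finally have "z * poly (pderiv (reversed_poly n \<phi>)) z = reversed_eval n \<phi> z * (\<Sum>i<n. z * ((- cnj (w i)) / (1 + (- cnj (w i)) * z)))"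
    by (simp add: sum_distrib_left mult_ac)
  \<comment> \<open>On the unit circle the conjugate of z / (z - w) is 1 / (1 - cnj w * z), so z
    times the logarithmic derivative of \<phi>* is n minus the conjugate of the same quantity for
    \<phi>.\<close>
  also have "(\<Sum>i<n. z * ((- cnj (w i)) / (1 + (- cnj (w i)) * z))) = (\<Sum>i<n. 1 - cnj (z / (z - w i)))"
  proof (intro sum.cong refl)
    fix i assume "i \<in> {..<n}"
    then have i: "i < n" by simp
    have c: "cnj (z - w i) \<noteq> 0" using wz(2)[OF i] by simp
    have m: "z * cnj (z - w i) = 1 + (- cnj (w i)) * z" using zz by (simp add: algebra_simps)
    have "cnj (z / (z - w i)) = (z * cnj z) / (z * cnj (z - w i))" using z0 c by simp
    also have "\<dots> = 1 / (1 + (- cnj (w i)) * z)" unfolding m zz ..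
    finally have e: "cnj (z / (z - w i)) = 1 / (1 + (- cnj (w i)) * z)" .
    show "z * ((- cnj (w i)) / (1 + (- cnj (w i)) * z)) = 1 - cnj (z / (z - w i))"
      unfolding e using ne[OF i] by (simp add: divide_simps algebra_simps)
  qed
  also have "\<dots> = of_nat n - cnj s" unfolding s(3) by (simp add: sum_subtractf)
  finally have es: "z * poly (pderiv (reversed_poly n \<phi>)) z = reversed_eval n \<phi> z * (of_nat n - cnj s)" .
  \<comment> \<open>At a zero of p both parts of p' become multiples of \<phi>(z), and the cofactors
    s and cnj s add up to a real number.\<close>
  have "reversed_eval n \<phi> z = - (z * monic_eval n \<phi> z)" using 0 p by (simp add: add_eq_0_iff)
  note es = es[unfolded this]
  have "p = pCons 0 (monic_poly n \<phi>) + reversed_poly n \<phi>"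
    by (subst poly_eq_poly_eq_iff[symmetric]) (auto simp: fun_eq_iff p poly_monic_poly poly_reversed_poly)
  then have "z * poly (pderiv p) z = z * monic_eval n \<phi> z + z * (z * poly (pderiv (monic_poly n \<phi>)) z) + z * poly (pderiv (reversed_poly n \<phi>)) z"
    by (simp add: pderiv_pCons pderiv_add poly_monic_poly algebra_simps)
  also have "\<dots> = z * monic_eval n \<phi> z * (1 - of_nat n + (s + cnj s))"
    unfolding s(1) es by (simp add: algebra_simps)
  also have "1 - of_nat n + (s + cnj s) = of_real (1 - real n + 2 * Re s)"
    by (simp add: complex_add_cnj)
  finally have "poly (pderiv p) z = of_real (1 - real n + 2 * Re s) * monic_eval n \<phi> z"
    using z0 by simp
  moreover have "1 - real n + 2 * Re s > 0" using s(2) by simp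
  moreover have "monic_eval n \<phi> z \<noteq> 0" using Schur_nonzero[OF S, of z] z1 by simp
  ultimately show thesis using that by blast
qed

text \<open>Each unordered pair occurs twice; this links a product of derivatives at the nodes with
  the squared Vandermonde product.\<close>

lemma prod_off_diagonal_symmetric:
  fixes f :: "nat \<Rightarrow> nat \<Rightarrow> 'a::comm_monoid_mult"
  assumes "\<And>i j. f i j = f j i"
  shows "(\<Prod>j\<in>{1..n}. \<Prod>i\<in>{1..n} - {j}. f j i) = (\<Prod>k\<in>{1..n}. \<Prod>j\<in>{1..<k}. f j k)\<^sup>2"
proof (induction n)
  case (Suc n)
  have ins: "{1..Suc n} = insert (Suc n) {1..n}" by auto
  have e: "insert (Suc n) {1..n} - {Suc n} = {1..n}" "{1..<Suc n} = {1..n}" by auto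
  have "(\<Prod>i\<in>{1..Suc n} - {j}. f j i) = f j (Suc n) * (\<Prod>i\<in>{1..n} - {j}. f j i)" if "j \<in> {1..n}" for j
  proof -
    have "{1..Suc n} - {j} = insert (Suc n) ({1..n} - {j})" using that by auto
    then show ?thesis by simp
  qed
  then have "(\<Prod>j\<in>{1..n}. \<Prod>i\<in>{1..Suc n} - {j}. f j i) = (\<Prod>j\<in>{1..n}. f j (Suc n)) * (\<Prod>j\<in>{1..n}. \<Prod>i\<in>{1..n} - {j}. f j i)"
    by (simp add: prod.distrib)
  then have "(\<Prod>j\<in>{1..Suc n}. \<Prod>i\<in>{1..Suc n} - {j}. f j i)
     = (\<Prod>i\<in>{1..n}. f (Suc n) i) * ((\<Prod>j\<in>{1..n}. f j (Suc n)) * (\<Prod>k\<in>{1..n}. \<Prod>j\<in>{1..<k}. f j k)\<^sup>2)"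
    unfolding ins Suc by (subst prod.insert) (auto simp: e)
  also have "(\<Prod>i\<in>{1..n}. f (Suc n) i) = (\<Prod>j\<in>{1..<Suc n}. f j (Suc n))"
    unfolding e using assms by simp
  also have "(\<Prod>j\<in>{1..n}. f j (Suc n)) = (\<Prod>j\<in>{1..<Suc n}. f j (Suc n))" unfolding e ..
  finally show ?case
    unfolding ins by (subst prod.insert) (auto simp: power2_eq_square mult_ac)
qed simp

section \<open>Masses on the fibre\<close>

text \<open>The product condition says that p has constant coefficient 1; with all zeros on the
  circle it makes p conjugate reciprocal.\<close>

locale simple_circle_roots =
  fixes n :: nat and z :: "nat \<Rightarrow> complex"
  assumes norm_z: "\<And>j. j \<in> {1..Suc n} \<Longrightarrow> norm (z j) = 1"
    and inj_z: "inj_on z {1..Suc n}"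
    and prod_z: "(\<Prod>j\<in>{1..Suc n}. z j) = (- 1) ^ Suc n"
begin

definition "pz x = (\<Prod>j\<in>{1..Suc n}. x - z j)"

text \<open>The derivative p'(z j), as \<open>pderiv_at_root\<close> confirms; dividing by it turns
  values of \<phi> into masses.\<close>

definition "dz j = (\<Prod>i\<in>{1..Suc n} - {j}. z j - z i)"

lemma pz_eq_0_iff: "pz x = 0 \<longleftrightarrow> (\<exists>j\<in>{1..Suc n}. x = z j)"
  unfolding pz_def by (subst prod_zero_iff) (simp_all only: finite_atLeastAtMost right_minus_eq)

lemma poly_linear: "poly [:- c, 1:] x = x - c" for c x :: complex
  by simp

lemma dz_nonzero: "j \<in> {1..Suc n} \<Longrightarrow> dz j \<noteq> 0"
  unfolding dz_def using inj_z by (auto simp: inj_on_def)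

text \<open>On the circle z_j * z_i * cnj (z_j - z_i) = -(z_j - z_i). Multiplying over all i other
  than j leaves the known product of all zeros.\<close>

lemma cnj_dz:
  assumes j: "j \<in> {1..Suc n}"
  shows "z j ^ n * cnj (dz j) = - (z j * dz j)"
proof -
  let ?J = "{1..Suc n} - {j}"
  have zz: "z i * cnj (z i) = 1" if "i \<in> {1..Suc n}" for i
    using norm_z[OF that] by (simp add: complex_norm_square[symmetric])
  have z0: "z i \<noteq> 0" if "i \<in> {1..Suc n}" for i using norm_z[OF that] by auto
  have card: "card ?J = n" using j by simp
  have P: "z j * (\<Prod>i\<in>?J. z i) = (- 1) ^ Suc n"
    using prod.remove[of "{1..Suc n}" j z] j prod_z by simp
  have "(\<Prod>i\<in>?J. z j * z i * cnj (z j - z i)) = (\<Prod>i\<in>?J. - (z j - z i))"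
  proof (rule prod.cong)
    fix i assume "i \<in> ?J"
    then have "i \<in> {1..Suc n}" by simp
    have "z j * z i * cnj (z j - z i) = (z j * cnj (z j)) * z i - z j * (z i * cnj (z i))"
      by (simp add: algebra_simps)
    then show "z j * z i * cnj (z j - z i) = - (z j - z i)"
      unfolding zz[OF j] zz[OF \<open>i \<in> {1..Suc n}\<close>] by simp
  qed simp
  then have "z j ^ n * (\<Prod>i\<in>?J. z i) * cnj (dz j) = (- 1) ^ n * dz j"
    unfolding dz_def
    by (simp only: prod.distrib prod_constant card cnj_prod prod_uminus)
  then have "z j * (z j ^ n * (\<Prod>i\<in>?J. z i) * cnj (dz j)) = z j * ((- 1) ^ n * dz j)" by simp
  then have "(z j * (\<Prod>i\<in>?J. z i)) * (z j ^ n * cnj (dz j)) = (- 1) ^ n * (z j * dz j)"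
    by (simp only: mult_ac)
  then have "- ((- 1) ^ n * (z j ^ n * cnj (dz j))) = (- 1) ^ n * (z j * dz j)"
    unfolding P by simp
  then have "(- 1) ^ n * (z j ^ n * cnj (dz j)) = (- 1) ^ n * (- (z j * dz j))"
    by (metis minus_minus mult_minus_right)
  then show ?thesis by (subst (asm) mult_left_cancel) simp_all
qed

text \<open>At z = z_j both u = \<phi>(z) and u = p'(z) satisfy z^n * cnj u = -z * u, so their
  quotient equals its own conjugate.\<close>

lemma mass_real:
  assumes fib: "\<And>x. pz x = x * monic_eval n \<phi> x + reversed_eval n \<phi> x" and j: "j \<in> {1..Suc n}"
  shows "monic_eval n \<phi> (z j) / dz j = of_real (Re (monic_eval n \<phi> (z j) / dz j))"
proof -
  have "pz (z j) = 0" using j pz_eq_0_iff by blast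
  then have "reversed_eval n \<phi> (z j) = - (z j * monic_eval n \<phi> (z j))" unfolding fib by (simp add: add_eq_0_iff)
  then have e: "z j ^ n * cnj (monic_eval n \<phi> (z j)) = - (z j * monic_eval n \<phi> (z j))"
    using reversed_eval_unit[OF norm_z[OF j]] by simp
  have z0: "z j \<noteq> 0" using norm_z[OF j] by auto
  have "cnj (monic_eval n \<phi> (z j) / dz j) = (z j ^ n * cnj (monic_eval n \<phi> (z j))) / (z j ^ n * cnj (dz j))"
    using z0 by simp
  also have "\<dots> = monic_eval n \<phi> (z j) / dz j"
    unfolding e cnj_dz[OF j] using z0 by simp
  finally show ?thesis by (metis complex_cnj_cancel_iff Reals_cnj_iff of_real_Re)
qed

lemma lagrange:
  shows "monic_poly n \<phi> = (\<Sum>j\<in>{1..Suc n}. smult (monic_eval n \<phi> (z j) / dz j) (\<Prod>i\<in>{1..Suc n} - {j}. [:- z i, 1:]))"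
    (is "_ = ?q")
proof (rule poly_eqI_degree[where A = "z ` {1..Suc n}"])
  have deg: "degree (\<Prod>i\<in>{1..Suc n} - {j}. [:- z i, 1:]) = n" if "j \<in> {1..Suc n}" for j
    using that by (subst degree_prod_sum_eq) auto
  show "card (z ` {1..Suc n}) > degree (monic_poly n \<phi>)"
    using card_image[OF inj_z] by (simp add: degree_monic_poly)
  have "degree ?q \<le> n"
    by (intro degree_sum_le order.trans[OF degree_smult_le]) (simp_all only: deg finite_atLeastAtMost)
  then show "card (z ` {1..Suc n}) > degree ?q"
    using card_image[OF inj_z] by simp
  fix x assume "x \<in> z ` {1..Suc n}"
  then obtain k where k: "k \<in> {1..Suc n}" "x = z k" by blast
  have 0: "(\<Prod>i\<in>{1..Suc n} - {j}. z k - z i) = 0" if "j \<noteq> k" for j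
    using that k by (intro prod_zero) auto
  have "poly ?q x = (\<Sum>j\<in>{1..Suc n}. monic_eval n \<phi> (z j) / dz j * (\<Prod>i\<in>{1..Suc n} - {j}. z k - z i))"
    by (simp add: poly_sum poly_prod k)
  also have "\<dots> = (\<Sum>j\<in>{1..Suc n}. if j = k then monic_eval n \<phi> (z k) else 0)"
  proof (intro sum.cong refl)
    fix j assume "j \<in> {1..Suc n}"
    show "monic_eval n \<phi> (z j) / dz j * (\<Prod>i\<in>{1..Suc n} - {j}. z k - z i) = (if j = k then monic_eval n \<phi> (z k) else 0)"
      using 0[of j] dz_nonzero[OF k(1)] by (auto simp: dz_def)
  qed
  also have "\<dots> = monic_eval n \<phi> x" using k by simp
  finally show "poly (monic_poly n \<phi>) x = poly ?q x" by (simp add: poly_monic_poly)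
qed

text \<open>Leading coefficients in Lagrange's interpolation formula, whose n + 1 products are monic
  of degree n.\<close>

lemma sum_mass: "(\<Sum>j\<in>{1..Suc n}. monic_eval n \<phi> (z j) / dz j) = 1"
proof -
  have c: "coeff (\<Prod>i\<in>{1..Suc n} - {j}. [:- z i, 1:]) n = 1" if "j \<in> {1..Suc n}" for j
  proof -
    have "degree (\<Prod>i\<in>{1..Suc n} - {j}. [:- z i, 1:]) = n"
      using that by (subst degree_prod_sum_eq) auto
    moreover have "lead_coeff (\<Prod>i\<in>{1..Suc n} - {j}. [:- z i, 1:]) = 1"
      by (subst lead_coeff_prod) simp
    ultimately show ?thesis by simp
  qed
  have "1 = coeff (monic_poly n \<phi>) n" by (simp add: coeff_monic_poly_ge)
  also have "\<dots> = (\<Sum>j\<in>{1..Suc n}. monic_eval n \<phi> (z j) / dz j)"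
    by (subst lagrange) (simp only: coeff_sum coeff_smult, intro sum.cong, simp_all only: c mult_1_right)
  finally show ?thesis ..
qed

lemma monic_eval_partial_fractions:
  assumes "pz x \<noteq> 0"
  shows "monic_eval n \<phi> x = pz x * (\<Sum>j\<in>{1..Suc n}. monic_eval n \<phi> (z j) / dz j * (1 / (x - z j)))"
proof -
  have "monic_eval n \<phi> x = poly (monic_poly n \<phi>) x" by (simp add: poly_monic_poly)
  also have "\<dots> = (\<Sum>j\<in>{1..Suc n}. monic_eval n \<phi> (z j) / dz j * (\<Prod>i\<in>{1..Suc n} - {j}. x - z i))"
    by (subst lagrange) (simp add: poly_sum poly_prod)
  also have "\<dots> = (\<Sum>j\<in>{1..Suc n}. pz x * (monic_eval n \<phi> (z j) / dz j * (1 / (x - z j))))"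
  proof (intro sum.cong refl)
    fix j assume j: "j \<in> {1..Suc n}"
    have ne: "x - z j \<noteq> 0" using assms j pz_eq_0_iff by auto
    have "pz x = (x - z j) * (\<Prod>i\<in>{1..Suc n} - {j}. x - z i)"
      unfolding pz_def using j by (subst prod.remove[of _ j]) auto
    then show "monic_eval n \<phi> (z j) / dz j * (\<Prod>i\<in>{1..Suc n} - {j}. x - z i)
       = pz x * (monic_eval n \<phi> (z j) / dz j * (1 / (x - z j)))"
      using ne by simp
  qed
  finally show ?thesis by (simp only: sum_distrib_left)
qed

text \<open>By partial fractions x * \<phi>(x) / p(x) is a convex combination of the numbers x / (x
  - z_j). For |x| >= 1 these lie in Re >= 1/2, so \<phi> cannot vanish; at a zero of p itself \<phi>
  is nonzero because the mass is.\<close>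

lemma Schur_if_masses_pos:
  assumes fib: "\<And>x. pz x = x * monic_eval n \<phi> x + reversed_eval n \<phi> x"
    and pos: "\<And>j. j \<in> {1..Suc n} \<Longrightarrow> 0 < Re (monic_eval n \<phi> (z j) / dz j)"
  shows "Schur n \<phi>"
  unfolding Schur_def
proof (intro allI impI, rule ccontr)
  fix x assume 0: "monic_eval n \<phi> x = 0" and "\<not> norm x < 1"
  then have x: "1 \<le> norm x" by simp
  show False
  proof (cases "pz x = 0")
    case True
    then obtain j where j: "j \<in> {1..Suc n}" "x = z j" using pz_eq_0_iff by blast
    then show False using pos[OF j(1)] 0 by simp
  next
    case False
    let ?m = "\<lambda>j. Re (monic_eval n \<phi> (z j) / dz j)"
    have R: "Re (of_real r * y) = r * Re y" for r y by simp
    have "0 = x * (\<Sum>j\<in>{1..Suc n}. monic_eval n \<phi> (z j) / dz j * (1 / (x - z j)))"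
      using monic_eval_partial_fractions[OF False, of \<phi>] 0 False by simp
    also have "\<dots> = (\<Sum>j\<in>{1..Suc n}. of_real (?m j) * (x / (x - z j)))"
      unfolding sum_distrib_left by (intro sum.cong refl) (subst mass_real[OF fib], auto)
    finally have "0 = (\<Sum>j\<in>{1..Suc n}. ?m j * Re (x / (x - z j)))"
      using R by (metis (no_types, lifting) Re_sum zero_complex.sel(1) sum.cong)
    moreover have "(\<Sum>j\<in>{1..Suc n}. ?m j * (1 / 2)) \<le> (\<Sum>j\<in>{1..Suc n}. ?m j * Re (x / (x - z j)))"
    proof (intro sum_mono mult_left_mono)
      fix j assume j: "j \<in> {1..Suc n}"
      show "1 / 2 \<le> Re (x / (x - z j))"
        by (rule Re_half_plane) (use False pz_eq_0_iff j x norm_z[OF j] in auto)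
      show "0 \<le> ?m j" using pos[OF j] by simp
    qed
    moreover have "(\<Sum>j\<in>{1..Suc n}. ?m j * (1 / 2)) = 1 / 2"
      unfolding sum_distrib_right[symmetric] Re_sum[symmetric] sum_mass by simp
    ultimately show False by simp
  qed
qed

lemma pderiv_at_root:
  assumes j: "j \<in> {1..Suc n}" and p: "\<And>x. poly p x = pz x"
  shows "poly (pderiv p) (z j) = dz j"
proof -
  have "p = [:- z j, 1:] * (\<Prod>i\<in>{1..Suc n} - {j}. [:- z i, 1:])"
  proof (subst poly_eq_poly_eq_iff[symmetric], rule ext)
    fix x
    show "poly p x = poly ([:- z j, 1:] * (\<Prod>i\<in>{1..Suc n} - {j}. [:- z i, 1:])) x"
      unfolding p pz_def poly_mult poly_prod poly_linear using j by (rule prod.remove[rotated]) simp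
  qed
  then show ?thesis
    by (simp only: pderiv_mult poly_add poly_mult) (simp add: pderiv_pCons poly_prod dz_def)
qed

lemma masses_pos_if_Schur:
  assumes fib: "\<And>x. pz x = x * monic_eval n \<phi> x + reversed_eval n \<phi> x" and S: "Schur n \<phi>"
    and j: "j \<in> {1..Suc n}"
  shows "0 < Re (monic_eval n \<phi> (z j) / dz j)"
proof -
  define p where "p = (\<Prod>i\<in>{1..Suc n}. [:- z i, 1:])"
  have p: "poly p x = pz x" for x by (simp only: p_def pz_def poly_prod poly_linear)
  have p0: "poly p (z j) = 0" using j pz_eq_0_iff by (auto simp: p)
  have pf: "poly p x = x * monic_eval n \<phi> x + reversed_eval n \<phi> x" for x by (simp only: p fib)
  obtain r where r: "r > 0" "poly (pderiv p) (z j) = of_real r * monic_eval n \<phi> (z j)" "monic_eval n \<phi> (z j) \<noteq> 0"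
    by (rule Schur_paraorthogonal_derivative[OF S pf p0])
  then have "monic_eval n \<phi> (z j) / dz j = of_real (1 / r)"
    unfolding pderiv_at_root[OF j p] using r by simp
  then show ?thesis using r(1) by simp
qed

text \<open>At a zero w of \<phi> the fibre relation reduces to \<phi>*(w) = p(w); exchanging the
  two products evaluates \<phi> at the zeros of p.\<close>

lemma resultant_masses:
  assumes fib: "\<And>x. pz x = x * monic_eval n \<phi> x + reversed_eval n \<phi> x" and w: "is_roots n \<phi> w"
  shows "(\<Prod>i<n. norm (reversed_eval n \<phi> (w i))) = (\<Prod>j\<in>{1..Suc n}. norm (monic_eval n \<phi> (z j)))"
proof -
  have "(\<Prod>i<n. norm (reversed_eval n \<phi> (w i))) = (\<Prod>i<n. \<Prod>j\<in>{1..Suc n}. norm (w i - z j))"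
  proof (intro prod.cong refl)
    fix i assume "i \<in> {..<n}"
    then have "reversed_eval n \<phi> (w i) = pz (w i)" unfolding fib using is_roots_zero[OF w] by simp
    then show "norm (reversed_eval n \<phi> (w i)) = (\<Prod>j\<in>{1..Suc n}. norm (w i - z j))"
      by (simp only: pz_def prod_norm)
  qed
  also have "\<dots> = (\<Prod>j\<in>{1..Suc n}. \<Prod>i<n. norm (z j - w i))"
    by (subst prod.swap) (simp only: norm_minus_commute)
  also have "\<dots> = (\<Prod>j\<in>{1..Suc n}. norm (monic_eval n \<phi> (z j)))"
    using w by (simp only: prod_norm is_roots_def)
  finally show ?thesis .
qed

text \<open>The resultant is the product of all |dz j| and all masses, and the last mass is 1 minus
  the sum of the others, which is the shape of \<open>dirichlet_density\<close>.\<close>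

lemma schur_weight_masses:
  assumes fib: "\<And>x. pz x = x * monic_eval n \<phi> x + reversed_eval n \<phi> x"
  shows "schur_weight n \<phi> = ennreal ((\<Prod>j\<in>{1..Suc n}. norm (dz j)) powr (- 1 / 2)) *
    dirichlet_density {1..n} 1 (\<lambda>j\<in>{1..n}. Re (monic_eval n \<phi> (z j) / dz j))"
proof -
  obtain w where w: "is_roots n \<phi> w" using exists_roots by blast
  let ?m = "\<lambda>j. Re (monic_eval n \<phi> (z j) / dz j)"
  have ins: "{1..Suc n} = insert (Suc n) {1..n}" by auto
  have "(\<Sum>j\<in>{1..Suc n}. ?m j) = 1"
    unfolding Re_sum[symmetric] sum_mass by simp
  then have last: "?m (Suc n) = 1 - sum ?m {1..n}" unfolding ins by simp
  have S: "Schur n \<phi> \<longleftrightarrow> (\<forall>j\<in>{1..n}. 0 < ?m j) \<and> sum ?m {1..n} < 1"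
  proof -
    have "Schur n \<phi> \<longleftrightarrow> (\<forall>j\<in>{1..Suc n}. 0 < ?m j)"
      using Schur_if_masses_pos[OF fib] masses_pos_if_Schur[OF fib] by blast
    then show ?thesis unfolding ins by (simp only: ball_simps last) auto
  qed
  have d: "dirichlet_density {1..n} 1 (\<lambda>j\<in>{1..n}. ?m j) = (if Schur n \<phi>
     then ennreal ((\<Prod>j\<in>{1..Suc n}. ?m j) powr (- 1 / 2)) else 0)"
  proof -
    have "(\<Sum>j\<in>{1..n}. (\<lambda>j\<in>{1..n}. ?m j) j) = sum ?m {1..n}"
      "(\<Prod>j\<in>{1..n}. (\<lambda>j\<in>{1..n}. ?m j) j) = prod ?m {1..n}"
      "(\<forall>j\<in>{1..n}. 0 < (\<lambda>j\<in>{1..n}. ?m j) j) \<longleftrightarrow> (\<forall>j\<in>{1..n}. 0 < ?m j)"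
      by (auto intro!: sum.cong prod.cong)
    moreover have "(\<Prod>j\<in>{1..Suc n}. ?m j) = prod ?m {1..n} * (1 - sum ?m {1..n})"
      unfolding ins by (subst prod.insert) (simp_all only: last finite_atLeastAtMost mult.commute, simp)
    ultimately show ?thesis unfolding dirichlet_density_def S by (simp only:)
  qed
  show ?thesis
  proof (cases "Schur n \<phi>")
    case True
    have "(\<Prod>i<n. norm (reversed_eval n \<phi> (w i))) = (\<Prod>j\<in>{1..Suc n}. norm (dz j)) * (\<Prod>j\<in>{1..Suc n}. ?m j)"
      unfolding resultant_masses[OF fib w] prod.distrib[symmetric]
    proof (intro prod.cong refl)
      fix j assume j: "j \<in> {1..Suc n}"
      have "norm (monic_eval n \<phi> (z j)) = norm (dz j * (monic_eval n \<phi> (z j) / dz j))"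
        using dz_nonzero[OF j] by simp
      also have "\<dots> = norm (dz j) * norm (of_real (?m j) :: complex)"
        unfolding norm_mult by (subst mass_real[OF fib j]) simp
      also have "\<dots> = norm (dz j) * ?m j"
        using masses_pos_if_Schur[OF fib True j] by simp
      finally show "norm (monic_eval n \<phi> (z j)) = norm (dz j) * ?m j" .
    qed
    then have "(\<Prod>i<n. norm (reversed_eval n \<phi> (w i))) powr (- 1 / 2)
      = (\<Prod>j\<in>{1..Suc n}. norm (dz j)) powr (- 1 / 2) * (\<Prod>j\<in>{1..Suc n}. ?m j) powr (- 1 / 2)"
      by (simp only: powr_mult)
    then show ?thesis unfolding schur_weight_eq[OF w] d using True by (simp only: if_True ennreal_mult powr_ge_zero)
  qed (simp only: schur_weight_eq[OF w] d if_False mult_zero_right)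
qed

end

section \<open>The integral over a fibre\<close>

text \<open>Evaluation is complex affine; subtracting x^n isolates its linear part. It is used with
  c = 1 and c = \<i> to compare real and imaginary shifts.\<close>

lemma monic_eval_fibre_coords_affine:
  assumes "\<And>k. k \<in> {1..n} \<Longrightarrow> w k = u k + c * v k"
  shows "monic_eval n (fibre_coords n w) x = monic_eval n (fibre_coords n u) x + c * (monic_eval n (fibre_coords n v) x - x ^ n)"
proof -
  have "fibre_coords n w k = fibre_coords n u k + c * fibre_coords n v k" if k: "k \<in> {1..n}" for k
  proof -
    define s where "s = complex_of_real (sqrt 2 / 4)"
    have "Suc n - k \<in> {1..n}" using k by auto
    then show ?thesis using k assms[OF k] assms[of "Suc n - k"]
      unfolding fibre_coords_def s_def[symmetric] by (simp add: algebra_simps add_divide_distrib)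
  qed
  then have "(\<Sum>k = 1..n. fibre_coords n w k * x ^ (n - k))
      = (\<Sum>k = 1..n. fibre_coords n u k * x ^ (n - k)) + c * (\<Sum>k = 1..n. fibre_coords n v k * x ^ (n - k))"
    unfolding sum_distrib_left sum.distrib[symmetric] by (intro sum.cong) (auto simp: algebra_simps)
  then show ?thesis by (simp add: monic_eval_def)
qed

context simple_circle_roots
begin

text \<open>Scaling factor of the real map from the fibre coordinate \<open>b\<close> to the first n
  masses; the complexified map scales by its square.\<close>

definition "mass_scale = (1 / 2) ^ n * (\<Prod>j\<in>{1..Suc n}. norm (dz j)) powr (- 1 / 2)"

text \<open>Three factors: 4^(-n) from \<open>fibre_coords\<close>, V^2 from evaluation at the first
  n nodes, and the inverse square of the product of |dz j| over j <= n, which is V^2 * e with e =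
  |p'(z_(n+1))|. The total 4^(-n) / (V * e)^2 is \<open>mass_scale\<close> squared, since over all n
  + 1 nodes the product of |dz j| is (V * e)^2.\<close>

lemma scales_masses:
  "scales (lborels {1..n}) (\<lambda>w. \<lambda>j\<in>{1..n}. monic_eval n (fibre_coords n w) (z j) / dz j) (ennreal (mass_scale\<^sup>2))"
proof -
  have ins: "{1..Suc n} = insert (Suc n) {1..n}" by auto
  have sub: "{1..n} \<subseteq> {1..Suc n}" by auto
  define V where "V = (\<Prod>k\<in>{1..n}. \<Prod>j\<in>{1..<k}. norm (z j - z k))"
  define e where "e = norm (dz (Suc n))"
  have e0: "e > 0" using dz_nonzero[of "Suc n"] by (simp add: e_def)
  have V0: "V > 0"
    unfolding V_def
  proof (intro prod_pos ballI)
    fix k j assume "k \<in> {1..n}" "j \<in> {1..<k}"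
    then show "0 < norm (z j - z k)" using inj_onD[OF inj_z, of j k] by auto
  qed
  have e: "e = (\<Prod>j\<in>{1..n}. norm (z (Suc n) - z j))"
  proof -
    have "{1..Suc n} - {Suc n} = {1..n}" by auto
    then show ?thesis unfolding e_def dz_def by (simp only: prod_norm)
  qed
  have D: "(\<Prod>j\<in>{1..n}. norm (dz j)) = V\<^sup>2 * e"
  proof -
    have "norm (dz j) = (\<Prod>i\<in>{1..n} - {j}. norm (z j - z i)) * norm (z (Suc n) - z j)" if j: "j \<in> {1..n}" for j
    proof -
      have "{1..Suc n} - {j} = insert (Suc n) ({1..n} - {j})" using j by auto
      then show ?thesis unfolding dz_def
        by (simp add: norm_mult prod_norm[symmetric] norm_minus_commute mult.commute)
    qed
    then have "(\<Prod>j\<in>{1..n}. norm (dz j)) = (\<Prod>j\<in>{1..n}. \<Prod>i\<in>{1..n} - {j}. norm (z j - z i)) * e"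
      unfolding e prod.distrib[symmetric] by (intro prod.cong) auto
    also have "(\<Prod>j\<in>{1..n}. \<Prod>i\<in>{1..n} - {j}. norm (z j - z i)) = V\<^sup>2"
      unfolding V_def by (rule prod_off_diagonal_symmetric) (rule norm_minus_commute)
    finally show ?thesis .
  qed
  have P: "(\<Prod>j\<in>{1..Suc n}. norm (dz j)) = (V * e) ^ 2"
  proof -
    have "(\<Prod>j\<in>{1..Suc n}. norm (dz j)) = e * (\<Prod>j\<in>{1..n}. norm (dz j))"
      unfolding ins e_def by (rule prod.insert) auto
    then show ?thesis unfolding D by (simp add: power2_eq_square)
  qed
  have "((V * e) ^ 2) powr (- 1 / 2) = 1 / (V * e)"
  proof -
    have "((V * e) ^ 2) powr (- 1 / 2) = ((V * e) powr 2) powr (- 1 / 2)"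
      using V0 e0 by (subst powr_numeral) auto
    also have "\<dots> = (V * e) powr (- 1)" by (simp only: powr_powr) simp
    finally show ?thesis using V0 e0 by (simp add: powr_minus_divide)
  qed
  then have ms: "mass_scale = (1 / 2) ^ n / (V * e)" unfolding mass_scale_def P by simp
  have 1: "scales (lborels {1..n}) (\<lambda>x. \<lambda>j\<in>{1..n}. 1 / dz j * x j + 0) (\<Prod>j\<in>{1..n}. ennreal ((norm (1 / dz j))\<^sup>2))"
    by (intro scales_lborels_coordinatewise scales_complex_affine) (use dz_nonzero sub in auto)
  have 2: "inj_on z {1..n}" by (rule inj_on_subset[OF inj_z sub])
  show ?thesis
  proof (rule scales_cong[OF scales_compose[OF 1 scales_compose[OF scales_evaluation[OF 2] scales_fibre_coords]]])
    have "(\<Prod>j\<in>{1..n}. ennreal ((norm (1 / dz j))\<^sup>2)) = ennreal (\<Prod>j\<in>{1..n}. (1 / norm (dz j))\<^sup>2)"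
      by (subst prod_ennreal) (auto simp: norm_divide)
    also have "(\<Prod>j\<in>{1..n}. (1 / norm (dz j))\<^sup>2) = (1 / (V\<^sup>2 * e))\<^sup>2"
      unfolding D[symmetric] by (simp add: prod_power_distrib[symmetric] prod_dividef power_divide)
    finally have a: "(\<Prod>j\<in>{1..n}. ennreal ((norm (1 / dz j))\<^sup>2)) = ennreal ((1 / (V\<^sup>2 * e))\<^sup>2)" .
    have b: "(\<Prod>k\<in>{1..n}. \<Prod>j\<in>{1..<k}. (norm (z j - z k))\<^sup>2) = V\<^sup>2"
      unfolding V_def by (simp add: prod_power_distrib)
    have "(1 / (V\<^sup>2 * e))\<^sup>2 * (V\<^sup>2 * (1 / 4) ^ n) = mass_scale\<^sup>2"
    proof -
      have "(1 / 4 :: real) ^ n = ((1 / 2) ^ n)\<^sup>2" by (simp add: power_divide power_mult[symmetric] mult.commute[of n] power_mult)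
      then show ?thesis unfolding ms using V0 e0 by (simp add: field_simps power2_eq_square)
    qed
    then show "(\<Prod>j\<in>{1..n}. ennreal ((norm (1 / dz j))\<^sup>2)) *
      (ennreal (\<Prod>k\<in>{1..n}. \<Prod>j\<in>{1..<k}. (norm (z j - z k))\<^sup>2) * ennreal ((1 / 4) ^ n)) = ennreal (mass_scale\<^sup>2)"
      unfolding a b by (simp only: ennreal_mult[symmetric] zero_le_power2 zero_le_power zero_le_mult_iff) (simp add: ennreal_mult[symmetric])
  qed auto
qed

text \<open>In mass coordinates the weight is a Dirichlet density times the power -1/2 of the
  product of all |dz j|. The Jacobian \<open>mass_scale\<close> carries the same power, so p drops
  out and 2^n remains.\<close>

lemma nn_integral_fibre:
  assumes a: "a \<in> space (lborels {1..n})"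
    and fib: "\<And>b x. pz x = x * monic_eval n (fibre_coords n (cplx {1..n} a b)) x + reversed_eval n (fibre_coords n (cplx {1..n} a b)) x"
  shows "(\<integral>\<^sup>+b. schur_weight n (fibre_coords n (cplx {1..n} a b)) \<partial>lborels {1..n}) = ennreal (2 ^ n * dirichlet_const n)"
proof -
  let ?I = "{1..n}"
  let ?T = "\<lambda>w. \<lambda>j\<in>?I. monic_eval n (fibre_coords n w) (z j) / dz j"
  let ?A = "\<lambda>b. \<lambda>j\<in>?I. Re (monic_eval n (fibre_coords n (cplx ?I a b)) (z j) / dz j)"
  let ?P = "\<Prod>j\<in>{1..Suc n}. norm (dz j)"
  have P0: "?P > 0" using dz_nonzero by (intro prod_pos) auto
  have ms: "0 \<le> mass_scale" by (simp add: mass_scale_def)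
  have A: "?A \<in> lborels ?I \<rightarrow>\<^sub>M lborels ?I"
  proof -
    have "(\<lambda>b. cplx ?I a b) \<in> lborels ?I \<rightarrow>\<^sub>M lborels ?I"
      by (rule measurable_cplx) (use a in auto)
    from measurable_compose[OF this scales_measurable[OF scales_masses]]
    have m: "(\<lambda>b. ?T (cplx ?I a b)) \<in> lborels ?I \<rightarrow>\<^sub>M lborels ?I" .
    show ?thesis
    proof (rule measurable_restrict)
      fix j assume j: "j \<in> ?I"
      have Re: "Re \<in> borel_measurable borel"
        by (intro borel_measurable_continuous_onI continuous_intros)
      have "(\<lambda>b. Re (?T (cplx ?I a b) j)) \<in> borel_measurable (lborels ?I)"
        by (rule measurable_compose[OF measurable_compose[OF m measurable_lborels_component[OF j]] Re])
      then show "(\<lambda>b. Re (monic_eval n (fibre_coords n (cplx ?I a b)) (z j) / dz j)) \<in> lborels ?I \<rightarrow>\<^sub>M lborel"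
        using j by simp
    qed
  qed
  have "scales (lborels ?I) ?A (ennreal (sqrt (mass_scale\<^sup>2)))"
  proof (rule scales_real_part[OF _ scales_masses _ A])
    fix s t :: "nat \<Rightarrow> real"
    show "?T (cplx ?I (\<lambda>k\<in>?I. a k + s k) t) = cplx ?I (?A t) (\<lambda>k\<in>?I. ?A (\<lambda>k. 0) k - ?A s k)"
      unfolding cplx_def[of _ "?A t"]
    proof (rule restrict_ext)
      fix j assume j: "j \<in> ?I"
      then have j': "j \<in> {1..Suc n}" by simp
      define E where "E b = monic_eval n (fibre_coords n (cplx ?I a b)) (z j)" for b
      \<comment> \<open>\<open>v\<close> is the change of value when s is added to the real parts;
        adding s to the imaginary parts changes it by \<open>\<i> * v\<close>. The latter stays in
        the fibre, where masses are real, so a real shift changes only the imaginary parts of the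
        quotients. This is the form \<open>scales_real_part\<close> requires.\<close>
      define v where "v = monic_eval n (fibre_coords n (\<lambda>k. of_real (s k))) (z j) - z j ^ n"
      have m: "E b / dz j = of_real (Re (E b / dz j))" for b
        unfolding E_def by (rule mass_real[OF fib j'])
      have 1: "monic_eval n (fibre_coords n (cplx ?I (\<lambda>k\<in>?I. a k + s k) t)) (z j) = E t + 1 * v"
        unfolding E_def v_def by (rule monic_eval_fibre_coords_affine) (auto simp: cplx_def complex_eq_iff)
      have 2: "E s = E (\<lambda>k. 0) + \<i> * v"
        unfolding E_def v_def by (rule monic_eval_fibre_coords_affine) (auto simp: cplx_def complex_eq_iff)
      have v: "v = \<i> * (E (\<lambda>k. 0) - E s)" unfolding 2 by (simp add: algebra_simps)
      have "(E t + 1 * v) / dz j = E t / dz j + \<i> * (E (\<lambda>k. 0) / dz j - E s / dz j)"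
        unfolding v by (simp only: add_divide_distrib diff_divide_distrib mult_1 times_divide_eq_right[symmetric])
      also have "\<dots> = Complex (Re (E t / dz j)) (Re (E (\<lambda>k. 0) / dz j) - Re (E s / dz j))"
        by (subst (1 2 3) m) (simp add: complex_eq_iff)
      finally show "monic_eval n (fibre_coords n (cplx ?I (\<lambda>k\<in>?I. a k + s k) t)) (z j) / dz j
        = Complex (?A t j) ((\<lambda>k\<in>?I. ?A (\<lambda>k. 0) k - ?A s k) j)"
        unfolding 1 using j by (simp add: E_def)
    qed
  qed auto
  then have sA: "scales (lborels ?I) ?A (ennreal mass_scale)" using ms by simp
  let ?g = "dirichlet_density ?I 1"
  have g: "?g \<in> borel_measurable (lborels ?I)" by (rule dirichlet_density_measurable) simp
  let ?J = "\<integral>\<^sup>+b. ?g (?A b) \<partial>lborels ?I"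
  have K: "?J * ennreal mass_scale = ennreal (dirichlet_const n)"
    using scalesD[OF sA g] nn_integral_dirichlet[of ?I 1] by simp
  have "(\<integral>\<^sup>+b. schur_weight n (fibre_coords n (cplx ?I a b)) \<partial>lborels ?I) = (\<integral>\<^sup>+b. ennreal (?P powr (- 1 / 2)) * ?g (?A b) \<partial>lborels ?I)"
    by (simp only: schur_weight_masses[OF fib])
  also have "\<dots> = ennreal (?P powr (- 1 / 2)) * ?J"
    by (rule nn_integral_cmult) (rule measurable_compose[OF A g])
  also have "ennreal (?P powr (- 1 / 2)) = ennreal mass_scale * ennreal (2 ^ n)"
  proof -
    have "?P powr (- 1 / 2) = mass_scale * 2 ^ n" unfolding mass_scale_def by (simp add: power_divide)
    then show ?thesis using ms by (simp add: ennreal_mult)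
  qed
  also have "ennreal mass_scale * ennreal (2 ^ n) * ?J = ennreal (2 ^ n) * (?J * ennreal mass_scale)"
    by (simp only: mult_ac)
  also have "\<dots> = ennreal (2 ^ n * dirichlet_const n)"
    unfolding K using dirichlet_const_nonneg by (intro ennreal_mult[symmetric]) auto
  finally show ?thesis .
qed

end

section \<open>The volume\<close>

text \<open>Masses are residues of \<phi> / p at simple poles, so the fibre computation reaches only
  these points; \<open>emeasure_W\<close> shows that no measure is lost.\<close>

definition W_simple :: "nat \<Rightarrow> (nat \<Rightarrow> real) set" where
  "W_simple N = {a \<in> W N. \<forall>x. poly (assoc_poly N a) x = 0 \<longrightarrow> poly (pderiv (assoc_poly N a)) x \<noteq> 0}"

lemma W_iff:
  "a \<in> W (Suc n) \<longleftrightarrow> a \<in> space (lborels {1..n}) \<and> (\<forall>x. poly (assoc_poly (Suc n) a) x = 0 \<longrightarrow> norm x = 1)"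
  by (simp add: W_def space_PiM)

text \<open>Serves twice: points outside \<open>W_simple\<close> carry no weight in their fibre, and
  damped polynomials land in \<open>W_simple\<close>.\<close>

lemma W_simple_if_Schur:
  assumes a: "a \<in> space (lborels {1..n})" and S: "Schur n \<phi>"
    and p: "\<And>x. poly (assoc_poly (Suc n) a) x = x * monic_eval n \<phi> x + reversed_eval n \<phi> x"
  shows "a \<in> W_simple (Suc n)"
proof -
  have "norm x = 1" if "poly (assoc_poly (Suc n) a) x = 0" for x
    using Schur_paraorthogonal_root_norm[OF S] that p by simp
  moreover have "poly (pderiv (assoc_poly (Suc n) a)) x \<noteq> 0" if 0: "poly (assoc_poly (Suc n) a) x = 0" for x
  proof -
    obtain r where "r > 0" "poly (pderiv (assoc_poly (Suc n) a)) x = of_real r * monic_eval n \<phi> x" "monic_eval n \<phi> x \<noteq> 0"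
      by (rule Schur_paraorthogonal_derivative[OF S p 0])
    then show ?thesis by simp
  qed
  ultimately show ?thesis using a by (simp add: W_simple_def W_iff)
qed

lemma assoc_poly_eq_monic_poly: "assoc_poly (Suc n) a = monic_poly (Suc n) ((coeff_c (Suc n) a)(Suc n := 1))"
  by (subst poly_eq_poly_eq_iff[symmetric]) (auto simp: fun_eq_iff poly_monic_poly poly_assoc_poly)

lemma poly_assoc_poly_0: "poly (assoc_poly (Suc n) a) 0 = 1"
  unfolding poly_assoc_poly by (simp add: monic_eval_Suc)

lemma W_simple_roots:
  assumes "a \<in> W_simple (Suc n)"
  obtains z where "simple_circle_roots n z" "\<And>x. poly (assoc_poly (Suc n) a) x = (\<Prod>j\<in>{1..Suc n}. x - z j)"
proof -
  let ?p = "assoc_poly (Suc n) a" and ?R = "{x. poly (assoc_poly (Suc n) a) x = 0}"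
  have "rsquarefree ?p" using assms by (auto simp: W_simple_def rsquarefree_roots)
  from complex_poly_decompose_rsquarefree[OF this]
  have dec: "?p = (\<Prod>x\<in>?R. [:- x, 1:])"
    unfolding assoc_poly_eq_monic_poly lead_coeff_monic_poly by simp
  have p0: "?p \<noteq> 0" using poly_assoc_poly_0[of n a] by auto
  then have fin: "finite ?R" by (rule poly_roots_finite)
  have "card ?R = degree (\<Prod>x\<in>?R. [:- x, 1:])"
    by (subst degree_prod_sum_eq) auto
  also have "\<dots> = Suc n" unfolding dec[symmetric] by (simp only: assoc_poly_eq_monic_poly degree_monic_poly)
  finally have "card ?R = Suc n" .
  then obtain z where z: "bij_betw z {1..Suc n} ?R"
    using ex_bij_betw_nat_finite_1[OF fin] by auto
  have eq: "poly ?p x = (\<Prod>j\<in>{1..Suc n}. x - z j)" for x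
  proof -
    have "poly ?p x = (\<Prod>y\<in>?R. x - y)" by (subst dec) (simp add: poly_prod)
    also have "\<dots> = (\<Prod>j\<in>{1..Suc n}. x - z j)" by (rule prod.reindex_bij_betw[OF z, symmetric])
    finally show ?thesis .
  qed
  have "simple_circle_roots n z"
  proof
    show "norm (z j) = 1" if "j \<in> {1..Suc n}" for j
    proof -
      have "z j \<in> ?R" using z that by (rule bij_betwE[rule_format])
      then show ?thesis using assms by (simp add: W_simple_def W_iff)
    qed
    show "inj_on z {1..Suc n}" using z by (rule bij_betw_imp_inj_on)
    have "1 = (\<Prod>j\<in>{1..Suc n}. - 1 * z j)" using eq[of 0] poly_assoc_poly_0[of n a] by simp
    also have "\<dots> = (- 1) ^ Suc n * (\<Prod>j\<in>{1..Suc n}. z j)"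
      by (simp only: prod.distrib prod_constant card_atLeastAtMost) simp
    finally have "(- 1) ^ Suc n * 1 = (- 1) ^ Suc n * ((- 1) ^ Suc n * (\<Prod>j\<in>{1..Suc n}. z j))" by (simp only:)
    then show "(\<Prod>j\<in>{1..Suc n}. z j) = (- 1) ^ Suc n"
      by (simp only: mult.assoc[symmetric] power_mult_distrib[symmetric]) simp
  qed
  with eq show thesis using that by blast
qed

text \<open>Above a point of \<open>W_simple\<close> the zeros instantiate the locale; above any
  other point no \<phi> has all its zeros in the open disk, so the weight vanishes on the whole
  fibre.\<close>

lemma nn_integral_fibre_W:
  assumes a: "a \<in> space (lborels {1..n})"
  shows "(\<integral>\<^sup>+b. schur_weight n (fibre_coords n (cplx {1..n} a b)) \<partial>lborels {1..n})
    = ennreal (2 ^ n * dirichlet_const n) * indicator (W_simple (Suc n)) a"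
proof (cases "a \<in> W_simple (Suc n)")
  case True
  then obtain z where z: "simple_circle_roots n z" "\<And>x. poly (assoc_poly (Suc n) a) x = (\<Prod>j\<in>{1..Suc n}. x - z j)"
    by (rule W_simple_roots) blast
  interpret simple_circle_roots n z by fact
  show ?thesis using True
    by (subst nn_integral_fibre[OF a]) (simp_all only: pz_def z(2)[symmetric] poly_assoc_poly_monic_eval indicator_simps mult_1_right)
next
  case False
  have "schur_weight n (fibre_coords n (cplx {1..n} a b)) = 0" for b
  proof -
    obtain w where "is_roots n (fibre_coords n (cplx {1..n} a b)) w" using exists_roots by blast
    moreover have "\<not> Schur n (fibre_coords n (cplx {1..n} a b))"
      using W_simple_if_Schur[OF a _ poly_assoc_poly_monic_eval] False by blast
    ultimately show ?thesis by (simp only: schur_weight_eq if_False)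
  qed
  then show ?thesis using False by simp
qed

lemma dirichlet_const_pos: "0 < dirichlet_const n"
  unfolding dirichlet_const_def by (intro divide_pos_pos Gamma_real_pos) auto

lemma measurable_schur_weight_fibre_coords:
  "(\<lambda>w. schur_weight n (fibre_coords n w)) \<in> borel_measurable (lborels {1..n})"
  by (rule measurable_compose[OF scales_measurable[OF scales_fibre_coords] schur_weight_measurable])

lemma measurable_fibre_integral:
  "(\<lambda>a. \<integral>\<^sup>+b. schur_weight n (fibre_coords n (cplx {1..n} a b)) \<partial>lborels {1..n}) \<in> borel_measurable (lborels {1..n})"
proof -
  interpret SI: sigma_finite_measure "lborels {1..n} :: (nat \<Rightarrow> real) measure"
    by (rule lborels.sigma_finite) simp
  have "(\<lambda>x. cplx {1..n} (fst x) (snd x)) \<in> lborels {1..n} \<Otimes>\<^sub>M lborels {1..n} \<rightarrow>\<^sub>M lborels {1..n}"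
    by (rule measurable_cplx) auto
  from measurable_compose[OF this measurable_schur_weight_fibre_coords]
  have "(\<lambda>(a, b). schur_weight n (fibre_coords n (cplx {1..n} a b))) \<in> borel_measurable (lborels {1..n} \<Otimes>\<^sub>M lborels {1..n})"
    by (simp add: case_prod_beta)
  then show ?thesis by (rule SI.borel_measurable_nn_integral)
qed

text \<open>A condition on all zeros of a polynomial is not visibly measurable. The set is recovered
  as the support of the fibre integral, which is measurable by Tonelli; the positive constant
  separates the two cases.\<close>

lemma W_simple_measurable: "W_simple (Suc n) \<in> sets (lborels {1..n})"
proof -
  let ?F = "\<lambda>a. \<integral>\<^sup>+b. schur_weight n (fibre_coords n (cplx {1..n} a b)) \<partial>lborels {1..n}"
  have "ennreal (2 ^ n * dirichlet_const n) \<noteq> 0" using dirichlet_const_pos[of n] by simp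
  then have "W_simple (Suc n) = {a \<in> space (lborels {1..n}). ?F a \<noteq> 0}"
    using nn_integral_fibre_W by (auto simp: W_simple_def W_iff indicator_def)
  also have "\<dots> = ?F -` (- {0}) \<inter> space (lborels {1..n})" by auto
  also have "\<dots> \<in> sets (lborels {1..n})"
    by (rule measurable_sets[OF measurable_fibre_integral]) auto
  finally show ?thesis .
qed

text \<open>Legendre's duplication formula at (n + 1) / 2. Passing to n + 1 exchanges the two
  factors and raises the smaller argument by 1.\<close>

lemma Gamma_half_duplication:
  "Gamma ((real n + 1) / 2) * Gamma ((real n + 2) / 2) = sqrt pi * fact n / 2 ^ n"
proof (induction n)
  case 0
  show ?case by (simp add: Gamma_one_half_real)
next
  case (Suc n)
  have "(real n + 1) / 2 \<notin> \<int>\<^sub>\<le>\<^sub>0"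
  proof
    assume "(real n + 1) / 2 \<in> \<int>\<^sub>\<le>\<^sub>0"
    then have "(real n + 1) / 2 \<le> 0" by (auto elim!: nonpos_Ints_cases)
    then show False by simp
  qed
  from Gamma_plus1[OF this]
  have "Gamma ((real n + 1) / 2 + 1) = (real n + 1) / 2 * Gamma ((real n + 1) / 2)" .
  moreover have "(real n + 1) / 2 + 1 = (real (Suc n) + 2) / 2" "(real (Suc n) + 1) / 2 = (real n + 2) / 2"
    by (simp_all add: field_simps)
  ultimately have "Gamma ((real (Suc n) + 1) / 2) * Gamma ((real (Suc n) + 2) / 2)
     = (real n + 1) / 2 * (Gamma ((real n + 1) / 2) * Gamma ((real n + 2) / 2))"
    by (simp only: mult_ac)
  then show ?case unfolding Suc by simp
qed

lemma emeasure_W_simple: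
  "emeasure (lborels {1..n}) (W_simple (Suc n))
     = ennreal (2 ^ n * pi powr (real n / 2) / Gamma ((real n + 2) / 2))"
proof -
  let ?v = "emeasure (lborels {1..n}) (W_simple (Suc n))"
  \<comment> \<open>\<open>2 ^ n * dirichlet_const n\<close> is the integral over each fibre,
    \<open>(1 / 4) ^ n\<close> the factor of \<open>fibre_coords\<close>.\<close>
  define c where "c = 2 ^ n * dirichlet_const n * (1 / 4) ^ n"
  have c: "c > 0" using dirichlet_const_pos[of n] by (simp add: c_def)
  have "ennreal ((2 * pi) ^ n / fact n) = (\<integral>\<^sup>+w. schur_weight n (fibre_coords n w) \<partial>lborels {1..n}) * ennreal ((1 / 4) ^ n)"
    using scalesD[OF scales_fibre_coords schur_weight_measurable] nn_integral_schur_weight[of n] by simp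
  also have "(\<integral>\<^sup>+w. schur_weight n (fibre_coords n w) \<partial>lborels {1..n})
     = (\<integral>\<^sup>+a. \<integral>\<^sup>+b. schur_weight n (fibre_coords n (cplx {1..n} a b)) \<partial>lborels {1..n} \<partial>lborels {1..n})"
    by (rule nn_integral_lborels_cplx[OF _ measurable_schur_weight_fibre_coords]) simp
  also have "\<dots> = (\<integral>\<^sup>+a. ennreal (2 ^ n * dirichlet_const n) * indicator (W_simple (Suc n)) a \<partial>lborels {1..n})"
    by (rule nn_integral_cong) (rule nn_integral_fibre_W)
  also have "\<dots> = ennreal (2 ^ n * dirichlet_const n) * ?v"
    by (rule nn_integral_cmult_indicator[OF W_simple_measurable])
  also have "\<dots> * ennreal ((1 / 4) ^ n) = ennreal c * ?v"
    unfolding c_def using dirichlet_const_pos[of n]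
    by (subst (2) ennreal_mult) (auto simp: mult_ac)
  finally have eq: "ennreal c * ?v = ennreal ((2 * pi) ^ n / fact n)" ..
  have "?v = ennreal (1 / c) * (ennreal c * ?v)"
    using c by (simp add: mult.assoc[symmetric] ennreal_mult[symmetric])
  also have "\<dots> = ennreal ((2 * pi) ^ n / fact n / c)"
    unfolding eq using c by (subst ennreal_mult[symmetric]) auto
  also have "(2 * pi) ^ n / fact n / c = 2 ^ n * pi powr (real n / 2) / Gamma ((real n + 2) / 2)"
  proof -
    define g1 g2 where "g1 = Gamma ((real n + 1) / 2)" and "g2 = Gamma ((real n + 2) / 2)"
    have g: "g1 > 0" "g2 > 0" unfolding g1_def g2_def by (auto intro!: Gamma_real_pos)
    have dup: "g1 * g2 = sqrt pi * fact n / 2 ^ n"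
      unfolding g1_def g2_def by (rule Gamma_half_duplication)
    define q where "q = pi powr (real n / 2)"
    have q: "q > 0" by (simp add: q_def)
    have pin: "pi ^ n = q * q"
      unfolding q_def by (simp add: powr_add[symmetric] powr_realpow)
    have pk: "pi powr ((real n + 1) / 2) = q * sqrt pi"
      unfolding q_def by (simp add: add_divide_distrib powr_add powr_half_sqrt)
    have c': "c = q * sqrt pi / (g1 * 2 ^ n)"
    proof -
      have "(2::real) ^ n * (1 / 4) ^ n = 1 / 2 ^ n"
        by (simp only: power_mult_distrib[symmetric]) (simp add: power_one_over)
      then have "c = dirichlet_const n * (1 / 2 ^ n)" unfolding c_def by (simp only: mult_ac)
      then show ?thesis unfolding dirichlet_const_def pk g1_def by simp
    qed
    have f: "fact n = g1 * g2 * 2 ^ n / sqrt pi" unfolding dup by simp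
    show ?thesis
      unfolding c' f q_def[symmetric] g2_def[symmetric] power_mult_distrib pin
      using g q by (simp add: field_simps)
  qed
  finally show ?thesis .
qed

section \<open>From \<open>W_simple\<close> to \<open>W\<close> by damping the coefficients\<close>

definition damping :: "nat \<Rightarrow> real \<Rightarrow> nat \<Rightarrow> real" where
  "damping N r k = (real (N - k) * r ^ k + real k * r ^ (N - k)) / real N"

lemma damping_pos: "0 < r \<Longrightarrow> k \<in> {1..n} \<Longrightarrow> 0 < damping (Suc n) r k"
  unfolding damping_def by (intro divide_pos_pos add_pos_pos mult_pos_pos) auto

text \<open>\<open>damping N r k\<close> is the multiplier that the k-th coefficient of p acquires
  when \<phi> = p' / N is rescaled by r. Its symmetry under k -> N - k lets it act on the real
  coordinates, because \<open>coeff_c\<close> mixes \<open>a k\<close> with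
  \<open>a (N - k)\<close>.\<close>

lemma coeff_c_damping:
  assumes k: "k \<in> {1..n}"
  shows "coeff_c (Suc n) (\<lambda>k\<in>{1..n}. damping (Suc n) r k * a k) k = of_real (damping (Suc n) r k) * coeff_c (Suc n) a k"
proof -
  have S: "Suc n - k \<in> {1..n}" "damping (Suc n) r (Suc n - k) = damping (Suc n) r k"
    using k by (auto simp: damping_def add.commute)
  obtain d where d: "damping (Suc n) r k = d" by simp
  show ?thesis using k S unfolding coeff_c_def d
    by (simp add: d algebra_simps)
qed

lemma cnj_coeff_c: "k \<in> {1..n} \<Longrightarrow> cnj (coeff_c (Suc n) a (Suc n - k)) = coeff_c (Suc n) a k"
proof -
  assume k: "k \<in> {1..n}"
  have S: "Suc n - (Suc n - k) = k" using k by auto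
  consider "2 * k < Suc n" | "2 * k = Suc n" | "2 * k > Suc n" by linarith
  then show ?thesis
  proof cases
    case 1
    then have "\<not> 2 * (Suc n - k) < Suc n" "2 * (Suc n - k) \<noteq> Suc n" by auto
    then show ?thesis using 1 unfolding coeff_c_def S by simp
  next
    case 2
    then have "Suc n - k = k" by simp
    then show ?thesis using 2 by (simp add: coeff_c_def)
  next
    case 3
    then have "2 * (Suc n - k) < Suc n" "2 * (Suc n - k) \<noteq> Suc n" by auto
    then show ?thesis using 3 unfolding coeff_c_def S by simp
  qed
qed

text \<open>By Gauss--Lucas \<open>\<phi> = p' / N\<close> has no zeros outside the closed disk, and
  \<open>p x = x * \<phi> x + \<phi>\<^sup>* x\<close>; damping replaces \<open>\<phi> x\<close> by \<open>r^n * \<phi> (x / r)\<close>, moving its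
  zeros into the open disk.\<close>

lemma damping_W:
  assumes a: "a \<in> W (Suc n)" and r: "0 < r" "r < 1"
  shows "(\<lambda>k\<in>{1..n}. damping (Suc n) r k * a k) \<in> W_simple (Suc n)"
proof (rule W_simple_if_Schur)
  let ?N = "of_nat (Suc n) :: complex"
  let ?c = "coeff_c (Suc n) a" and ?c' = "(coeff_c (Suc n) a)(Suc n := 1)"
  \<comment> \<open>Differentiation contributes (N - k) / N to the k-th coefficient, the rescaling
    r^k.\<close>
  let ?\<phi> = "\<lambda>k. of_nat (Suc n - k) / ?N * of_real r ^ k * ?c k"
  let ?b = "\<lambda>k\<in>{1..n}. damping (Suc n) r k * a k"
  show "?b \<in> space (lborels {1..n})" by (simp add: space_PiM)
  obtain w where w: "is_roots (Suc n) ?c' w" using exists_roots by blast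
  have w1: "norm (w i) = 1" if "i < Suc n" for i
  proof -
    have "poly (assoc_poly (Suc n) a) (w i) = 0"
      unfolding poly_assoc_poly by (rule is_roots_zero[OF w that])
    then show ?thesis using a by (simp add: W_iff)
  qed
  have rc: "complex_of_real r \<noteq> 0" using r by simp
  have N0: "?N \<noteq> 0" by (simp del: of_nat_Suc)
  show "Schur n ?\<phi>"
    unfolding Schur_def
  proof (intro allI impI, rule ccontr)
    fix x assume 0: "monic_eval n ?\<phi> x = 0" and "\<not> norm x < 1"
    \<comment> \<open>Undoes the rescaling. As r < 1, y lies strictly outside the closed disk, where
      the logarithmic derivative of p has positive real part and so p' has no zero.\<close>
    define y where "y = x / of_real r"
    have "1 \<le> norm x" using \<open>\<not> norm x < 1\<close> by simp
    then have "1 < norm y" using r unfolding y_def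
      by (simp add: norm_divide less_divide_eq)
    have xy: "x = of_real r * y" using rc by (simp add: y_def)
    have pd: "poly (pderiv (monic_poly (Suc n) ?c')) y = ?N * y ^ n + (\<Sum>k = 1..n. of_nat (Suc n - k) * ?c k * y ^ (n - k))"
    proof -
      have "pderiv (monic_poly (Suc n) ?c') = monom ?N n + (\<Sum>k = 1..Suc n. monom (of_nat (Suc n - k) * ?c' k) (Suc n - k - 1))"
        unfolding monic_poly_def pderiv_add higher_pderiv_sum[where n = "Suc 0", simplified] pderiv_monom by simp
      also have "(\<Sum>k = 1..Suc n. monom (of_nat (Suc n - k) * ?c' k) (Suc n - k - 1))
          = (\<Sum>k = 1..n. monom (of_nat (Suc n - k) * ?c k) (n - k))"
        by (simp add: sum.nat_ivl_Suc')
      finally show ?thesis by (simp only: poly_add poly_sum poly_monom)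
    qed
    have "of_real r ^ n * poly (pderiv (monic_poly (Suc n) ?c')) y = ?N * monic_eval n ?\<phi> x"
    proof -
      have "of_real r ^ n * (\<Sum>k = 1..n. of_nat (Suc n - k) * ?c k * y ^ (n - k)) = ?N * (\<Sum>k = 1..n. ?\<phi> k * x ^ (n - k))"
        unfolding sum_distrib_left
      proof (intro sum.cong refl)
        fix k assume "k \<in> {1..n}"
        then have "complex_of_real r ^ n = of_real r ^ k * of_real r ^ (n - k)"
          by (simp add: power_add[symmetric])
        then show "of_real r ^ n * (of_nat (Suc n - k) * ?c k * y ^ (n - k)) = ?N * (?\<phi> k * x ^ (n - k))"
          unfolding xy power_mult_distrib using N0 by (simp del: of_nat_Suc)
      qed
      then show ?thesis unfolding pd monic_eval_def distrib_left xy power_mult_distrib by (simp only: mult_ac)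
    qed
    then have dp: "poly (pderiv (monic_poly (Suc n) ?c')) y = 0" using 0 rc by simp
    have yw: "y \<noteq> w i" "norm (w i) \<le> norm y" if "i < Suc n" for i
      using w1[OF that] \<open>1 < norm y\<close> by auto
    obtain s where s: "y * poly (pderiv (monic_poly (Suc n) ?c')) y = monic_eval (Suc n) ?c' y * s" "real (Suc n) / 2 \<le> Re s"
      by (rule Re_log_derivative[OF w yw])
    have "monic_eval (Suc n) ?c' y \<noteq> 0"
      using w yw(1) unfolding is_roots_def by (simp only: prod_zero_iff finite_lessThan) auto
    moreover have "s \<noteq> 0" using s(2) by auto
    ultimately show False using s(1) unfolding dp by simp
  qed
  fix x
  \<comment> \<open>Conjugate symmetry of the coefficients turns the reversed part into k / N * r^(N
    - k) times c_k; with the direct part it adds up to the damping factor.\<close>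
  have "((coeff_c (Suc n) ?b)(Suc n := 1)) k = ?\<phi> k + 1 * cnj (?\<phi> (Suc n - k))" if k: "k \<in> {1..n}" for k
  proof -
    have S: "Suc n - (Suc n - k) = k" and "k \<noteq> Suc n" using k by auto
    have cnj: "cnj (?\<phi> (Suc n - k)) = of_nat k / ?N * of_real r ^ (Suc n - k) * cnj (?c (Suc n - k))"
      unfolding S by (simp del: of_nat_Suc)
    have d: "of_real (damping (Suc n) r k)
       = (of_nat (Suc n - k) * of_real r ^ k + of_nat k * of_real r ^ (Suc n - k)) / ?N"
      by (simp add: damping_def del: of_nat_Suc)
    show ?thesis unfolding fun_upd_other[OF \<open>k \<noteq> Suc n\<close>] cnj cnj_coeff_c[OF k] coeff_c_damping[OF k] d
      by (simp add: add_divide_distrib distrib_right del: of_nat_Suc)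
  qed
  from monic_eval_step(1)[OF fun_upd_same this, of x]
  show "poly (assoc_poly (Suc n) ?b) x = x * monic_eval n ?\<phi> x + reversed_eval n ?\<phi> x"
    unfolding poly_assoc_poly mult_1 .
qed

text \<open>Any sequence in (0, 1) tending to 1 would serve; the shift by 2 keeps the term at m = 0
  positive.\<close>

definition damping_rate :: "nat \<Rightarrow> real" where
  "damping_rate m = 1 - 1 / (real m + 2)"

lemma damping_rate: "0 < damping_rate m" "damping_rate m < 1" "damping_rate \<longlonglongrightarrow> 1"
proof -
  show "0 < damping_rate m" "damping_rate m < 1" by (simp_all add: damping_rate_def)
  have "(\<lambda>m. 1 / (real m + 2)) \<longlonglongrightarrow> 0"
    using LIMSEQ_ignore_initial_segment[OF lim_1_over_n, of 2] by (simp add: add.commute)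
  from tendsto_diff[OF tendsto_const[of 1] this]
  show "damping_rate \<longlonglongrightarrow> 1" by (simp add: damping_rate_def[abs_def])
qed

lemma tendsto_damping:
  assumes k: "k \<in> {1..n}"
  shows "(\<lambda>m. damping (Suc n) (damping_rate m) k) \<longlonglongrightarrow> 1"
proof -
  have "(\<lambda>m. damping (Suc n) (damping_rate m) k) \<longlonglongrightarrow> (real (Suc n - k) * 1 ^ k + real k * 1 ^ (Suc n - k)) / real (Suc n)"
    unfolding damping_def by (intro tendsto_intros damping_rate) (simp del: of_nat_Suc)
  moreover have "real (Suc n - k) * 1 ^ k + real k * 1 ^ (Suc n - k) = real (Suc n)" using k by simp
  ultimately show ?thesis by (simp del: of_nat_Suc)
qed

abbreviation damp :: "nat \<Rightarrow> nat \<Rightarrow> (nat \<Rightarrow> real) \<Rightarrow> nat \<Rightarrow> real" where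
  "damp n m a \<equiv> \<lambda>k\<in>{1..n}. damping (Suc n) (damping_rate m) k * a k"

text \<open>Quantitative closedness: zeros on the circle keep every factor |z - w_i| at least ||z| -
  1|. At a point z off the circle the damped values thus stay away from 0, whereas they converge to
  p(z).\<close>

lemma W_if_damped:
  assumes a: "a \<in> space (lborels {1..n})" and d: "\<And>m. damp n m a \<in> W (Suc n)"
  shows "a \<in> W (Suc n)"
  unfolding W_iff
proof (intro conjI allI impI a, rule ccontr)
  fix z assume z: "poly (assoc_poly (Suc n) a) z = 0" "norm z \<noteq> 1"
  define e where "e = \<bar>norm z - 1\<bar> ^ Suc n"
  have e: "0 < e" using z by (simp add: e_def del: power_Suc)
  have "e \<le> norm (poly (assoc_poly (Suc n) (damp n m a)) z)" for m
  proof -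
    obtain w where w: "is_roots (Suc n) ((coeff_c (Suc n) (damp n m a))(Suc n := 1)) w" using exists_roots by blast
    have "\<bar>norm z - 1\<bar> \<le> norm (z - w i)" if i: "i < Suc n" for i
    proof -
      have "poly (assoc_poly (Suc n) (damp n m a)) (w i) = 0"
        unfolding poly_assoc_poly by (rule is_roots_zero[OF w i])
      then have "norm (w i) = 1" using d[of m] by (simp add: W_iff)
      then show ?thesis using norm_triangle_ineq3[of z "w i"] by simp
    qed
    then have "(\<Prod>i<Suc n. \<bar>norm z - 1\<bar>) \<le> (\<Prod>i<Suc n. norm (z - w i))"
      by (intro prod_mono) auto
    also have "\<dots> = norm (poly (assoc_poly (Suc n) (damp n m a)) z)"
      using w unfolding poly_assoc_poly is_roots_def by (simp only: prod_norm)
    finally show ?thesis by (simp only: e_def prod_constant card_lessThan)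
  qed
  moreover have "(\<lambda>m. norm (poly (assoc_poly (Suc n) (damp n m a)) z)) \<longlonglongrightarrow> 0"
  proof -
    have p: "poly (assoc_poly (Suc n) b) z = z ^ Suc n + (\<Sum>k = 1..n. coeff_c (Suc n) b k * z ^ (Suc n - k)) + 1" for b
      by (simp add: assoc_poly_def poly_monom poly_sum)
    have "(\<lambda>m. coeff_c (Suc n) (damp n m a) k) \<longlonglongrightarrow> coeff_c (Suc n) a k" if k: "k \<in> {1..n}" for k
    proof -
      have "(\<lambda>m. of_real (damping (Suc n) (damping_rate m) k) * coeff_c (Suc n) a k) \<longlonglongrightarrow> of_real 1 * coeff_c (Suc n) a k"
        by (intro tendsto_intros tendsto_damping k)
      then show ?thesis unfolding coeff_c_damping[OF k] by simp
    qed
    then have "(\<lambda>m. poly (assoc_poly (Suc n) (damp n m a)) z) \<longlonglongrightarrow> poly (assoc_poly (Suc n) a) z"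
      unfolding p by (intro tendsto_intros)
    then show ?thesis unfolding z(1) by (rule tendsto_norm_zero)
  qed
  ultimately have "e \<le> 0"
    by (intro tendsto_lowerbound[where F = sequentially]) auto
  with e show False by simp
qed

lemma scales_damp:
  "scales (lborels {1..n}) (damp n m) (ennreal (\<Prod>k\<in>{1..n}. damping (Suc n) (damping_rate m) k))"
proof (rule scales_cong[OF scales_lborels_coordinatewise])
  fix k assume "k \<in> {1..n}"
  then have "0 < damping (Suc n) (damping_rate m) k" by (intro damping_pos damping_rate)
  then show "scales lborel (\<lambda>x. damping (Suc n) (damping_rate m) k * x) (ennreal (damping (Suc n) (damping_rate m) k))"
    using scales_lborel_affine[of "damping (Suc n) (damping_rate m) k" "0::real"] by simp
next
  show "(\<Prod>k\<in>{1..n}. ennreal (damping (Suc n) (damping_rate m) k)) = ennreal (\<Prod>k\<in>{1..n}. damping (Suc n) (damping_rate m) k)"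
    by (rule prod_ennreal) (auto intro!: less_imp_le[OF damping_pos] damping_rate)
qed auto

text \<open>\<open>damping_W\<close> gives one inclusion, the closedness in
  \<open>W_if_damped\<close> the other. A countable intersection of preimages of
  \<open>W_simple\<close> is measurable.\<close>

lemma W_eq_Inter_damped:
  "W (Suc n) = (\<Inter>m. damp n m -` W_simple (Suc n) \<inter> space (lborels {1..n}))"
proof (intro equalityI subsetI)
  fix a assume "a \<in> W (Suc n)"
  then show "a \<in> (\<Inter>m. damp n m -` W_simple (Suc n) \<inter> space (lborels {1..n}))"
    using damping_W[OF _ damping_rate(1,2)] W_iff by blast
next
  fix a assume a: "a \<in> (\<Inter>m. damp n m -` W_simple (Suc n) \<inter> space (lborels {1..n}))"
  then have s: "a \<in> space (lborels {1..n})" by blast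
  have "damp n m a \<in> W (Suc n)" for m using a unfolding W_simple_def by blast
  then show "a \<in> W (Suc n)" by (rule W_if_damped[OF s])
qed

lemma damped_measurable: "damp n m -` W_simple (Suc n) \<inter> space (lborels {1..n}) \<in> sets (lborels {1..n})"
  by (rule measurable_sets[OF scales_measurable[OF scales_damp] W_simple_measurable])

lemma W_measurable: "W (Suc n) \<in> sets (lborels {1..n})"
  unfolding W_eq_Inter_damped using damped_measurable by (intro sets.countable_INT) auto

text \<open>\<open>W\<close> lies in each damped preimage of \<open>W_simple\<close>, so its measure
  times the determinant is at most that of \<open>W_simple\<close>, and the determinants tend to
  1.\<close>

lemma emeasure_W: "emeasure (lborels {1..n}) (W (Suc n)) = emeasure (lborels {1..n}) (W_simple (Suc n))"
proof (rule antisym)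
  let ?\<mu> = "emeasure (lborels {1..n})"
  let ?d = "\<lambda>m. \<Prod>k\<in>{1..n}. damping (Suc n) (damping_rate m) k"
  show "?\<mu> (W_simple (Suc n)) \<le> ?\<mu> (W (Suc n))"
    by (rule emeasure_mono[OF _ W_measurable]) (auto simp: W_simple_def)
  have le: "?\<mu> (W (Suc n)) * ennreal (?d m) \<le> ?\<mu> (W_simple (Suc n))" for m
  proof -
    let ?D = "damp n m -` W_simple (Suc n) \<inter> space (lborels {1..n})"
    have "?\<mu> (W (Suc n)) \<le> ?\<mu> ?D"
      by (rule emeasure_mono[OF _ damped_measurable]) (use W_eq_Inter_damped in blast)
    also have "?\<mu> ?D = (\<integral>\<^sup>+a. indicator ?D a \<partial>lborels {1..n})"
      using damped_measurable by simp
    also have "\<dots> = (\<integral>\<^sup>+a. indicator (W_simple (Suc n)) (damp n m a) \<partial>lborels {1..n})"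
      by (rule nn_integral_cong) (auto simp: indicator_def)
    finally have "?\<mu> (W (Suc n)) * ennreal (?d m) \<le> (\<integral>\<^sup>+a. indicator (W_simple (Suc n)) (damp n m a) \<partial>lborels {1..n}) * ennreal (?d m)"
      by (rule mult_right_mono) simp
    also have "\<dots> = ?\<mu> (W_simple (Suc n))"
      using scalesD[OF scales_damp, of "indicator (W_simple (Suc n))"] W_simple_measurable by simp
    finally show ?thesis .
  qed
  have dpos: "0 < ?d m" for m by (intro prod_pos ballI damping_pos damping_rate)
  \<comment> \<open>Finiteness allows the passage to the limit in the product with the determinants;
    it follows from the bound at m = 0, as \<open>W_simple\<close> has finite measure.\<close>
  have "?\<mu> (W (Suc n)) < top"
  proof (rule ccontr)
    assume "\<not> ?\<mu> (W (Suc n)) < top"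
    then have "?\<mu> (W (Suc n)) = top" by (simp only: less_top[symmetric] not_not)
    moreover have "ennreal (?d 0) \<noteq> 0" using dpos[of 0] by (simp only: ennreal_eq_0_iff not_le)
    ultimately have "top \<le> ?\<mu> (W_simple (Suc n))"
      using le[of 0] by (simp only: ennreal_top_mult if_False)
    then show False unfolding emeasure_W_simple by (simp only: top_unique ennreal_neq_top)
  qed
  moreover have "?d \<longlonglongrightarrow> (\<Prod>k\<in>{1..n}. 1)"
    by (intro tendsto_prod tendsto_damping)
  then have "(\<lambda>m. ennreal (?d m)) \<longlonglongrightarrow> ennreal 1" by (intro tendsto_ennrealI) simp
  ultimately have "(\<lambda>m. ?\<mu> (W (Suc n)) * ennreal (?d m)) \<longlonglongrightarrow> ?\<mu> (W (Suc n)) * ennreal 1"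
    by (intro ennreal_tendsto_cmult)
  then show "?\<mu> (W (Suc n)) \<le> ?\<mu> (W_simple (Suc n))"
    by (intro LIMSEQ_le_const2[where X = "\<lambda>m. ?\<mu> (W (Suc n)) * ennreal (?d m)"]) (use le in auto)
qed

theorem theorem4:
  fixes N :: nat
  assumes "N \<ge> 2"
  shows "emeasure (PiM {1..N - 1} (\<lambda>_. lborel)) (W N)
           = ennreal (2 ^ (N - 1) * pi powr (real (N - 1) / 2) / Gamma (real (N + 1) / 2))"
proof -
  obtain n where N: "N = Suc n" using assms by (cases N) auto
  have "real (N + 1) = real n + 2" by (simp add: N)
  then show ?thesis using emeasure_W[of n] emeasure_W_simple[of n] by (simp add: N add.commute)
qed

end
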